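(* Assume that $$\lim_{m\to\infty}\alpha_m^{\mathbf a}=\alpha\quad\text{and}\quad\lim_{n\to\infty}\beta_n^{\mathbf b}=\beta\quad\text{in the vague topology},$$ $$\lim_{m\to\infty}\min\mathbf a_m=\mathfrak a\quad\text{and}\quad\lim_{n\to\infty}\min\mathbf b_n=\mathfrak b$$ for some subprobability measures $\alpha,\beta$ on $\mathbb R$ and some $\mathfrak a,\mathfrak b\in\mathbb R\cup\{\infty\}$ with $\mathfrak a+\mathfrak b>0$. Then for any $\epsilon>0$, $\mathbf P$-almost surely, there exists a random $L\in\mathbb Z_{>0}$ such that $$|\mathrm G^{\mathbf a,\mathbf b}(m,n)-\gamma(m,n)|\le\epsilon(m+n)\qquad\text{for all } m,n\in\mathbb Z_{\ge L},$$ where, for $x,y>0$, $$\gamma(x,y)=\inf_{z\in(-\mathfrak a,\mathfrak b)}\Big\{x\int_{\mathbb R}\frac{\alpha(\mathrm da)}{a+z}+y\int_{\mathbb R}\frac{\beta(\mathrm db)}{b-z}\Big\}.$$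
   Context: $[n]=\{1,\dots,n\}$; $\mathrm{Exp}(\lambda)$ is the exponential distribution with rate $\lambda$ (mean $1/\lambda$). Fix two collections of real parameters $\mathbf a=\{\mathbf a_m(i):m\in\mathbb Z_{>0},i\in[m]\}$ and $\mathbf b=\{\mathbf b_n(j):n\in\mathbb Z_{>0},j\in[n]\}$ such that $\mathbf a_m(i)+\mathbf b_n(j)>0$ for all $m,n\in\mathbb Z_{>0}$, $i\in[m]$, $j\in[n]$. Write $\min\mathbf a_m=\min_{i\in[m]}\mathbf a_m(i)$ and $\min\mathbf b_n=\min_{j\in[n]}\mathbf b_n(j)$. Let $\alpha_m^{\mathbf a}=\frac1m\sum_{i=1}^m\delta_{\mathbf a_m(i)}$ and $\beta_n^{\mathbf b}=\frac1n\sum_{j=1}^n\delta_{\mathbf b_n(j)}$ be the empirical distributions. Vague convergence $\mu_n\to\mu$ of finite Borel measures on $\mathbb R$ means $\int f\,\mathrm d\mu_n\to\int f\,\mathrm d\mu$ for every continuous $f:\mathbb R\to\mathbb R$ vanishing at infinity. A subprobability measure is a nonnegative Borel measure of total mass at most $1$ (the zero measure is allowed). The convergence assumptions imply $\mathfrak a\le\inf\operatorname{supp}\alpha$ and $\mathfrak b\le\inf\operatorname{supp}\beta$ (with $\inf\emptyset=\infty$), so the integrals defining $\gamma$ make sense. Let $(\Omega,\mathbf P)$ be $\Omega=\mathbb R^{\mathbb Z_{>0}^2}$ with the product measure under which the coordinates are i.i.d. $\mathrm{Exp}(1)$. For each $m,n\in\mathbb Z_{>0}$ let $\{\omega_{m,n}^{\mathbf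 a,\mathbf b}(i,j): i\in[m],j\in[n]\}$ be independent random variables on $(\Omega,\mathbf P)$ with $\omega_{m,n}^{\mathbf a,\mathbf b}(i,j)\sim\mathrm{Exp}(\mathbf a_m(i)+\mathbf b_n(j))$; no assumption is made about the joint distribution of these collections for different $(m,n)$. The last-passage time is $$\mathrm G^{\mathbf a,\mathbf b}(m,n)=\max_{\pi}\sum_{(i,j)\in\pi}\omega^{\mathbf a,\mathbf b}_{m,n}(i,j),$$ the maximum over all up-right lattice paths $\pi$ from $(1,1)$ to $(m,n)$ (steps $(1,0)$ or $(0,1)$). *)

theory Defs
  imports "HOL-Probability.Probability"
begin

text \<open>
  A triangular array \<open>{a m i : m \<ge> 1, i \<in> {1..m}}\<close> is a function \<open>a :: nat \<Rightarrow> nat \<Rightarrow> real\<close>;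
  the values outside this index range are never used.
\<close>

definition row_min :: "(nat \<Rightarrow> nat \<Rightarrow> real) \<Rightarrow> nat \<Rightarrow> real" where
  "row_min a m = Min (a m ` {1..m})"

text \<open>The push-forward of the uniform distribution on \<open>{1..m}\<close> is
  \<open>(1/m) \<Sum>i=1..m. \<delta>(a m i)\<close>, repeated values being counted with multiplicity.\<close>

definition empirical_distribution :: "(nat \<Rightarrow> nat \<Rightarrow> real) \<Rightarrow> nat \<Rightarrow> real measure" where
  "empirical_distribution a m = distr (uniform_count_measure {1..m}) borel (a m)"

definition vague_convergence :: "(nat \<Rightarrow> real measure) \<Rightarrow> real measure \<Rightarrow> bool" where
  "vague_convergence M N \<longleftrightarrow>
     (\<forall>f :: real \<Rightarrow> real. continuous_on UNIV f \<and> (f \<longlongrightarrow> 0) at_infinity \<longrightarrow>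
        (\<lambda>n. \<integral>x. f x \<partial>M n) \<longlonglongrightarrow> (\<integral>x. f x \<partial>N))"

definition subprobability_on_reals :: "real measure \<Rightarrow> bool" where
  "subprobability_on_reals M \<longleftrightarrow> sets M = sets borel \<and> subprob_space M"

text \<open>The probability space \<open>\<Omega>\<close> of i.i.d. Exp(1) coordinates indexed by pairs of positive integers.\<close>

definition iid_exp_space :: "(nat \<times> nat \<Rightarrow> real) measure" where
  "iid_exp_space = PiM ({1..} \<times> {1..}) (\<lambda>_. density lborel (exponential_density 1))"

definition up_right_step :: "nat \<times> nat \<Rightarrow> nat \<times> nat \<Rightarrow> bool" where
  "up_right_step p q \<longleftrightarrow> q = (fst p + 1, snd p) \<or> q = (fst p, snd p + 1)"

definition up_right_paths :: "nat \<Rightarrow> nat \<Rightarrow> (nat \<times> nat) list set" where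
  "up_right_paths m n =
     {\<pi>. \<pi> \<noteq> [] \<and> hd \<pi> = (1, 1) \<and> last \<pi> = (m, n) \<and> successively up_right_step \<pi>}"

definition last_passage_time :: "(nat \<times> nat \<Rightarrow> real) \<Rightarrow> nat \<Rightarrow> nat \<Rightarrow> real" where
  "last_passage_time w m n = Max ((\<lambda>\<pi>. \<Sum>p\<in>set \<pi>. w p) ` up_right_paths m n)"

text \<open>The endpoints \<open>\<aa>\<close>, \<open>\<bb>\<close> may be infinite, hence \<open>z\<close> ranges over those reals with
  \<open>-\<aa> < z < \<bb>\<close> in the extended reals.  For \<open>\<aa>\<close> and \<open>\<bb>\<close> bounding the supports of \<open>\<alpha>\<close> and \<open>\<beta>\<close>
  from below, both integrands are nonnegative and bounded almost everywhere, so the integrals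
  are genuine and the infimum is over a set bounded below by \<open>0\<close>; it is nonempty
  when \<open>\<aa> + \<bb> > 0\<close> and neither endpoint is \<open>-\<infinity>\<close>.\<close>

definition shape_function ::
  "real measure \<Rightarrow> real measure \<Rightarrow> ereal \<Rightarrow> ereal \<Rightarrow> real \<Rightarrow> real \<Rightarrow> real" where
  "shape_function \<alpha> \<beta> \<aa> \<bb> x y =
     (INF z\<in>{z :: real. - \<aa> < ereal z \<and> ereal z < \<bb>}.
        x * (\<integral>a. 1 / (a + z) \<partial>\<alpha>) + y * (\<integral>b. 1 / (b - z) \<partial>\<beta>))"

end

theory Submission
  imports Defs "HOL-Real_Asymp.Real_Asymp"
begin

text \<open>
  For a parameter \<open>z\<close> add boundary weights of rates \<open>a i + z\<close> and \<open>b j - z\<close> on the axes.  By Burke's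
  theorem the increments of this stationary model along the top right boundary are again independent
  exponentials, so its passage time concentrates at \<open>M z = (\<Sum>i. 1 / (a i + z)) + (\<Sum>j. 1 / (b j - z))\<close>,
  which bounds the original passage time from above for every \<open>z\<close>.

  For the lower bound take \<open>z\<close> with \<open>M' z = 0\<close>.  If the stationary maximizer left the axis at a
  macroscopic distance, the upper bound at \<open>z - \<delta>\<close> or \<open>z + \<delta>\<close>, applied to the rest of the path, would
  be violated, because \<open>M\<close> is flat to second order at \<open>z\<close>.  So the boundary contributes little, and
  the passage time is at least \<open>M z - \<epsilon> (m + n)\<close>.  If \<open>M'\<close> has no zero at distance \<open>\<eta>\<close> from the
  endpoints, say because the minimal rate \<open>a p\<close> dominates, then \<open>z = \<eta> - a p\<close> works: two smaller
  rectangles, left and right of column \<open>p\<close>, are critical for this \<open>z\<close>, and the path between them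
  follows column \<open>p\<close>.

  All error probabilities decay exponentially in \<open>m + n\<close>, so the Borel-Cantelli lemma applies whatever
  the coupling of the arrays; the deterministic part compares \<open>M z\<close> with the shape function, uniformly
  in the direction.
\<close>

section \<open>Last-passage times as a recursion\<close>

text \<open>All models live on one field of unit exponentials divided by rates. A bulk weight has
  rate \<open>(a i + z) + (b j - z) = a i + b j\<close>, so a change of z alters the boundary
  weights but not the bulk: the stationary model at z can be tested against upper bounds at
  \<open>z - \<delta>\<close> and \<open>z + \<delta>\<close> on the very same weights. Exit costs
  are then known up to multiples of \<delta> and s / \<delta>, for a deviation level s, and get
  divided by a threshold \<theta> of order \<epsilon>; this forces \<delta> of order
  \<open>\<epsilon>\<^sup>2\<close> and s of order \<open>\<epsilon>\<^sup>2 * \<delta>\<close>. The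
  empirical distributions do not see a single small rate, and the critical z may run into the pole
  of that rate. Concentration needs rates bounded below, hence the margin \<eta> and the separate
  argument for a dominating column. The tail bounds are stated for arbitrary rows of rates, with
  constants that depend on the margins only: the rows change with m and n, and nothing relates them
  beyond the limits of averages and minima.\<close>

fun lpp :: "(nat \<times> nat \<Rightarrow> real) \<Rightarrow> nat \<Rightarrow> nat \<Rightarrow> real" where
  "lpp w 0 0 = 0"
| "lpp w (Suc i) 0 = lpp w i 0 + w (Suc i, 0)"
| "lpp w 0 (Suc j) = lpp w 0 j + w (0, Suc j)"
| "lpp w (Suc i) (Suc j) = w (Suc i, Suc j) + max (lpp w i (Suc j)) (lpp w (Suc i) j)"

text \<open>With zero weights on both axes, and nonnegative weights elsewhere, the recursion
  computes the maximum over paths that start at (1, 1); with weights on the axes it is the passage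
  time of a model with boundary. The weight at (0, 0) never enters \<open>lpp\<close>.\<close>

definition bulk :: "(nat \<times> nat \<Rightarrow> real) \<Rightarrow> nat \<times> nat \<Rightarrow> real" where
  "bulk w = (\<lambda>(i, j). if i = 0 \<or> j = 0 then 0 else w (i, j))"

definition offset :: "nat \<Rightarrow> nat \<Rightarrow> (nat \<times> nat \<Rightarrow> 'a) \<Rightarrow> nat \<times> nat \<Rightarrow> 'a" where
  "offset p q w = (\<lambda>(i, j). w (p + i, q + j))"

lemma bulk_axis [simp]: "bulk w (0, j) = 0" "bulk w (i, 0) = 0"
  and bulk_Suc [simp]: "bulk w (Suc i, Suc j) = w (Suc i, Suc j)"
  by (simp_all add: bulk_def)

lemma offset_apply [simp]: "offset p q w (i, j) = w (p + i, q + j)"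
  by (simp add: offset_def)

lemma bulk_shift_bulk: "bulk (offset p q (bulk w)) = bulk (offset p q w)"
  by (auto simp: bulk_def offset_def)

lemma lpp_axis_sum: "lpp w i 0 = (\<Sum>k=1..i. w (k, 0))" "lpp w 0 j = (\<Sum>k=1..j. w (0, k))"
  by (induction i, simp_all) (induction j, simp_all)

lemma lpp_bulk_axis [simp]: "lpp (bulk w) i 0 = 0" "lpp (bulk w) 0 j = 0"
  by (simp_all add: lpp_axis_sum)

lemma lpp_cong:
  assumes "\<And>i j. i \<le> m \<Longrightarrow> j \<le> n \<Longrightarrow> (i, j) \<noteq> (0, 0) \<Longrightarrow> w (i, j) = w' (i, j)"
  shows "lpp w m n = lpp w' m n"
  using assms by (induction w m n rule: lpp.induct) auto

lemma lpp_mono: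
  assumes "\<And>i j. i \<le> m \<Longrightarrow> j \<le> n \<Longrightarrow> (i, j) \<noteq> (0, 0) \<Longrightarrow> w (i, j) \<le> w' (i, j)"
  shows "lpp w m n \<le> lpp w' m n"
  using assms
proof (induction w m n rule: lpp.induct)
  case (4 w i j)
  have "lpp w i (Suc j) \<le> lpp w' i (Suc j)" "lpp w (Suc i) j \<le> lpp w' (Suc i) j"
    using 4 by auto
  moreover have "w (Suc i, Suc j) \<le> w' (Suc i, Suc j)" using 4(3) by auto
  ultimately show ?case by (auto simp: max_def)
qed (auto intro!: add_mono)

lemma bulk_nonneg: "(\<And>p. 0 \<le> w p) \<Longrightarrow> 0 \<le> bulk w p"
  by (cases p) (simp add: bulk_def)

lemma lpp_bulk_le: "(\<And>p. 0 \<le> w p) \<Longrightarrow> lpp (bulk w) m n \<le> lpp w m n"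
  by (intro lpp_mono) (auto simp: bulk_def)

lemma lpp_step_mono:
  assumes "\<And>p. 0 \<le> w p"
  shows "lpp w i j \<le> lpp w (Suc i) j" "lpp w i j \<le> lpp w i (Suc j)"
proof -
  show "lpp w i j \<le> lpp w (Suc i) j"
    by (cases j) (simp_all add: assms add_increasing max.coboundedI1)
  show "lpp w i j \<le> lpp w i (Suc j)"
    by (cases i) (simp_all add: assms add_increasing max.coboundedI2)
qed

lemma lpp_add_mono:
  assumes "\<And>p. 0 \<le> w p"
  shows "lpp w i j \<le> lpp w (i + k) (j + l)"
proof -
  have "lpp w i j \<le> lpp w (i + k) j"
    by (induction k) (auto intro: order_trans[OF _ lpp_step_mono(1)[OF assms]])
  also have "\<dots> \<le> lpp w (i + k) (j + l)"
    by (induction l) (auto intro: order_trans[OF _ lpp_step_mono(2)[OF assms]])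
  finally show ?thesis .
qed

lemma lpp_nonneg: "(\<And>p. 0 \<le> w p) \<Longrightarrow> 0 \<le> lpp w i j"
  using lpp_add_mono[of w 0 0 i j] by simp

text \<open>A maximal path to (p, q) continues with one that starts at (p + 1, q + 1); the corner
  between them only adds a nonnegative weight. On the axes of the shifted rectangle the second term
  is 0 and monotonicity suffices.\<close>

lemma lpp_superadditive:
  assumes "\<And>p. 0 \<le> w p"
  shows "lpp w p q + lpp (bulk (offset p q w)) i j \<le> lpp w (p + i) (q + j)"
proof (induction "bulk (offset p q w)" i j rule: lpp.induct)
  case 1
  then show ?case by simp
next
  case (2 i)
  then show ?case using lpp_add_mono[where w=w and i=p and j=q and k="Suc i" and l=0, OF assms] by simp
next
  case (3 j)
  then show ?case using lpp_add_mono[where w=w and i=p and j=q and k=0 and l="Suc j", OF assms] by simp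
next
  case (4 i j)
  then show ?case by (auto simp: max_def)
qed

lemma lpp_bulk_superadditive:
  assumes "\<And>p. 0 \<le> w p"
  shows "lpp (bulk w) p q + lpp (bulk (offset p q w)) i j \<le> lpp (bulk w) (p + i) (q + j)"
  using lpp_superadditive[where w="bulk w", OF bulk_nonneg[OF assms], where p=p and q=q and i=i and j=j] by (simp add: bulk_shift_bulk)

lemma lpp_bulk_shift_le:
  assumes "\<And>p. 0 \<le> w p" "p \<le> m" "q \<le> n"
  shows "lpp (bulk (offset p q w)) (m - p) (n - q) \<le> lpp (bulk w) m n"
  using lpp_bulk_superadditive[where w=w and p=p and q=q and i="m - p" and j="n - q", OF assms(1)]
    lpp_nonneg[where w="bulk w" and i=p and j=q, OF bulk_nonneg[OF assms(1)]] assms(2,3) by simp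

lemma lpp_bulk_column: "lpp (bulk w) 1 n = (\<Sum>j=1..n. w (1, j))" if "\<And>p. 0 \<le> w p"
proof (induction n)
  case (Suc n)
  have "0 \<le> (\<Sum>j=1..n. w (1, j))" by (simp add: sum_nonneg that)
  then show ?case using Suc by (simp add: max_def)
qed (simp add: lpp_axis_sum)

lemma lpp_transpose: "lpp (\<lambda>(i, j). w (j, i)) m n = lpp w n m"
  by (induction w n m rule: lpp.induct) (auto simp: max.commute)

text \<open>A maximal path leaves the axes either from \<open>(k, 0)\<close> or from \<open>(0, l)\<close>.  The truncated
  \<open>k - 1\<close> covers \<open>k = 0\<close>, which is only used for degenerate rectangles.\<close>

lemma lpp_exit:
  "(\<exists>k\<le>m. lpp w m n \<le> (\<Sum>i=1..k. w (i, 0)) + lpp (bulk (offset (k - 1) 0 w)) (m - (k - 1)) n) \<or>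
   (\<exists>l\<le>n. lpp w m n \<le> (\<Sum>j=1..l. w (0, j)) + lpp (bulk (offset 0 (l - 1) w)) m (n - (l - 1)))"
  (is "?A m n \<or> ?B m n")
proof (induction w m n rule: lpp.induct)
  case (1 w)
  then show ?case by auto
next
  case (2 w i)
  have "lpp w (Suc i) 0 = (\<Sum>i=1..Suc i. w (i, 0))" by (simp only: lpp_axis_sum)
  then show ?case by (intro disjI1 exI[of _ "Suc i"]) simp
next
  case (3 w j)
  have "lpp w 0 (Suc j) = (\<Sum>i=1..Suc j. w (0, i))" by (simp only: lpp_axis_sum)
  then show ?case by (intro disjI2 exI[of _ "Suc j"]) simp
next
  case (4 w i j)
  have rec1: "v (Suc a, Suc b) + lpp v a (Suc b) \<le> lpp v (Suc a) (Suc b)"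
    and rec2: "v (Suc a, Suc b) + lpp v (Suc a) b \<le> lpp v (Suc a) (Suc b)"
    for v :: "nat \<times> nat \<Rightarrow> real" and a b by auto
  \<comment> \<open>The restarted rectangle obeys the same recursion at its top right corner, so the
    last weight can be absorbed into its passage time.\<close>
  have right: "w (Suc i, Suc j) + lpp (bulk (offset p q w)) (i - p) (Suc j - q)
      \<le> lpp (bulk (offset p q w)) (Suc i - p) (Suc j - q)" if "p \<le> i" "q \<le> j" for p q
    using rec1[of "bulk (offset p q w)" "i - p" "j - q"] that by (simp add: Suc_diff_le)
  have up: "w (Suc i, Suc j) + lpp (bulk (offset p q w)) (Suc i - p) (j - q)
      \<le> lpp (bulk (offset p q w)) (Suc i - p) (Suc j - q)" if "p \<le> i" "q \<le> j" for p q
    using rec2[of "bulk (offset p q w)" "i - p" "j - q"] that by (simp add: Suc_diff_le)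
  consider "lpp w (Suc i) (Suc j) = w (Suc i, Suc j) + lpp w i (Suc j)"
    | "lpp w (Suc i) (Suc j) = w (Suc i, Suc j) + lpp w (Suc i) j"
    by (cases "lpp w i (Suc j) \<le> lpp w (Suc i) j") (auto simp: max_def)
  then show ?case
  proof cases
    case 1
    from 4(1) show ?thesis
    proof (elim disjE exE conjE)
      fix k assume k: "k \<le> i" "lpp w i (Suc j) \<le>
        (\<Sum>i=1..k. w (i, 0)) + lpp (bulk (offset (k - 1) 0 w)) (i - (k - 1)) (Suc j)"
      then have "k - 1 \<le> i" by simp
      from 1 k right[OF this, of 0] show ?thesis by (intro disjI1 exI[of _ k]) auto
    next
      fix l assume k: "l \<le> Suc j" "lpp w i (Suc j) \<le>
        (\<Sum>j=1..l. w (0, j)) + lpp (bulk (offset 0 (l - 1) w)) i (Suc j - (l - 1))"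
      then have "l - 1 \<le> j" by simp
      from 1 k right[OF le0 this] show ?thesis by (intro disjI2 exI[of _ l]) auto
    qed
  next
    case 2
    from 4(2) show ?thesis
    proof (elim disjE exE conjE)
      fix k assume k: "k \<le> Suc i" "lpp w (Suc i) j \<le>
        (\<Sum>i=1..k. w (i, 0)) + lpp (bulk (offset (k - 1) 0 w)) (Suc i - (k - 1)) j"
      then have "k - 1 \<le> i" by simp
      from 2 k up[OF this, of 0] show ?thesis by (intro disjI1 exI[of _ k]) auto
    next
      fix l assume k: "l \<le> j" "lpp w (Suc i) j \<le>
        (\<Sum>j=1..l. w (0, j)) + lpp (bulk (offset 0 (l - 1) w)) (Suc i) (j - (l - 1))"
      then have "l - 1 \<le> j" by simp
      from 2 k up[OF le0 this] show ?thesis by (intro disjI2 exI[of _ l]) auto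
    qed
  qed
qed

section \<open>Up-right paths and the recursion\<close>

lemma up_right_path_coords:
  assumes "successively up_right_step \<pi>" "\<pi> \<noteq> []" "p \<in> set \<pi>"
  shows "fst (hd \<pi>) \<le> fst p \<and> snd (hd \<pi>) \<le> snd p \<and> fst p \<le> fst (last \<pi>) \<and> snd p \<le> snd (last \<pi>)
    \<and> length \<pi> + (fst (hd \<pi>) + snd (hd \<pi>)) = Suc (fst (last \<pi>) + snd (last \<pi>))"
  using assms
proof (induction \<pi> arbitrary: p)
  case (Cons x xs)
  show ?case
  proof (cases "xs = []")
    case False
    then have s: "up_right_step x (hd xs)" "successively up_right_step xs"
      using Cons.prems by (auto simp: successively_Cons)
    have "hd xs \<in> set xs" using False by simp
    note a = Cons.IH[OF s(2) False this]
    show ?thesis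
    proof (cases "p = x")
      case True
      then show ?thesis using a s False by (auto simp: up_right_step_def)
    next
      case n: False
      then have "p \<in> set xs" using Cons.prems by auto
      from Cons.IH[OF s(2) False this] show ?thesis using s False
        by (auto simp: up_right_step_def)
    qed
  qed (use Cons.prems in auto)
qed auto

lemma finite_up_right_paths: "finite (up_right_paths m n)"
proof (rule finite_subset)
  show "up_right_paths m n \<subseteq> {\<pi>. set \<pi> \<subseteq> {..m} \<times> {..n} \<and> length \<pi> \<le> Suc (m + n)}"
  proof
    fix \<pi> assume p: "\<pi> \<in> up_right_paths m n"
    have "i \<le> m \<and> j \<le> n" if "(i, j) \<in> set \<pi>" for i j
      using up_right_path_coords[of \<pi>, OF _ _ that] p by (auto simp: up_right_paths_def)
    moreover have "length \<pi> \<le> Suc (m + n)"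
      using up_right_path_coords[of \<pi> "hd \<pi>"] hd_in_set[of \<pi>] p
      by (auto simp: up_right_paths_def simp del: hd_in_set)
    ultimately show "\<pi> \<in> {\<pi>. set \<pi> \<subseteq> {..m} \<times> {..n} \<and> length \<pi> \<le> Suc (m + n)}" by auto
  qed
  show "finite {\<pi>. set \<pi> \<subseteq> {..m} \<times> {..n} \<and> length \<pi> \<le> Suc (m + n)}"
    by (rule finite_lists_length_le) simp
qed

text \<open>Coordinates on a path never exceed those of its last point, so the new point is fresh.
  This is what makes the sum over \<open>set \<pi>\<close> grow by exactly the weight of that
  point.\<close>

lemma up_right_paths_snoc:
  assumes "\<pi> \<in> up_right_paths i j" "up_right_step (i, j) q"
  shows "\<pi> @ [q] \<in> up_right_paths (fst q) (snd q)" "q \<notin> set \<pi>"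
proof -
  show "\<pi> @ [q] \<in> up_right_paths (fst q) (snd q)"
    using assms by (auto simp: up_right_paths_def successively_append_iff)
  show "q \<notin> set \<pi>"
    using assms up_right_path_coords[of \<pi> q] by (auto simp: up_right_paths_def up_right_step_def)
qed

lemma up_right_paths_cases:
  assumes "\<pi> \<in> up_right_paths m n" "(m, n) \<noteq> (1, 1)"
  obtains i j \<rho> where "\<rho> \<in> up_right_paths i j" "up_right_step (i, j) (m, n)" "\<pi> = \<rho> @ [(m, n)]"
    "i \<ge> 1" "j \<ge> 1"
proof -
  from assms have ne: "\<pi> \<noteq> []" "last \<pi> = (m, n)" "hd \<pi> = (1, 1)" "successively up_right_step \<pi>"
    by (auto simp: up_right_paths_def)
  then obtain \<rho> where r: "\<pi> = \<rho> @ [(m, n)]" by (metis append_butlast_last_id)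
  with ne assms(2) have r0: "\<rho> \<noteq> []" by auto
  obtain i j where l: "last \<rho> = (i, j)" by (cases "last \<rho>")
  have s: "successively up_right_step \<rho>" "up_right_step (i, j) (m, n)"
    using ne(4) r r0 l by (auto simp: successively_append_iff)
  have h: "hd \<rho> = (1, 1)" using ne r r0 by auto
  have "i \<ge> 1" "j \<ge> 1"
    using up_right_path_coords[OF s(1) r0, of "(i, j)"] l h r0 last_in_set[OF r0] by auto
  moreover have "\<rho> \<in> up_right_paths i j" using s h l r0 by (auto simp: up_right_paths_def)
  ultimately show ?thesis using that s r by blast
qed

lemma lpp_path_bound:
  assumes w: "\<And>p. 0 \<le> w p"
  shows "\<pi> \<in> up_right_paths (Suc m) (Suc n) \<Longrightarrow> (\<Sum>p\<in>set \<pi>. w p) \<le> lpp (bulk w) (Suc m) (Suc n)"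
proof (induction "m + n" arbitrary: m n \<pi>)
  case 0
  then have "m = 0" "n = 0" by auto
  moreover have "length \<pi> = 1"
    using 0 up_right_path_coords[of \<pi> "hd \<pi>"] hd_in_set[of \<pi>]
    by (auto simp: up_right_paths_def simp del: hd_in_set)
  ultimately have "\<pi> = [(1, 1)]" using 0 by (auto simp: up_right_paths_def length_Suc_conv)
  then show ?case using \<open>m = 0\<close> \<open>n = 0\<close> by simp
next
  case (Suc k)
  from Suc.hyps have ne: "(Suc m, Suc n) \<noteq> (1, 1)" by auto
  from up_right_paths_cases[OF Suc.prems ne] obtain i j \<rho> where
    r: "\<rho> \<in> up_right_paths i j" "up_right_step (i, j) (Suc m, Suc n)" "\<pi> = \<rho> @ [(Suc m, Suc n)]"
    "i \<ge> 1" "j \<ge> 1" by blast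
  have nin: "(Suc m, Suc n) \<notin> set \<rho>" using up_right_paths_snoc[OF r(1,2)] by auto
  then have eq: "(\<Sum>p\<in>set \<pi>. w p) = w (Suc m, Suc n) + (\<Sum>p\<in>set \<rho>. w p)" by (simp add: r(3))
  obtain i' j' where ij: "i = Suc i'" "j = Suc j'" using r(4,5) by (metis Suc_le_D One_nat_def)
  have "(\<Sum>p\<in>set \<rho>. w p) \<le> lpp (bulk w) (Suc i') (Suc j')"
    using r(1) ij Suc.hyps(1)[of i' j' \<rho>] r(2) Suc.hyps(2) by (auto simp: up_right_step_def)
  with r(2) ij eq show ?case by (auto simp: up_right_step_def)
qed

lemma lpp_path_attained:
  assumes w: "\<And>p. 0 \<le> w p"
  shows "\<exists>\<pi>\<in>up_right_paths (Suc m) (Suc n). (\<Sum>p\<in>set \<pi>. w p) = lpp (bulk w) (Suc m) (Suc n)"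
proof (induction "m + n" arbitrary: m n)
  case 0
  then have "m = 0" "n = 0" by auto
  moreover have "[(1, 1)] \<in> up_right_paths 1 1" by (auto simp: up_right_paths_def)
  ultimately show ?case by (intro bexI[of _ "[(1,1)]"]) auto
next
  case (Suc k)
  have step: ?case if ij: "up_right_step (Suc i, Suc j) (Suc m, Suc n)"
    "lpp (bulk w) (Suc m) (Suc n) = w (Suc m, Suc n) + lpp (bulk w) (Suc i) (Suc j)" for i j
  proof -
    have "k = i + j" using ij Suc.hyps(2) by (auto simp: up_right_step_def)
    from Suc.hyps(1)[OF this] obtain \<rho> where
      r: "\<rho> \<in> up_right_paths (Suc i) (Suc j)" "(\<Sum>p\<in>set \<rho>. w p) = lpp (bulk w) (Suc i) (Suc j)"
      by blast
    show ?thesis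
      using up_right_paths_snoc[OF r(1) ij(1)] r(2) ij(2)
      by (intro bexI[of _ "\<rho> @ [(Suc m, Suc n)]"]) auto
  qed
  have nn: "0 \<le> lpp (bulk w) i j" for i j by (intro lpp_nonneg bulk_nonneg w)
  consider "n > 0" "m = 0 \<or> lpp (bulk w) m (Suc n) \<le> lpp (bulk w) (Suc m) n"
    | "m > 0" "n = 0 \<or> lpp (bulk w) (Suc m) n \<le> lpp (bulk w) m (Suc n)"
    using Suc.hyps(2) by fastforce
  then show ?case
  proof cases
    case 1
    then obtain j where "n = Suc j" by (auto simp: gr0_conv_Suc)
    moreover have "lpp (bulk w) m (Suc n) \<le> lpp (bulk w) (Suc m) n"
      using 1(2) nn[of "Suc m" n] by (cases "m = 0") auto
    ultimately show ?thesis by (intro step[of m j]) (auto simp: up_right_step_def max_def)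
  next
    case 2
    then obtain i where "m = Suc i" by (auto simp: gr0_conv_Suc)
    moreover have "lpp (bulk w) (Suc m) n \<le> lpp (bulk w) m (Suc n)"
      using 2(2) nn[of m "Suc n"] by (cases "n = 0") auto
    ultimately show ?thesis by (intro step[of i n]) (auto simp: up_right_step_def max_def)
  qed
qed

lemma last_passage_time_eq_lpp:
  assumes nn: "\<And>i j. 1 \<le> i \<Longrightarrow> i \<le> m \<Longrightarrow> 1 \<le> j \<Longrightarrow> j \<le> n \<Longrightarrow> 0 \<le> w (i, j)" and mn: "m \<ge> 1" "n \<ge> 1"
  shows "last_passage_time w m n = lpp (bulk w) m n"
proof -
  \<comment> \<open>Only the weights inside the rectangle are assumed nonnegative, whereas the path
    lemmas ask for it everywhere; the positive part agrees with w wherever a path goes.\<close>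
  define w' where "w' p = max 0 (w p)" for p
  have w': "0 \<le> w' p" for p by (simp add: w'_def)
  obtain m' n' where S: "m = Suc m'" "n = Suc n'" using mn by (metis Suc_le_D One_nat_def)
  have "w p = w' p" if "\<pi> \<in> up_right_paths m n" "p \<in> set \<pi>" for \<pi> p
    using up_right_path_coords[of \<pi> p] that nn[of "fst p" "snd p"]
    by (auto simp: up_right_paths_def w'_def)
  then have "(\<lambda>\<pi>. \<Sum>p\<in>set \<pi>. w p) ` up_right_paths m n = (\<lambda>\<pi>. \<Sum>p\<in>set \<pi>. w' p) ` up_right_paths m n"
    by (intro image_cong refl sum.cong) auto
  then have "last_passage_time w m n = last_passage_time w' m n"
    by (simp only: last_passage_time_def)
  also have "\<dots> = lpp (bulk w') m n"
    unfolding last_passage_time_def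
  proof (rule Max_eqI)
    show "finite ((\<lambda>\<pi>. sum w' (set \<pi>)) ` up_right_paths m n)"
      by (intro finite_imageI finite_up_right_paths)
    show "y \<le> lpp (bulk w') m n" if "y \<in> (\<lambda>\<pi>. sum w' (set \<pi>)) ` up_right_paths m n" for y
      using that lpp_path_bound[OF w'] S by auto
    show "lpp (bulk w') m n \<in> (\<lambda>\<pi>. sum w' (set \<pi>)) ` up_right_paths m n"
      unfolding S using lpp_path_attained[where w=w', OF w', of m' n'] by (force simp del: lpp.simps)
  qed
  also have "\<dots> = lpp (bulk w) m n"
    by (rule lpp_cong) (use nn in \<open>auto simp: bulk_def w'_def\<close>)
  finally show ?thesis .
qed

section \<open>The Burke transformation\<close>

definition exp1 :: "real measure" where
  "exp1 = density lborel (exponential_density 1)"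

text \<open>Indices run over all pairs, zero included: (i, 0) and (0, j) carry the boundary weights.
  Unit exponentials serve all rates at once, a weight of rate r being
  \<open>X p / r\<close>.\<close>

definition exp_field :: "(nat \<times> nat \<Rightarrow> real) measure" where
  "exp_field = PiM UNIV (\<lambda>_. exp1)"

lemma sets_exp1 [simp, measurable_cong]: "sets exp1 = sets borel"
  and space_exp1 [simp]: "space exp1 = UNIV"
  by (simp_all add: exp1_def)

interpretation exp1: prob_space exp1
  unfolding exp1_def by (rule prob_space_exponential_density) simp

interpretation exp_field: prob_space exp_field
  unfolding exp_field_def by (rule prob_space_PiM) unfold_locales

interpretation exp_prod: product_prob_space "\<lambda>_::nat \<times> nat. exp1" UNIV
  by unfold_locales

lemma space_exp_field [simp]: "space exp_field = UNIV"
  by (simp add: exp_field_def space_PiM)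

lemma sets_exp_field [measurable_cong]: "sets exp_field = sets (PiM UNIV (\<lambda>_. borel))"
  unfolding exp_field_def by (intro sets_PiM_cong) auto

lemma measurable_exp_field_component: "(\<lambda>X. X p) \<in> borel_measurable exp_field"
  unfolding exp_field_def by measurable

lemma distr_exp_field_reindex:
  assumes "inj \<phi>"
  shows "distr exp_field exp_field (\<lambda>X. X \<circ> \<phi>) = exp_field"
  using distr_PiM_reindex[of UNIV "\<lambda>_. exp1" \<phi> UNIV] assms exp1.prob_space_axioms
  by (simp add: exp_field_def comp_def restrict_def)

lemma measurable_reindex: "(\<lambda>X. X \<circ> \<phi>) \<in> exp_field \<rightarrow>\<^sub>M exp_field"
  unfolding comp_def by (subst (2) exp_field_def) (rule measurable_PiM_single', auto simp: space_PiM)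

lemma AE_exp_field_nonneg: "AE X in exp_field. \<forall>p. 0 \<le> X p"
proof -
  have "AE x in exp1. 0 \<le> x"
    unfolding exp1_def by (subst AE_density) (auto simp: erlang_density_def)
  then have "AE X in exp_field. 0 \<le> X p" for p
    unfolding exp_field_def by (intro exp_prod.AE_component) auto
  then show ?thesis by (simp add: AE_all_countable)
qed

text \<open>In the coordinates d = u - v, v, w the Burke map merely interchanges v and w when
  \<open>d \<ge> 0\<close>; with d innermost this is an exchange of the two outer integrals.\<close>

lemma nn_integral_lborel_rotate_shift:
  fixes H :: "real \<times> real \<times> real \<Rightarrow> ennreal"
  assumes [measurable]: "H \<in> borel_measurable (borel \<Otimes>\<^sub>M borel \<Otimes>\<^sub>M borel)"
  shows "(\<integral>\<^sup>+u. \<integral>\<^sup>+v. \<integral>\<^sup>+w. H (u, v, w) \<partial>lborel \<partial>lborel \<partial>lborel)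
    = (\<integral>\<^sup>+v. \<integral>\<^sup>+w. \<integral>\<^sup>+d. H (v + d, v, w) \<partial>lborel \<partial>lborel \<partial>lborel)"
proof -
  have "(\<integral>\<^sup>+u. \<integral>\<^sup>+v. \<integral>\<^sup>+w. H (u, v, w) \<partial>lborel \<partial>lborel \<partial>lborel)
      = (\<integral>\<^sup>+v. \<integral>\<^sup>+u. \<integral>\<^sup>+w. H (u, v, w) \<partial>lborel \<partial>lborel \<partial>lborel)"
    by (rule lborel_pair.Fubini') measurable
  also have "\<dots> = (\<integral>\<^sup>+v. \<integral>\<^sup>+w. \<integral>\<^sup>+u. H (u, v, w) \<partial>lborel \<partial>lborel \<partial>lborel)"
    by (intro nn_integral_cong lborel_pair.Fubini') measurable
  also have "\<dots> = (\<integral>\<^sup>+v. \<integral>\<^sup>+w. \<integral>\<^sup>+d. H (v + d, v, w) \<partial>lborel \<partial>lborel \<partial>lborel)"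
  proof (rule nn_integral_cong, rule nn_integral_cong)
    fix v w :: real
    show "(\<integral>\<^sup>+u. H (u, v, w) \<partial>lborel) = (\<integral>\<^sup>+d. H (v + d, v, w) \<partial>lborel)"
      by (subst nn_integral_real_affine[where c=1 and t=v]) simp_all
  qed
  finally show ?thesis .
qed

text \<open>The horizontal increment u on the bottom edge of a unit square, the vertical increment v
  on its left edge and the weight w yield the increments on the top and right edges. The third
  component is the dual weight, kept so that the map preserves volume on the octant.\<close>

definition burke3 :: "real \<times> real \<times> real \<Rightarrow> real \<times> real \<times> real" where
  "burke3 = (\<lambda>(u, v, w). (w + max 0 (u - v), w + max 0 (v - u), min u v))"

lemma measurable_burke3 [measurable]:
  "burke3 \<in> borel \<Otimes>\<^sub>M borel \<Otimes>\<^sub>M borel \<rightarrow>\<^sub>M borel \<Otimes>\<^sub>M borel \<Otimes>\<^sub>M borel"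
  unfolding burke3_def by measurable

text \<open>On each of \<open>v \<le> u\<close> and \<open>u < v\<close>, \<open>burke3\<close> just exchanges \<open>min u v\<close> and \<open>w\<close>
  and keeps \<open>u - v\<close>.\<close>

lemma nn_integral_burke3:
  fixes H :: "real \<times> real \<times> real \<Rightarrow> ennreal"
  assumes [measurable]: "H \<in> borel_measurable (borel \<Otimes>\<^sub>M borel \<Otimes>\<^sub>M borel)"
  defines "Q \<equiv> {0..} \<times> {0..} \<times> {0..}"
  shows "(\<integral>\<^sup>+u. \<integral>\<^sup>+v. \<integral>\<^sup>+w. H (burke3 (u, v, w)) * indicator Q (u, v, w) \<partial>lborel \<partial>lborel \<partial>lborel)
    = (\<integral>\<^sup>+u. \<integral>\<^sup>+v. \<integral>\<^sup>+w. H (u, v, w) * indicator Q (u, v, w) \<partial>lborel \<partial>lborel \<partial>lborel)"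
    (is "?I (\<lambda>x. H (burke3 x) * indicator Q x) = ?I (\<lambda>x. H x * indicator Q x)")
proof -
  define R1 R2 :: "(real \<times> real \<times> real) set"
    where "R1 = {(u, v, w). v \<le> u}" and "R2 = {(u, v, w). u < v}"
  have [measurable]: "Q \<in> sets (borel \<Otimes>\<^sub>M borel \<Otimes>\<^sub>M borel)"
    unfolding Q_def by measurable
  have region: "R \<in> sets (borel \<Otimes>\<^sub>M borel \<Otimes>\<^sub>M borel)"
    if "R = {x. fst (snd x) \<le> fst x}" for R :: "(real \<times> real \<times> real) set"
  proof -
    have "{x \<in> space (borel \<Otimes>\<^sub>M borel \<Otimes>\<^sub>M borel). fst (snd x) \<le> fst x}
        \<in> sets ((borel :: real measure) \<Otimes>\<^sub>M borel \<Otimes>\<^sub>M (borel :: real measure))"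
      by measurable
    then show ?thesis by (simp add: that space_pair_measure)
  qed
  have region': "R \<in> sets (borel \<Otimes>\<^sub>M borel \<Otimes>\<^sub>M borel)"
    if "R = - {x. fst (snd x) \<le> fst x}" for R :: "(real \<times> real \<times> real) set"
    using sets.compl_sets[OF region[OF refl]] that by (simp add: space_pair_measure Compl_eq_Diff_UNIV)
  have [measurable]: "R1 \<in> sets (borel \<Otimes>\<^sub>M borel \<Otimes>\<^sub>M borel)"
    by (rule region) (auto simp: R1_def)
  have [measurable]: "R2 \<in> sets (borel \<Otimes>\<^sub>M borel \<Otimes>\<^sub>M borel)"
    by (rule region') (auto simp: R2_def)
  have split: "?I f = ?I (\<lambda>x. f x * indicator R1 x) + ?I (\<lambda>x. f x * indicator R2 x)"
    if [measurable]: "f \<in> borel_measurable (borel \<Otimes>\<^sub>M borel \<Otimes>\<^sub>M borel)"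
    for f :: "real \<times> real \<times> real \<Rightarrow> ennreal"
  proof -
    have "f x = f x * indicator R1 x + f x * indicator R2 x" for x
      by (auto simp: R1_def R2_def indicator_def)
    then have "?I f = ?I (\<lambda>x. f x * indicator R1 x + f x * indicator R2 x)"
      by simp
    also have "\<dots> = ?I (\<lambda>x. f x * indicator R1 x) + ?I (\<lambda>x. f x * indicator R2 x)"
      by (simp add: nn_integral_add)
    finally show ?thesis .
  qed
  have swap: "?I f = ?I (\<lambda>(u, v, w). f (v, u, w))"
    if [measurable]: "f \<in> borel_measurable (borel \<Otimes>\<^sub>M borel \<Otimes>\<^sub>M borel)"
    for f :: "real \<times> real \<times> real \<Rightarrow> ennreal"
    unfolding split_beta fst_conv snd_conv by (rule lborel_pair.Fubini') measurable
  \<comment> \<open>For \<open>d \<ge> 0\<close> one has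
    \<open>burke3 (v + d, v, w) = (w + d, w, v)\<close>, so the two sides differ by the order of the
    v and w integrals. Membership in R depends on d alone and survives the exchange.\<close>
  have A: "?I (\<lambda>x. H (burke3 x) * indicator Q x * indicator R x) =
      ?I (\<lambda>x. H x * indicator Q x * indicator R x)"
    if H[measurable]: "H \<in> borel_measurable (borel \<Otimes>\<^sub>M borel \<Otimes>\<^sub>M borel)"
      and R[measurable]: "R \<in> sets (borel \<Otimes>\<^sub>M borel \<Otimes>\<^sub>M borel)"
      and R_iff: "\<And>v d w. (v + d, v, w) \<in> R \<longleftrightarrow> d \<in> D" and D: "D \<subseteq> {0..}"
    for H :: "real \<times> real \<times> real \<Rightarrow> ennreal" and R D
  proof -
    define h where "h x y = (\<integral>\<^sup>+d. H (x + d, x, y) * indicator Q (x + d, x, y)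
      * indicator R (x + d, x, y) \<partial>lborel)" for x y
    have [measurable]: "case_prod h \<in> borel_measurable (borel \<Otimes>\<^sub>M borel)"
      unfolding h_def by measurable
    have eq: "(\<integral>\<^sup>+d. H (burke3 (v + d, v, w)) * indicator Q (v + d, v, w)
      * indicator R (v + d, v, w) \<partial>lborel) = h w v" for v w
      unfolding h_def
      by (intro nn_integral_cong) (use D in \<open>auto simp: R_iff burke3_def Q_def split: split_indicator\<close>)
    have "?I (\<lambda>x. H (burke3 x) * indicator Q x * indicator R x) =
      (\<integral>\<^sup>+v. \<integral>\<^sup>+w. h w v \<partial>lborel \<partial>lborel)"
      by (subst nn_integral_lborel_rotate_shift) (simp_all add: eq)
    also have "\<dots> = (\<integral>\<^sup>+v. \<integral>\<^sup>+w. h v w \<partial>lborel \<partial>lborel)"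
      by (rule lborel_pair.Fubini') measurable
    also have "\<dots> = ?I (\<lambda>x. H x * indicator Q x * indicator R x)"
      by (subst nn_integral_lborel_rotate_shift) (simp_all add: h_def[abs_def])
    finally show ?thesis .
  qed
  have 1: "?I (\<lambda>x. H (burke3 x) * indicator Q x * indicator R1 x) =
      ?I (\<lambda>x. H x * indicator Q x * indicator R1 x)"
    by (rule A[where D="{0..}"]) (measurable, auto simp: R1_def)
  have 2: "?I (\<lambda>x. H (burke3 x) * indicator Q x * indicator R2 x) =
      ?I (\<lambda>x. H x * indicator Q x * indicator R2 x)"
  proof -
    \<comment> \<open>Reflection in the diagonal turns u < v into v < u, which is again of the kind
      treated in \<open>A\<close>.\<close>
    let ?s = "\<lambda>(u, v, w). (v, u, w) :: real \<times> real \<times> real"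
    let ?R = "{(u, v, w). v < u} :: (real \<times> real \<times> real) set"
    have ind: "indicator Q (?s x) = (indicator Q x :: ennreal)"
      "indicator R2 (?s x) = (indicator ?R x :: ennreal)" "burke3 (?s x) = ?s (burke3 x)" for x
      by (auto simp: Q_def R2_def indicator_def burke3_def split_beta min.commute mem_Times_iff)
    have "?I (\<lambda>x. H (burke3 x) * indicator Q x * indicator R2 x) =
      ?I (\<lambda>x. H (burke3 (?s x)) * indicator Q (?s x) * indicator R2 (?s x))"
      by (subst swap) simp_all
    also have "\<dots> = ?I (\<lambda>x. H (?s (burke3 x)) * indicator Q x * indicator ?R x)"
      by (simp only: ind)
    also have "\<dots> = ?I (\<lambda>x. H (?s x) * indicator Q x * indicator ?R x)"
    proof (rule A[where D="{0<..}"])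
      show "?R \<in> sets (borel \<Otimes>\<^sub>M borel \<Otimes>\<^sub>M borel)"
      proof -
        have "{x \<in> space (borel \<Otimes>\<^sub>M borel \<Otimes>\<^sub>M borel). fst (snd x) < fst x}
            \<in> sets ((borel :: real measure) \<Otimes>\<^sub>M borel \<Otimes>\<^sub>M (borel :: real measure))"
          by measurable
        then show ?thesis by (simp add: space_pair_measure split_beta')
      qed
    qed auto
    also have "\<dots> = ?I (\<lambda>x. H (?s x) * indicator Q (?s x) * indicator R2 (?s x))"
      by (simp only: ind)
    also have "\<dots> = ?I (\<lambda>x. H x * indicator Q x * indicator R2 x)"
      by (subst (2) swap) simp_all
    finally show ?thesis .
  qed
  show ?thesis
    by (subst (1 2) split) (simp_all add: 1 2)
qed

lemma nn_integral_exp1: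
  assumes [measurable]: "g \<in> borel_measurable borel" and c: "c > 0"
  shows "(\<integral>\<^sup>+x. g x \<partial>exp1) = (\<integral>\<^sup>+x. ennreal (c * exp (- (c * x))) * indicator {0..} x * g (c * x) \<partial>lborel)"
proof -
  have "(\<integral>\<^sup>+x. g x \<partial>exp1) = (\<integral>\<^sup>+x. ennreal (exponential_density 1 x) * g x \<partial>lborel)"
    unfolding exp1_def by (rule nn_integral_density) auto
  also have "\<dots> = ennreal c * (\<integral>\<^sup>+x. ennreal (exponential_density 1 (c * x)) * g (c * x) \<partial>lborel)"
    using c by (subst nn_integral_real_affine[where c=c and t=0]) simp_all
  also have "\<dots> = (\<integral>\<^sup>+x. ennreal c * (ennreal (exponential_density 1 (c * x)) * g (c * x)) \<partial>lborel)"
    by (rule nn_integral_cmult[symmetric]) measurable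
  also have "\<dots> = (\<integral>\<^sup>+x. ennreal (c * exp (- (c * x))) * indicator {0..} x * g (c * x) \<partial>lborel)"
    by (intro nn_integral_cong) (use c in
      \<open>auto simp: erlang_density_def mult_less_0_iff ennreal_mult mult.assoc split: split_indicator\<close>)
  finally show ?thesis .
qed

lemma nn_integral_exp1_3:
  fixes F :: "real \<times> real \<times> real \<Rightarrow> ennreal"
  assumes [measurable]: "F \<in> borel_measurable (borel \<Otimes>\<^sub>M borel \<Otimes>\<^sub>M borel)"
    and c: "r > 0" "s > 0" "t > 0"
  shows "(\<integral>\<^sup>+u. \<integral>\<^sup>+v. \<integral>\<^sup>+w. F (u, v, w) \<partial>exp1 \<partial>exp1 \<partial>exp1) =
    (\<integral>\<^sup>+u. \<integral>\<^sup>+v. \<integral>\<^sup>+w. ennreal (r * s * t * exp (- (r * u + s * v + t * w))) * F (r * u, s * v, t * w)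
      * indicator ({0..} \<times> {0..} \<times> {0..}) (u, v, w) \<partial>lborel \<partial>lborel \<partial>lborel)"
proof -
  let ?d = "\<lambda>c x. ennreal (c * exp (- (c * x))) * indicator {0..} (x :: real)"
  have "(\<integral>\<^sup>+u. \<integral>\<^sup>+v. \<integral>\<^sup>+w. F (u, v, w) \<partial>exp1 \<partial>exp1 \<partial>exp1) =
    (\<integral>\<^sup>+u. ?d r u * (\<integral>\<^sup>+v. ?d s v * (\<integral>\<^sup>+w. ?d t w * F (r * u, s * v, t * w) \<partial>lborel) \<partial>lborel) \<partial>lborel)"
  proof -
    have "(\<integral>\<^sup>+u. \<integral>\<^sup>+v. \<integral>\<^sup>+w. F (u, v, w) \<partial>exp1 \<partial>exp1 \<partial>exp1) =
        (\<integral>\<^sup>+u. ?d r u * (\<integral>\<^sup>+v. \<integral>\<^sup>+w. F (r * u, v, w) \<partial>exp1 \<partial>exp1) \<partial>lborel)"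
      by (rule nn_integral_exp1[OF _ c(1)]) measurable
    moreover have "(\<integral>\<^sup>+v. \<integral>\<^sup>+w. F (x, v, w) \<partial>exp1 \<partial>exp1) =
        (\<integral>\<^sup>+v. ?d s v * (\<integral>\<^sup>+w. F (x, s * v, w) \<partial>exp1) \<partial>lborel)" for x
      by (rule nn_integral_exp1[OF _ c(2)]) measurable
    moreover have "(\<integral>\<^sup>+w. F (x, y, w) \<partial>exp1) = (\<integral>\<^sup>+w. ?d t w * F (x, y, t * w) \<partial>lborel)" for x y
      by (rule nn_integral_exp1[OF _ c(3)]) measurable
    ultimately show ?thesis by simp
  qed
  also have "\<dots> = (\<integral>\<^sup>+u. \<integral>\<^sup>+v. \<integral>\<^sup>+w. ?d r u * (?d s v * (?d t w * F (r * u, s * v, t * w)))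
      \<partial>lborel \<partial>lborel \<partial>lborel)"
    by (simp add: nn_integral_cmult)
  also have "\<dots> = (\<integral>\<^sup>+u. \<integral>\<^sup>+v. \<integral>\<^sup>+w. ennreal (r * s * t * exp (- (r * u + s * v + t * w)))
      * F (r * u, s * v, t * w) * indicator ({0..} \<times> {0..} \<times> {0..}) (u, v, w) \<partial>lborel \<partial>lborel \<partial>lborel)"
  proof (intro nn_integral_cong)
    fix u v w :: real
    have "ennreal (r * s * t * exp (- (r * u + s * v + t * w))) =
      ennreal (r * exp (- (r * u))) * ennreal (s * exp (- (s * v))) * ennreal (t * exp (- (t * w)))"
      using c by (simp add: ennreal_mult[symmetric] exp_diff exp_minus exp_add field_simps)
    then show "?d r u * (?d s v * (?d t w * F (r * u, s * v, t * w))) =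
        ennreal (r * s * t * exp (- (r * u + s * v + t * w))) * F (r * u, s * v, t * w)
        * indicator ({0..} \<times> {0..} \<times> {0..}) (u, v, w)"
      by (auto simp: indicator_def mult_ac)
  qed
  finally show ?thesis .
qed

text \<open>The exponent \<open>r * u + s * v + (r + s) * w\<close> is invariant under
  \<open>burke3\<close>, precisely because the weight has rate r + s. Together with the preservation
  of volume this is Burke's theorem for one square, written for normalized variables.\<close>

lemma nn_integral_exp1_burke3:
  fixes F :: "real \<times> real \<times> real \<Rightarrow> ennreal"
  assumes [measurable]: "F \<in> borel_measurable (borel \<Otimes>\<^sub>M borel \<Otimes>\<^sub>M borel)"
    and c: "r > 0" "s > 0"
  shows "(\<integral>\<^sup>+u. \<integral>\<^sup>+v. \<integral>\<^sup>+w. (case burke3 (u / r, v / s, w / (r + s)) of (u', v', w') \<Rightarrow>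
      F (r * u', s * v', (r + s) * w')) \<partial>exp1 \<partial>exp1 \<partial>exp1)
    = (\<integral>\<^sup>+u. \<integral>\<^sup>+v. \<integral>\<^sup>+w. F (u, v, w) \<partial>exp1 \<partial>exp1 \<partial>exp1)"
proof -
  define K where "K = (\<lambda>(u, v, w). ennreal (r * s * (r + s) * exp (- (r * u + s * v + (r + s) * w)))
    * F (r * u, s * v, (r + s) * w))"
  have [measurable]: "K \<in> borel_measurable (borel \<Otimes>\<^sub>M borel \<Otimes>\<^sub>M borel)"
    unfolding K_def by measurable
  have inv: "- (r * (w + max 0 (u - v))) - s * (w + max 0 (v - u)) - (r + s) * min u v =
      - (r * u) - s * v - (r + s) * w" for u v w :: real
    by (auto simp: max_def min_def algebra_simps)
  have rs: "r + s > 0" using c by simp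
  define G where "G = (\<lambda>(u, v, w). case burke3 (u / r, v / s, w / (r + s)) of (u', v', w') \<Rightarrow>
      F (r * u', s * v', (r + s) * w'))"
  have [measurable]: "G \<in> borel_measurable (borel \<Otimes>\<^sub>M borel \<Otimes>\<^sub>M borel)"
    unfolding G_def burke3_def by measurable
  have "(\<integral>\<^sup>+u. \<integral>\<^sup>+v. \<integral>\<^sup>+w. G (u, v, w) \<partial>exp1 \<partial>exp1 \<partial>exp1)
      = (\<integral>\<^sup>+u. \<integral>\<^sup>+v. \<integral>\<^sup>+w. F (u, v, w) \<partial>exp1 \<partial>exp1 \<partial>exp1)"
    using nn_integral_burke3[of K] nn_integral_exp1_3[of G, OF _ c rs] nn_integral_exp1_3[of F, OF _ c rs] c rs
    by (simp add: K_def G_def burke3_def inv)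
  then show ?thesis by (simp add: G_def)
qed

lemma measurable_exp_field_I:
  assumes "\<And>p. (\<lambda>x. f x p) \<in> borel_measurable M"
  shows "f \<in> M \<rightarrow>\<^sub>M exp_field"
proof -
  have "(\<lambda>x. (\<lambda>p. f x p)) \<in> M \<rightarrow>\<^sub>M PiM UNIV (\<lambda>_. borel)"
    by (rule measurable_PiM_single') (auto intro: assms)
  then show ?thesis by (subst measurable_cong_sets[OF refl sets_exp_field]) simp
qed

lemma nn_integral_PiM_exp1_insert:
  fixes I :: "'i set"
  assumes [measurable]: "f \<in> borel_measurable (PiM (insert i I) (\<lambda>_. exp1))"
  shows "(\<integral>\<^sup>+X. f X \<partial>PiM (insert i I) (\<lambda>_. exp1)) = (\<integral>\<^sup>+x. \<integral>\<^sup>+X. f (X(i := x)) \<partial>PiM I (\<lambda>_. exp1) \<partial>exp1)"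
proof -
  interpret P: prob_space "PiM I (\<lambda>_. exp1)"
    by (rule prob_space_PiM) unfold_locales
  have "(\<integral>\<^sup>+X. f X \<partial>PiM (insert i I) (\<lambda>_. exp1)) =
     (\<integral>\<^sup>+X. f X \<partial>distr (exp1 \<Otimes>\<^sub>M PiM I (\<lambda>_. exp1)) (PiM (insert i I) (\<lambda>_. exp1)) (\<lambda>(x, X). X(i := x)))"
    using distr_pair_PiM_eq_PiM[of I "\<lambda>_. exp1" i] exp1.prob_space_axioms by simp
  also have "\<dots> = (\<integral>\<^sup>+z. f ((snd z)(i := fst z)) \<partial>(exp1 \<Otimes>\<^sub>M PiM I (\<lambda>_. exp1)))"
    by (subst nn_integral_distr) (auto simp: split_beta')
  also have "\<dots> = (\<integral>\<^sup>+x. \<integral>\<^sup>+X. f (X(i := x)) \<partial>PiM I (\<lambda>_. exp1) \<partial>exp1)"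
    by (subst P.nn_integral_fst[symmetric]) (auto simp: split_beta')
  finally show ?thesis .
qed

text \<open>Dividing by the rates and multiplying back keeps the coordinates normalized, so that
  every step preserves the one law \<open>exp_field\<close>, whatever the rates. The slot (i, j),
  read once in the whole sweep, receives the dual weight.\<close>

definition burke_step :: "(nat \<Rightarrow> real) \<Rightarrow> (nat \<Rightarrow> real) \<Rightarrow> nat \<Rightarrow> nat \<Rightarrow> (nat \<times> nat \<Rightarrow> real) \<Rightarrow> (nat \<times> nat \<Rightarrow> real)" where
  "burke_step u v i j X = (case burke3 (X (i, 0) / u i, X (0, j) / v j, X (i, j) / (u i + v j)) of
     (x, y, z) \<Rightarrow> X((i, j) := (u i + v j) * z, (0, j) := v j * y, (i, 0) := u i * x))"

lemma measurable_burke_step: "burke_step u v i j \<in> exp_field \<rightarrow>\<^sub>M exp_field"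
proof (rule measurable_exp_field_I)
  fix p
  note [measurable] = measurable_exp_field_component
  show "(\<lambda>X. burke_step u v i j X p) \<in> borel_measurable exp_field"
    unfolding burke_step_def burke3_def split_beta' prod.sel fun_upd_apply by measurable
qed

text \<open>For i, j >= 1 the three slots are distinct, and the other coordinates are independent of
  them and untouched. Integrating these out leaves a function \<open>F\<close> of three variables,
  to which the identity for one square applies.\<close>

lemma distr_burke_step:
  assumes "i \<ge> 1" "j \<ge> 1" "u i > 0" "v j > 0"
  shows "distr exp_field exp_field (burke_step u v i j) = exp_field"
proof (rule measure_eqI)
  fix A assume "A \<in> sets (distr exp_field exp_field (burke_step u v i j))"
  then have A[measurable]: "A \<in> sets exp_field" by simp
  define I where "I = UNIV - {(i, 0), (0, j), (i, j)}"
  let ?P = "PiM I (\<lambda>_. exp1)"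
  define upd where "upd = (\<lambda>x y z X. X((i, j) := z, (0, j) := y, (i, 0) := x :: real))"
  define F where "F = (\<lambda>(x, y, z). \<integral>\<^sup>+X. indicator A (upd x y z X) \<partial>?P)"
  have ins: "insert (i, 0) (insert (0, j) (insert (i, j) I)) = UNIV" by (auto simp: I_def)
  interpret P: prob_space ?P by (rule prob_space_PiM) unfold_locales
  have upd_meas: "(\<lambda>((x, y, z), X). upd x y z X) \<in> (borel \<Otimes>\<^sub>M borel \<Otimes>\<^sub>M borel) \<Otimes>\<^sub>M ?P \<rightarrow>\<^sub>M exp_field"
  proof (rule measurable_exp_field_I)
    fix p :: "nat \<times> nat"
    have [measurable]: "(\<lambda>X. X p) \<in> borel_measurable ?P" if "p \<in> I"
    proof -
      have "(\<lambda>X. X p) \<in> ?P \<rightarrow>\<^sub>M exp1" using that by measurable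
      then show ?thesis by (simp cong: measurable_cong_sets)
    qed
    show "(\<lambda>x. (case x of (x, xa) \<Rightarrow> (case x of (x, y, z) \<Rightarrow> upd x y z) xa) p)
        \<in> borel_measurable ((borel \<Otimes>\<^sub>M borel \<Otimes>\<^sub>M borel) \<Otimes>\<^sub>M ?P)"
      unfolding upd_def split_beta' fun_upd_apply
      by (cases "p = (i, 0)"; cases "p = (0, j)"; cases "p = (i, j)"; cases "p \<in> I";
          (simp; fail | (simp, measurable; fail) | auto simp: I_def))
  qed
  have [measurable]: "F \<in> borel_measurable (borel \<Otimes>\<^sub>M borel \<Otimes>\<^sub>M borel)"
    unfolding F_def split_beta'
    using measurable_compose[OF upd_meas, of "indicator A" "borel :: ennreal measure"]
    by (intro P.borel_measurable_nn_integral) (simp add: split_beta')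
  have split3: "(\<integral>\<^sup>+X. f X \<partial>exp_field) = (\<integral>\<^sup>+x. \<integral>\<^sup>+y. \<integral>\<^sup>+z. \<integral>\<^sup>+X. f (upd x y z X) \<partial>?P \<partial>exp1 \<partial>exp1 \<partial>exp1)"
    if [measurable]: "f \<in> borel_measurable exp_field" for f
  proof -
    have upd1: "(\<lambda>X. X(p := x)) \<in> PiM J (\<lambda>_. exp1) \<rightarrow>\<^sub>M PiM (insert p J) (\<lambda>_. exp1)"
      for p :: "nat \<times> nat" and x :: real and J
      by (rule measurable_fun_upd[where J=J]) auto
    have m0: "f \<in> borel_measurable (PiM (insert (i, 0) (insert (0, j) (insert (i, j) I))) (\<lambda>_. exp1))"
      using that by (simp add: exp_field_def ins)
    note m1 = measurable_compose[OF upd1 m0]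
    note m2 = measurable_compose[OF upd1 m1]
    show ?thesis
      unfolding exp_field_def ins[symmetric]
      apply (subst nn_integral_PiM_exp1_insert, rule m0)
      apply (subst nn_integral_PiM_exp1_insert, rule m1)
      apply (subst nn_integral_PiM_exp1_insert, rule m2)
      apply (simp add: upd_def)
      done
  qed
  have step: "burke_step u v i j (upd x y z X) = (case burke3 (x / u i, y / v j, z / (u i + v j)) of
     (x', y', z') \<Rightarrow> upd (u i * x') (v j * y') ((u i + v j) * z') X)" for x y z X
    using assms by (auto simp: burke_step_def upd_def burke3_def fun_eq_iff)
  have "emeasure (distr exp_field exp_field (burke_step u v i j)) A = (\<integral>\<^sup>+X. indicator A (burke_step u v i j X) \<partial>exp_field)"
    by (simp add: nn_integral_distr[OF measurable_burke_step] flip: nn_integral_indicator)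
  also have "\<dots> = (\<integral>\<^sup>+x. \<integral>\<^sup>+y. \<integral>\<^sup>+z. (case burke3 (x / u i, y / v j, z / (u i + v j)) of (x', y', z') \<Rightarrow>
      F (u i * x', v j * y', (u i + v j) * z')) \<partial>exp1 \<partial>exp1 \<partial>exp1)"
    using measurable_compose[OF measurable_burke_step, of "indicator A" "borel :: ennreal measure"]
    by (subst split3) (simp_all add: step F_def split_beta')
  also have "\<dots> = (\<integral>\<^sup>+x. \<integral>\<^sup>+y. \<integral>\<^sup>+z. F (x, y, z) \<partial>exp1 \<partial>exp1 \<partial>exp1)"
    by (rule nn_integral_exp1_burke3) (use assms in auto)
  also have "\<dots> = emeasure exp_field A"
    by (simp add: F_def split3 flip: nn_integral_indicator)
  finally show "emeasure (distr exp_field exp_field (burke_step u v i j)) A = emeasure exp_field A" .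
qed simp

section \<open>Stationary boundaries and the upper tail\<close>

definition rate_weights :: "(nat \<Rightarrow> real) \<Rightarrow> (nat \<Rightarrow> real) \<Rightarrow> (nat \<times> nat \<Rightarrow> real) \<Rightarrow> nat \<times> nat \<Rightarrow> real" where
  "rate_weights u v X = (\<lambda>(i, j). X (i, j) / (u i + v j))"

lemma rate_weights_apply [simp]: "rate_weights u v X (i, j) = X (i, j) / (u i + v j)"
  by (simp add: rate_weights_def)

primrec burke_col :: "(nat \<Rightarrow> real) \<Rightarrow> (nat \<Rightarrow> real) \<Rightarrow> nat \<Rightarrow> nat \<Rightarrow> (nat \<times> nat \<Rightarrow> real) \<Rightarrow> (nat \<times> nat \<Rightarrow> real)" where
  "burke_col u v i 0 X = X"
| "burke_col u v i (Suc j) X = burke_step u v i (Suc j) (burke_col u v i j X)"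

text \<open>Columns go from left to right, each from bottom to top, so both increments entering a
  square are in their slots when it is processed. After i columns the slots (0, j) hold the vertical
  increments on column i, multiplied by \<open>v j\<close>.\<close>

primrec burke_grid :: "(nat \<Rightarrow> real) \<Rightarrow> (nat \<Rightarrow> real) \<Rightarrow> nat \<Rightarrow> nat \<Rightarrow> (nat \<times> nat \<Rightarrow> real) \<Rightarrow> (nat \<times> nat \<Rightarrow> real)" where
  "burke_grid u v n 0 X = X"
| "burke_grid u v n (Suc i) X = burke_col u v (Suc i) n (burke_grid u v n i X)"

lemma distr_exp_field_compose:
  assumes f: "f \<in> exp_field \<rightarrow>\<^sub>M exp_field" "distr exp_field exp_field f = exp_field" and g: "g \<in> exp_field \<rightarrow>\<^sub>M exp_field" "distr exp_field exp_field g = exp_field"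
  shows "(\<lambda>X. g (f X)) \<in> exp_field \<rightarrow>\<^sub>M exp_field" "distr exp_field exp_field (\<lambda>X. g (f X)) = exp_field"
proof -
  show "(\<lambda>X. g (f X)) \<in> exp_field \<rightarrow>\<^sub>M exp_field" by (rule measurable_compose[OF f(1) g(1)])
  have "distr exp_field exp_field (g \<circ> f) = distr (distr exp_field exp_field f) exp_field g" by (rule distr_distr[OF g(1) f(1), symmetric])
  then show "distr exp_field exp_field (\<lambda>X. g (f X)) = exp_field" by (simp add: f g comp_def)
qed

lemma distr_burke_col:
  assumes "i \<ge> 1" "u i > 0" "\<And>j. 1 \<le> j \<Longrightarrow> j \<le> n \<Longrightarrow> v j > 0"
  shows "burke_col u v i n \<in> exp_field \<rightarrow>\<^sub>M exp_field \<and> distr exp_field exp_field (burke_col u v i n) = exp_field"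
  using assms(3)
proof (induction n)
  case 0
  have "burke_col u v i 0 = (\<lambda>X. X)" by auto
  then show ?case by simp
next
  case (Suc n)
  have eq: "burke_col u v i (Suc n) = (\<lambda>X. burke_step u v i (Suc n) (burke_col u v i n X))" by auto
  have "distr exp_field exp_field (burke_step u v i (Suc n)) = exp_field"
    using assms Suc.prems by (intro distr_burke_step) auto
  moreover have "burke_col u v i n \<in> exp_field \<rightarrow>\<^sub>M exp_field" "distr exp_field exp_field (burke_col u v i n) = exp_field"
    using Suc by auto
  ultimately show ?case
    unfolding eq using distr_exp_field_compose measurable_burke_step by metis
qed

lemma distr_burke_grid:
  assumes "\<And>i. 1 \<le> i \<Longrightarrow> i \<le> m \<Longrightarrow> u i > 0" "\<And>j. 1 \<le> j \<Longrightarrow> j \<le> n \<Longrightarrow> v j > 0"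
  shows "burke_grid u v n m \<in> exp_field \<rightarrow>\<^sub>M exp_field \<and> distr exp_field exp_field (burke_grid u v n m) = exp_field"
  using assms(1)
proof (induction m)
  case 0
  have "burke_grid u v n 0 = (\<lambda>X. X)" by auto
  then show ?case by simp
next
  case (Suc m)
  have eq: "burke_grid u v n (Suc m) = (\<lambda>X. burke_col u v (Suc m) n (burke_grid u v n m X))" by auto
  have "burke_col u v (Suc m) n \<in> exp_field \<rightarrow>\<^sub>M exp_field \<and> distr exp_field exp_field (burke_col u v (Suc m) n) = exp_field"
    using assms(2) Suc.prems by (intro distr_burke_col) auto
  moreover have "burke_grid u v n m \<in> exp_field \<rightarrow>\<^sub>M exp_field" "distr exp_field exp_field (burke_grid u v n m) = exp_field"
    using Suc by auto
  ultimately show ?case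
    unfolding eq using distr_exp_field_compose by metis
qed

text \<open>The increments of \<open>lpp\<close> across a unit square are \<open>burke3\<close> of the incoming increments and the
  weight; the slots \<open>(i, 0)\<close> and \<open>(0, j)\<close> store the current horizontal and vertical increments.\<close>

lemma burke_col_increments:
  fixes u v X
  defines "w \<equiv> rate_weights u v X"
  assumes u: "u (Suc i) > 0" "u 0 = 0" and v: "\<And>j. 1 \<le> j \<Longrightarrow> j \<le> n \<Longrightarrow> v j > 0" "v 0 = 0"
    and Y: "\<And>j. j < n \<Longrightarrow> Y (0, Suc j) / v (Suc j) = lpp w i (Suc j) - lpp w i j"
      "\<And>i' j. i < i' \<Longrightarrow> Y (i', j) = X (i', j)"
    and "j \<le> n"
  defines "Z \<equiv> burke_col u v (Suc i) j Y"
  shows "Z (Suc i, 0) / u (Suc i) = lpp w (Suc i) j - lpp w i j \<and>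
    (\<forall>k<j. Z (0, Suc k) / v (Suc k) = lpp w (Suc i) (Suc k) - lpp w (Suc i) k) \<and>
    (\<forall>k>j. Z (0, k) = Y (0, k) \<and> Z (Suc i, k) = X (Suc i, k)) \<and>
    (\<forall>i' k. Suc i < i' \<longrightarrow> Z (i', k) = X (i', k))"
  using \<open>j \<le> n\<close> unfolding Z_def
proof (induction j)
  case 0
  then show ?case using u v(2) by (auto simp: Y w_def)
next
  case (Suc j)
  let ?Z = "burke_col u v (Suc i) j Y"
  from Suc have IH: "?Z (Suc i, 0) / u (Suc i) = lpp w (Suc i) j - lpp w i j"
    "\<And>k. k < j \<Longrightarrow> ?Z (0, Suc k) / v (Suc k) = lpp w (Suc i) (Suc k) - lpp w (Suc i) k"
    "\<And>k. k > j \<Longrightarrow> ?Z (0, k) = Y (0, k) \<and> ?Z (Suc i, k) = X (Suc i, k)"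
    "\<And>i' k. Suc i < i' \<Longrightarrow> ?Z (i', k) = X (i', k)"
    by auto
  have vj: "v (Suc j) > 0" using v Suc.prems by auto
  have a: "?Z (0, Suc j) / v (Suc j) = lpp w i (Suc j) - lpp w i j"
    using IH(3)[of "Suc j"] Y(1)[of j] Suc.prems by auto
  have b: "?Z (Suc i, Suc j) / (u (Suc i) + v (Suc j)) = w (Suc i, Suc j)"
    using IH(3)[of "Suc j"] by (simp add: w_def)
  have "burke3 (?Z (Suc i, 0) / u (Suc i), ?Z (0, Suc j) / v (Suc j), ?Z (Suc i, Suc j) / (u (Suc i) + v (Suc j)))
    = (lpp w (Suc i) (Suc j) - lpp w i (Suc j), lpp w (Suc i) (Suc j) - lpp w (Suc i) j,
       min (lpp w (Suc i) j - lpp w i j) (lpp w i (Suc j) - lpp w i j))"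
    unfolding IH(1) a b burke3_def by (simp add: max_def)
  then obtain c where eq: "burke_col u v (Suc i) (Suc j) Y = ?Z((Suc i, Suc j) := c,
      (0, Suc j) := v (Suc j) * (lpp w (Suc i) (Suc j) - lpp w (Suc i) j),
      (Suc i, 0) := u (Suc i) * (lpp w (Suc i) (Suc j) - lpp w i (Suc j)))"
    by (simp add: burke_step_def)
  show ?case
    unfolding eq
  proof (intro conjI allI impI)
    fix k assume "k < Suc j"
    then show "(?Z((Suc i, Suc j) := c, (0, Suc j) := v (Suc j) * (lpp w (Suc i) (Suc j) - lpp w (Suc i) j),
        (Suc i, 0) := u (Suc i) * (lpp w (Suc i) (Suc j) - lpp w i (Suc j)))) (0, Suc k) / v (Suc k) =
        lpp w (Suc i) (Suc k) - lpp w (Suc i) k"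
      using IH(2)[of k] vj by (cases "k = j") auto
  qed (use IH u(1) in \<open>auto simp del: lpp.simps\<close>)
qed

lemma burke_grid_increments:
  fixes u v X
  defines "w \<equiv> rate_weights u v X"
  assumes u: "\<And>i. 1 \<le> i \<Longrightarrow> i \<le> m \<Longrightarrow> u i > 0" "u 0 = 0"
    and v: "\<And>j. 1 \<le> j \<Longrightarrow> j \<le> n \<Longrightarrow> v j > 0" "v 0 = 0"
  shows "(\<forall>j<n. burke_grid u v n m X (0, Suc j) / v (Suc j) = lpp w m (Suc j) - lpp w m j) \<and>
    (\<forall>i j. m < i \<longrightarrow> burke_grid u v n m X (i, j) = X (i, j))"
  using u(1)
proof (induction m)
  case 0
  then show ?case using u(2) by (auto simp: w_def)
next
  case (Suc m)
  then have IH: "\<And>j. j < n \<Longrightarrow> burke_grid u v n m X (0, Suc j) / v (Suc j) = lpp w m (Suc j) - lpp w m j"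
     "\<And>i j. m < i \<Longrightarrow> burke_grid u v n m X (i, j) = X (i, j)" by auto
  from burke_col_increments[where Y="burke_grid u v n m X" and X=X and u=u and v=v and i=m and n=n and j=n,
      folded w_def, OF _ u(2) v IH] Suc.prems
  show ?case by auto
qed

text \<open>The last column telescopes: the passage time is the bottom row sum plus the vertical
  increments on the right edge, which are scaled coordinates of the transformed field. The two sums
  are dependent, but each is a sum of independent exponentials, and a union bound will
  suffice.\<close>

lemma lpp_boundary_sum:
  assumes u: "\<And>i. 1 \<le> i \<Longrightarrow> i \<le> m \<Longrightarrow> u i > 0" "u 0 = 0"
    and v: "\<And>j. 1 \<le> j \<Longrightarrow> j \<le> n \<Longrightarrow> v j > 0" "v 0 = 0"
  shows "(\<Sum>j=1..n. burke_grid u v n m X (0, j) / v j) =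
    lpp (rate_weights u v X) m n - (\<Sum>i=1..m. X (i, 0) / u i)"
proof -
  let ?w = "rate_weights u v X"
  have "(\<Sum>j=1..n. burke_grid u v n m X (0, j) / v j) = (\<Sum>j<n. burke_grid u v n m X (0, Suc j) / v (Suc j))"
    by (rule sum.reindex_bij_witness[of _ Suc "\<lambda>i. i - 1"]) auto
  also have "\<dots> = (\<Sum>j<n. lpp ?w m (Suc j) - lpp ?w m j)"
    by (intro sum.cong refl) (use burke_grid_increments[where u=u and v=v and m=m and n=n and X=X] u v in auto)
  also have "\<dots> = lpp ?w m n - lpp ?w m 0" by (simp add: sum_lessThan_telescope)
  also have "lpp ?w m 0 = (\<Sum>i=1..m. X (i, 0) / u i)" by (simp add: lpp_axis_sum v)
  finally show ?thesis .
qed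

lemma measure_exp_field_preserving:
  assumes "f \<in> exp_field \<rightarrow>\<^sub>M exp_field" "distr exp_field exp_field f = exp_field" "A \<in> sets exp_field"
  shows "measure exp_field {X. f X \<in> A} = measure exp_field A"
  using measure_distr[OF assms(1), of A] assms by (simp add: vimage_def)

section \<open>Exponential moments and concentration\<close>

lemma nn_integral_exp_field_prod:
  assumes "finite S" and [measurable]: "\<And>p. p \<in> S \<Longrightarrow> f p \<in> borel_measurable borel"
  shows "(\<integral>\<^sup>+X. (\<Prod>p\<in>S. f p (X p)) \<partial>exp_field) = (\<Prod>p\<in>S. \<integral>\<^sup>+x. f p x \<partial>exp1)"
proof -
  have [measurable]: "(\<lambda>X. \<Prod>p\<in>S. f p (X p)) \<in> borel_measurable (PiM S (\<lambda>_. exp1))"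
    by (intro borel_measurable_prod_ennreal measurable_compose[OF measurable_component_singleton]) auto
  have "(\<integral>\<^sup>+X. (\<Prod>p\<in>S. f p (X p)) \<partial>exp_field) = (\<integral>\<^sup>+X. (\<Prod>p\<in>S. f p (restrict X S p)) \<partial>exp_field)"
    by simp
  also have "\<dots> = (\<integral>\<^sup>+X. (\<Prod>p\<in>S. f p (X p)) \<partial>distr exp_field (PiM S (\<lambda>_. exp1)) (\<lambda>X. restrict X S))"
    by (rule nn_integral_distr[symmetric]) (auto simp: exp_field_def simp del: restrict_apply intro!: measurable_restrict_subset)
  also have "distr exp_field (PiM S (\<lambda>_. exp1)) (\<lambda>X. restrict X S) = PiM S (\<lambda>_. exp1)"
    unfolding exp_field_def by (rule exp_prod.distr_PiM_restrict_finite) (auto simp: assms)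
  also have "(\<integral>\<^sup>+X. (\<Prod>p\<in>S. f p (X p)) \<partial>PiM S (\<lambda>_. exp1)) = (\<Prod>p\<in>S. \<integral>\<^sup>+x. f p x \<partial>exp1)"
    by (rule exp_prod.product_nn_integral_prod) (use assms in auto)
  finally show ?thesis .
qed

lemma nn_integral_exp1_exp:
  assumes "t < 1"
  shows "(\<integral>\<^sup>+x. ennreal (exp (t * x)) \<partial>exp1) = ennreal (1 / (1 - t))"
proof -
  have "(\<integral>\<^sup>+x. ennreal (exp (t * x)) \<partial>exp1) = (\<integral>\<^sup>+x. ennreal (exponential_density 1 x) * ennreal (exp (t * x)) \<partial>lborel)"
    unfolding exp1_def by (rule nn_integral_density) auto
  also have "\<dots> = (\<integral>\<^sup>+x. ennreal (1 / (1 - t)) * ennreal (exponential_density (1 - t) x) \<partial>lborel)"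
  proof (rule nn_integral_cong)
    fix x :: real
    have "exp (- x) * exp (t * x) = exp ((t - 1) * x)"
      by (simp add: exp_add[symmetric] algebra_simps)
    then have "exponential_density 1 x * exp (t * x) = 1 / (1 - t) * exponential_density (1 - t) x"
      using assms by (simp add: erlang_density_def)
    then show "ennreal (exponential_density 1 x) * ennreal (exp (t * x)) =
        ennreal (1 / (1 - t)) * ennreal (exponential_density (1 - t) x)"
      using assms by (metis ennreal_mult' erlang_density_nonneg exp_ge_zero zero_le_one
        ennreal_mult divide_nonneg_nonneg diff_ge_0_iff_ge less_imp_le)
  qed
  also have "\<dots> = ennreal (1 / (1 - t)) * (\<integral>\<^sup>+x. ennreal (exponential_density (1 - t) x) \<partial>lborel)"
    by (rule nn_integral_cmult) measurable
  also have "(\<integral>\<^sup>+x. ennreal (exponential_density (1 - t) x) \<partial>lborel) = 1"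
    using nn_integral_erlang_ith_moment[of "1 - t" 0 0] assms by simp
  finally show ?thesis by simp
qed

text \<open>The moment equals \<open>exp (- t) / (1 - t)\<close>, so the claim is the second-order
  estimate of \<open>ln (1 - t)\<close>.\<close>

lemma nn_integral_exp1_exp_centered:
  assumes "\<bar>t\<bar> \<le> 1/2"
  shows "(\<integral>\<^sup>+x. ennreal (exp (t * (x - 1))) \<partial>exp1) \<le> ennreal (exp (2 * t\<^sup>2))"
proof -
  have "(\<integral>\<^sup>+x. ennreal (exp (t * (x - 1))) \<partial>exp1) = (\<integral>\<^sup>+x. ennreal (exp (- t)) * ennreal (exp (t * x)) \<partial>exp1)"
    by (intro nn_integral_cong) (simp add: ennreal_mult[symmetric] exp_add[symmetric] algebra_simps)
  also have "\<dots> = ennreal (exp (- t)) * (\<integral>\<^sup>+x. ennreal (exp (t * x)) \<partial>exp1)"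
    by (rule nn_integral_cmult) measurable
  also have "\<dots> = ennreal (exp (- t) / (1 - t))"
    using assms by (subst nn_integral_exp1_exp) (auto simp: ennreal_mult[symmetric])
  also have "\<dots> \<le> ennreal (exp (2 * t\<^sup>2))"
  proof (rule ennreal_leI)
    have "\<bar>ln (1 + (- t)) - (- t)\<bar> \<le> 2 * (- t)\<^sup>2"
      by (rule abs_ln_one_plus_x_minus_x_bound) (use assms in simp)
    then have "exp (- t - 2 * t\<^sup>2) \<le> 1 - t"
      using assms by (subst ln_ge_iff[symmetric]) auto
    then show "exp (- t) / (1 - t) \<le> exp (2 * t\<^sup>2)"
      using assms by (auto simp: divide_le_eq exp_diff mult.commute abs_le_iff)
  qed
  finally show ?thesis .
qed

text \<open>The Chernoff exponent \<open>s * l / 2\<close> for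
  \<open>l = min (\<eta> / 2) (s * \<eta>\<^sup>2 / 4)\<close>: the first bound on l keeps every
  tilt at most 1/2, the second makes the quadratic term at most half of the linear one.\<close>

definition dev_rate :: "real \<Rightarrow> real \<Rightarrow> real" where
  "dev_rate \<eta> s = s * min (\<eta> / 2) (s * \<eta>\<^sup>2 / 4) / 2"

lemma dev_rate_pos: "\<eta> > 0 \<Longrightarrow> s > 0 \<Longrightarrow> dev_rate \<eta> s > 0"
  by (simp add: dev_rate_def)

text \<open>The scale N may exceed the number of terms, so that all partial sums along an axis obey
  one and the same bound. The sign \<sigma> selects the upper or the lower tail.\<close>

lemma sum_deviation:
  assumes S: "finite S" "real (card S) \<le> N" and r: "\<And>p. p \<in> S \<Longrightarrow> r p \<ge> \<eta>" and pos: "\<eta> > 0" "s > 0"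
    and sgn: "\<sigma> = 1 \<or> \<sigma> = -1"
  shows "measure exp_field {X. s * N \<le> \<sigma> * ((\<Sum>p\<in>S. X p / r p) - (\<Sum>p\<in>S. 1 / r p))} \<le> exp (- dev_rate \<eta> s * N)"
    (is "measure exp_field ?A \<le> _")
proof -
  note [measurable] = measurable_exp_field_component
  define l where "l = min (\<eta> / 2) (s * \<eta>\<^sup>2 / 4)"
  have l: "l > 0" "l \<le> \<eta> / 2" "l \<le> s * \<eta>\<^sup>2 / 4" using pos by (auto simp: l_def)
  have rp: "r p > 0" if "p \<in> S" for p using r[OF that] pos by linarith
  define t where "t p = \<sigma> * l / r p" for p
  have t: "\<bar>t p\<bar> \<le> 1/2" "(t p)\<^sup>2 \<le> l\<^sup>2 / \<eta>\<^sup>2" if "p \<in> S" for p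
  proof -
    have "l / r p \<le> l / \<eta>" using r[OF that] pos l by (intro divide_left_mono) auto
    moreover have "l / \<eta> \<le> 1/2" using l pos by (simp add: field_simps)
    moreover have a: "\<bar>t p\<bar> = l / r p" using sgn l rp[OF that] by (auto simp: t_def)
    ultimately show "\<bar>t p\<bar> \<le> 1/2" by linarith
    have "\<bar>t p\<bar>\<^sup>2 \<le> (l / \<eta>)\<^sup>2"
      unfolding a using \<open>l / r p \<le> l / \<eta>\<close> l rp[OF that] by (intro power_mono) auto
    then show "(t p)\<^sup>2 \<le> l\<^sup>2 / \<eta>\<^sup>2" by (simp add: power_divide)
  qed
  have eq: "l * (\<sigma> * ((\<Sum>p\<in>S. X p / r p) - (\<Sum>p\<in>S. 1 / r p))) = (\<Sum>p\<in>S. t p * (X p - 1))" for X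
    by (simp add: t_def sum_distrib_left sum_subtractf[symmetric] diff_divide_distrib algebra_simps)
  have [measurable]: "?A \<in> sets exp_field"
  proof -
    have "{X \<in> space exp_field. s * N \<le> \<sigma> * ((\<Sum>p\<in>S. X p / r p) - (\<Sum>p\<in>S. 1 / r p))} \<in> sets exp_field" by measurable
    then show ?thesis by simp
  qed
  have "emeasure exp_field ?A = (\<integral>\<^sup>+X. indicator ?A X \<partial>exp_field)" by simp
  also have "\<dots> \<le> (\<integral>\<^sup>+X. ennreal (exp (- l * s * N)) * (\<Prod>p\<in>S. ennreal (exp (t p * (X p - 1)))) \<partial>exp_field)"
  proof (rule nn_integral_mono)
    fix X
    have "1 \<le> exp (- l * s * N) * exp (\<Sum>p\<in>S. t p * (X p - 1))" if "X \<in> ?A"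
    proof -
      have "l * (s * N) \<le> (\<Sum>p\<in>S. t p * (X p - 1))"
        unfolding eq[symmetric] using that l by simp
      then show ?thesis by (simp add: exp_add[symmetric] mult.assoc)
    qed
    moreover have "ennreal (exp (- l * s * N)) * (\<Prod>p\<in>S. ennreal (exp (t p * (X p - 1)))) =
        ennreal (exp (- l * s * N) * exp (\<Sum>p\<in>S. t p * (X p - 1)))"
      by (simp add: prod_ennreal exp_sum S(1) ennreal_mult prod_nonneg)
    ultimately show "indicator ?A X \<le> ennreal (exp (- l * s * N)) * (\<Prod>p\<in>S. ennreal (exp (t p * (X p - 1))))"
      by (auto simp: indicator_def simp flip: ennreal_1 intro!: ennreal_leI)
  qed
  also have "\<dots> = ennreal (exp (- l * s * N)) * (\<integral>\<^sup>+X. (\<Prod>p\<in>S. ennreal (exp (t p * (X p - 1)))) \<partial>exp_field)"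
    by (rule nn_integral_cmult) measurable
  also have "(\<integral>\<^sup>+X. (\<Prod>p\<in>S. ennreal (exp (t p * (X p - 1)))) \<partial>exp_field) =
     (\<Prod>p\<in>S. \<integral>\<^sup>+x. ennreal (exp (t p * (x - 1))) \<partial>exp1)"
    by (rule nn_integral_exp_field_prod[OF S(1)]) measurable
  also have "\<dots> \<le> (\<Prod>p\<in>S. ennreal (exp (2 * l\<^sup>2 / \<eta>\<^sup>2)))"
  proof (rule prod_mono_ennreal)
    fix p assume p: "p \<in> S"
    have "(\<integral>\<^sup>+x. ennreal (exp (t p * (x - 1))) \<partial>exp1) \<le> ennreal (exp (2 * (t p)\<^sup>2))"
      by (rule nn_integral_exp1_exp_centered[OF t(1)[OF p]])
    also have "\<dots> \<le> ennreal (exp (2 * l\<^sup>2 / \<eta>\<^sup>2))" using t(2)[OF p] by (auto intro!: ennreal_leI)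
    finally show "(\<integral>\<^sup>+x. ennreal (exp (t p * (x - 1))) \<partial>exp1) \<le> ennreal (exp (2 * l\<^sup>2 / \<eta>\<^sup>2))" .
  qed
  also have "(\<Prod>p\<in>S. ennreal (exp (2 * l\<^sup>2 / \<eta>\<^sup>2))) = ennreal (exp (card S * (2 * l\<^sup>2 / \<eta>\<^sup>2)))"
    by (simp add: ennreal_power flip: exp_of_nat_mult)
  also have "ennreal (exp (- l * s * N)) * \<dots> = ennreal (exp (card S * (2 * l\<^sup>2 / \<eta>\<^sup>2) - l * s * N))"
    by (simp add: ennreal_mult[symmetric] exp_add[symmetric] algebra_simps)
  also have "\<dots> \<le> ennreal (exp (- dev_rate \<eta> s * N))"
  proof (rule ennreal_leI, rule exp_le_cancel_iff[THEN iffD2])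
    have N: "N \<ge> 0" using S(2) by linarith
    have "2 * l\<^sup>2 / \<eta>\<^sup>2 \<le> l * s / 2"
      using mult_left_mono[OF l(3), of l] l(1) pos by (simp add: field_simps power2_eq_square)
    then have "card S * (2 * l\<^sup>2 / \<eta>\<^sup>2) \<le> N * (l * s / 2)"
      using S(2) N l pos by (intro mult_mono) auto
    then show "card S * (2 * l\<^sup>2 / \<eta>\<^sup>2) - l * s * N \<le> - dev_rate \<eta> s * N"
      by (simp add: dev_rate_def l_def[symmetric] field_simps)
  qed
  finally have "emeasure exp_field ?A \<le> ennreal (exp (- dev_rate \<eta> s * N))"
    by (rule meta_mp) (rule mult_left_mono, auto)
  then show ?thesis by (simp add: exp_field.emeasure_eq_measure)
qed

lemma sum_deviation_reindex:
  assumes I: "finite I" "real (card I) \<le> N" "inj_on \<phi> I" and r: "\<And>i. i \<in> I \<Longrightarrow> r i \<ge> \<eta>"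
    and pos: "\<eta> > 0" "s > 0" and sgn: "\<sigma> = 1 \<or> \<sigma> = -1"
  shows "measure exp_field {X. s * N \<le> \<sigma> * ((\<Sum>i\<in>I. X (\<phi> i) / r i) - (\<Sum>i\<in>I. 1 / r i))} \<le> exp (- dev_rate \<eta> s * N)"
proof -
  have eq: "(\<Sum>p\<in>\<phi> ` I. f p (r (the_inv_into I \<phi> p))) = (\<Sum>i\<in>I. f (\<phi> i) (r i))"
    for f :: "nat \<times> nat \<Rightarrow> real \<Rightarrow> real"
    using I(3) by (simp add: sum.reindex the_inv_into_f_f)
  have "measure exp_field {X. s * N \<le> \<sigma> * ((\<Sum>p\<in>\<phi> ` I. X p / r (the_inv_into I \<phi> p))
      - (\<Sum>p\<in>\<phi> ` I. 1 / r (the_inv_into I \<phi> p)))} \<le> exp (- dev_rate \<eta> s * N)"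
    using I r by (intro sum_deviation pos sgn) (auto simp: the_inv_into_f_f card_image)
  then show ?thesis by (simp only: eq[of "\<lambda>p r. X p / r" for X] eq[of "\<lambda>_ r. 1 / r"])
qed

lemma measurable_lpp:
  assumes [measurable]: "\<And>p. (\<lambda>x. w x p) \<in> borel_measurable M"
  shows "(\<lambda>x. lpp (w x) m n) \<in> borel_measurable M"
\<comment> \<open>The weight in the induction rule is a dummy; only the case pattern on m and n
  matters.\<close>
proof (induction "\<lambda>_ :: nat \<times> nat. 0 :: real" m n rule: lpp.induct)
  case (4 i j)
  note [measurable] = 4
  show ?case by simp
next
  case (2 i)
  note [measurable] = 2
  show ?case by simp
next
  case (3 i)
  note [measurable] = 3
  show ?case by simp
qed simp

lemma measurable_rate_weights: "(\<lambda>X. rate_weights u v X p) \<in> borel_measurable exp_field"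
  using measurable_exp_field_component by (cases p) simp

lemma measurable_bulk_rate_weights: "(\<lambda>X. bulk (rate_weights u v X) p) \<in> borel_measurable exp_field"
  using measurable_rate_weights by (cases p) (simp add: bulk_def del: rate_weights_apply)

text \<open>By \<open>lpp_boundary_sum\<close> the deviating quantity is the centred left edge sum
  evaluated at \<open>burke_grid u v n m X\<close>, which has the same law as X.\<close>

lemma boundary_deviation:
  assumes u: "\<And>i. 1 \<le> i \<Longrightarrow> i \<le> m \<Longrightarrow> u i > 0" "u 0 = 0"
    and v: "\<And>j. 1 \<le> j \<Longrightarrow> j \<le> n \<Longrightarrow> v j \<ge> \<eta>" "v 0 = 0"
    and N: "real n \<le> N" and pos: "\<eta> > 0" "s > 0" and sgn: "\<sigma> = 1 \<or> \<sigma> = -1"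
  shows "measure exp_field {X. s * N \<le> \<sigma> * (lpp (rate_weights u v X) m n - (\<Sum>i=1..m. X (i, 0) / u i)
    - (\<Sum>j=1..n. 1 / v j))} \<le> exp (- dev_rate \<eta> s * N)"
proof -
  note [measurable] = measurable_exp_field_component
  let ?A = "{X. s * N \<le> \<sigma> * ((\<Sum>j=1..n. X (0, j) / v j) - (\<Sum>j=1..n. 1 / v j))}"
  have v': "v j > 0" if "1 \<le> j" "j \<le> n" for j using v(1)[OF that] pos by linarith
  have "{X \<in> space exp_field. s * N \<le> \<sigma> * ((\<Sum>j=1..n. X (0, j) / v j) - (\<Sum>j=1..n. 1 / v j))} \<in> sets exp_field"
    by measurable
  then have A: "?A \<in> sets exp_field" by simp
  have "{X. s * N \<le> \<sigma> * (lpp (rate_weights u v X) m n - (\<Sum>i=1..m. X (i, 0) / u i) - (\<Sum>j=1..n. 1 / v j))}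
      = {X. burke_grid u v n m X \<in> ?A}"
    using lpp_boundary_sum[where u=u and v=v and m=m and n=n] u v v' by simp
  moreover have "measure exp_field {X. burke_grid u v n m X \<in> ?A} = measure exp_field ?A"
    using distr_burke_grid[where u=u and v=v and m=m and n=n] u v v' A
    by (intro measure_exp_field_preserving) auto
  moreover have "measure exp_field ?A \<le> exp (- dev_rate \<eta> s * N)"
    by (rule sum_deviation_reindex) (use v N pos sgn in \<open>auto intro: inj_onI\<close>)
  ultimately show ?thesis by (simp only:)
qed

text \<open>The bulk weights do not depend on \<open>u 0\<close> and \<open>v 0\<close>; setting both to \<open>0\<close> adds the
  stationary boundary weights on the axes.\<close>

lemma upper_tail:
  assumes u: "\<And>i. 1 \<le> i \<Longrightarrow> i \<le> m \<Longrightarrow> u i \<ge> \<eta>" and v: "\<And>j. 1 \<le> j \<Longrightarrow> j \<le> n \<Longrightarrow> v j \<ge> \<eta>"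
    and N: "real m \<le> N" "real n \<le> N" and pos: "\<eta> > 0" "s > 0"
  shows "measure exp_field {X. (\<Sum>i=1..m. 1 / u i) + (\<Sum>j=1..n. 1 / v j) + 2 * s * N
      \<le> lpp (bulk (rate_weights u v X)) m n} \<le> 2 * exp (- dev_rate \<eta> s * N)"
    (is "measure exp_field ?A \<le> _")
proof -
  note [measurable] = measurable_exp_field_component measurable_lpp[OF measurable_rate_weights]
    measurable_lpp[OF measurable_bulk_rate_weights]
  \<comment> \<open>Nothing is known about the rates outside the rectangle; clipping at \<eta> makes
    all weights nonnegative and changes no bulk weight inside.\<close>
  define u' v' where "u' i = (if i = 0 then 0 else max \<eta> (u i))" and "v' i = (if i = 0 then 0 else max \<eta> (v i))" for i
  have u': "\<And>i. 1 \<le> i \<Longrightarrow> i \<le> m \<Longrightarrow> u' i \<ge> \<eta>" "u' 0 = 0" "\<And>i. 1 \<le> i \<Longrightarrow> i \<le> m \<Longrightarrow> u' i > 0"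
    "\<And>i. u' i \<ge> 0" "\<And>i. 1 \<le> i \<Longrightarrow> i \<le> m \<Longrightarrow> u' i = u i"
    and v': "\<And>i. 1 \<le> i \<Longrightarrow> i \<le> n \<Longrightarrow> v' i \<ge> \<eta>" "v' 0 = 0" "\<And>i. v' i \<ge> 0"
    "\<And>i. 1 \<le> i \<Longrightarrow> i \<le> n \<Longrightarrow> v' i = v i"
    using u v pos by (auto simp: u'_def v'_def max_def intro: less_le_trans[OF pos(1)])
  let ?w = "\<lambda>X. rate_weights u' v' X"
  define B :: "(nat \<times> nat \<Rightarrow> real) set" where "B = {X. s * N \<le> 1 * ((\<Sum>i=1..m. X (i, 0) / u' i) - (\<Sum>i=1..m. 1 / u' i))}"
  define C where "C = {X. s * N \<le> 1 * (lpp (?w X) m n - (\<Sum>i=1..m. X (i, 0) / u' i) - (\<Sum>j=1..n. 1 / v' j))}"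
  have "{X \<in> space exp_field. s * N \<le> 1 * ((\<Sum>i=1..m. X (i, 0) / u' i) - (\<Sum>i=1..m. 1 / u' i))} \<in> sets exp_field"
    by measurable
  then have [measurable]: "B \<in> sets exp_field" by (simp add: B_def)
  have "{X \<in> space exp_field. s * N \<le> 1 * (lpp (?w X) m n - (\<Sum>i=1..m. X (i, 0) / u' i) - (\<Sum>j=1..n. 1 / v' j))} \<in> sets exp_field"
    by measurable
  then have [measurable]: "C \<in> sets exp_field" by (simp add: C_def)
  have sums: "(\<Sum>i=1..m. 1 / u' i) = (\<Sum>i=1..m. 1 / u i)" "(\<Sum>j=1..n. 1 / v' j) = (\<Sum>j=1..n. 1 / v j)"
    using u' v' by (auto intro: sum.cong)
  have "measure exp_field ?A \<le> measure exp_field (B \<union> C)"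
  proof (rule exp_field.finite_measure_mono_AE)
    show "AE X in exp_field. X \<in> ?A \<longrightarrow> X \<in> B \<union> C"
      using AE_exp_field_nonneg
    proof eventually_elim
      case (elim X)
      have nn: "0 \<le> ?w X p" for p using elim u'(4) v'(3) by (cases p) auto
      have "lpp (bulk (rate_weights u v X)) m n = lpp (bulk (?w X)) m n"
        by (rule lpp_cong) (use u'(5) v'(4) in \<open>auto simp: bulk_def\<close>)
      also have "\<dots> \<le> lpp (?w X) m n" by (rule lpp_bulk_le[OF nn])
      finally show ?case unfolding B_def C_def sums by auto
    qed
  qed measurable
  also have "\<dots> \<le> measure exp_field B + measure exp_field C" by (rule measure_Un_le) measurable
  also have "measure exp_field B \<le> exp (- dev_rate \<eta> s * N)"
    unfolding B_def by (rule sum_deviation_reindex) (use u' N pos in \<open>auto intro: inj_onI\<close>)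
  also have "measure exp_field C \<le> exp (- dev_rate \<eta> s * N)"
    unfolding C_def by (rule boundary_deviation) (use u' v' N pos in auto)
  finally show ?thesis by simp
qed

section \<open>Exit points and the lower tail at a critical parameter\<close>

text \<open>Second-order expansions with remainders uniform in \<open>x \<ge> \<eta>\<close>; the
  first-order terms are the ones that cancel at a critical parameter.\<close>

lemma inverse_shift_bounds:
  fixes x \<eta> \<delta> :: real
  assumes "\<eta> > 0" "x \<ge> \<eta>" "0 < \<delta>" "\<delta> \<le> \<eta> / 2"
  shows "1 / (x - \<delta>) \<le> 1 / x + \<delta> / x\<^sup>2 + 2 * \<delta>\<^sup>2 / \<eta> ^ 3" "1 / (x - \<delta>) \<le> 2 / \<eta>"
    "1 / (x + \<delta>) \<le> 1 / x - \<delta> / x\<^sup>2 + \<delta>\<^sup>2 / \<eta> ^ 3"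
proof -
  have x: "x > 0" "x - \<delta> \<ge> \<eta> / 2" "x - \<delta> > 0" using assms by linarith+
  show "1 / (x - \<delta>) \<le> 2 / \<eta>" using frac_le[of 1 1 "\<eta> / 2" "x - \<delta>"] x assms by simp
  have "1 / (x - \<delta>) = 1 / x + \<delta> / x\<^sup>2 + \<delta>\<^sup>2 / (x\<^sup>2 * (x - \<delta>))"
    using x by (simp add: divide_simps) (simp add: algebra_simps power2_eq_square)
  moreover have "\<delta>\<^sup>2 / (x\<^sup>2 * (x - \<delta>)) \<le> \<delta>\<^sup>2 / (\<eta>\<^sup>2 * (\<eta> / 2))"
    using assms x by (intro divide_left_mono mult_mono power_mono mult_pos_pos) auto
  moreover have "\<delta>\<^sup>2 / (\<eta>\<^sup>2 * (\<eta> / 2)) = 2 * \<delta>\<^sup>2 / \<eta> ^ 3" by (simp add: power2_eq_square power3_eq_cube)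
  ultimately show "1 / (x - \<delta>) \<le> 1 / x + \<delta> / x\<^sup>2 + 2 * \<delta>\<^sup>2 / \<eta> ^ 3" by linarith
  have "x + \<delta> > 0" using x assms by linarith
  then have "1 / (x + \<delta>) = 1 / x - \<delta> / x\<^sup>2 + \<delta>\<^sup>2 / (x\<^sup>2 * (x + \<delta>))"
    using x by (simp add: divide_simps) (simp add: algebra_simps power2_eq_square)
  moreover have "\<delta>\<^sup>2 / (x\<^sup>2 * (x + \<delta>)) \<le> \<delta>\<^sup>2 / (\<eta>\<^sup>2 * \<eta>)"
    using assms x by (intro divide_left_mono mult_mono power_mono mult_pos_pos) auto
  moreover have "\<delta>\<^sup>2 / (\<eta>\<^sup>2 * \<eta>) = \<delta>\<^sup>2 / \<eta> ^ 3" by (simp add: power2_eq_square power3_eq_cube)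
  ultimately show "1 / (x + \<delta>) \<le> 1 / x - \<delta> / x\<^sup>2 + \<delta>\<^sup>2 / \<eta> ^ 3" by linarith
qed

lemma sum_shift_Icc:
  fixes f :: "nat \<Rightarrow> real"
  shows "(\<Sum>i=1..m - p. f (p + i)) = (\<Sum>i=Suc p..m. f i)"
  by (rule sum.reindex_bij_witness[of _ "\<lambda>i. i - p" "\<lambda>i. p + i"]) auto

lemma sum_split_Icc:
  fixes f :: "nat \<Rightarrow> real"
  assumes "k \<le> m"
  shows "(\<Sum>i=1..m. f i) = (\<Sum>i=1..k. f i) + (\<Sum>i=Suc k..m. f i)"
proof -
  have "{1..m} = {1..k} \<union> {Suc k..m}" using assms by auto
  then show ?thesis by (simp add: sum.union_disjoint)
qed

text \<open>Comparing the stationary model at parameter \<open>z\<close> with the upper bound at \<open>z - \<delta>\<close>: leaving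
  the axis after \<open>k\<close> steps costs about \<open>\<delta> * (\<Sum>i=1..k. 1 / u i ^ 2)\<close>.\<close>

lemma exit_cost:
  fixes u v :: "nat \<Rightarrow> real"
  assumes \<delta>: "\<eta> > 0" "0 < \<delta>" "\<delta> \<le> \<eta> / 2"
    and u: "\<And>i. 1 \<le> i \<Longrightarrow> i \<le> m \<Longrightarrow> u i \<ge> \<eta>" and v: "\<And>j. 1 \<le> j \<Longrightarrow> j \<le> n \<Longrightarrow> v j \<ge> \<eta>"
    and N: "real m \<le> N" "real n \<le> N" and k: "k \<le> m" and "D \<ge> 0" "s \<ge> 0"
    and bal: "(\<Sum>i=1..m. 1 / (u i)\<^sup>2) \<le> (\<Sum>j=1..n. 1 / (v j)\<^sup>2) + D"
    and cmp: "(\<Sum>i=1..m. 1 / u i) + (\<Sum>j=1..n. 1 / v j) \<le> (\<Sum>i=1..k. 1 / u i)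
      + (\<Sum>i=1..m - (k - 1). 1 / (u (k - 1 + i) - \<delta>)) + (\<Sum>j=1..n. 1 / (v j + \<delta>)) + 5 * s * N"
  shows "(\<Sum>i=1..k. 1 / (u i)\<^sup>2) \<le> D + 2 / (\<eta> * \<delta>) + 3 * \<delta> * N / \<eta> ^ 3 + 5 * s * N / \<delta>"
proof (cases "k = 0")
  case True
  then show ?thesis using assms by (auto intro!: add_nonneg_nonneg divide_nonneg_nonneg mult_nonneg_nonneg)
next
  case False
  define U V where "U = (\<Sum>i=Suc k..m. 1 / (u i)\<^sup>2)" and "V = (\<Sum>j=1..n. 1 / (v j)\<^sup>2)"
  \<comment> \<open>A path that leaves the axis at (k, 0) still visits bulk column k, so index k is
    counted on the axis and once more here. The extra term costs at most 2 / \<eta>.\<close>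
  have "(\<Sum>i=1..m - (k - 1). 1 / (u (k - 1 + i) - \<delta>)) = (\<Sum>i=k..m. 1 / (u i - \<delta>))"
    using sum_shift_Icc[of "\<lambda>i. 1 / (u i - \<delta>)" "k - 1" m] False by simp
  also have "\<dots> = 1 / (u k - \<delta>) + (\<Sum>i=Suc k..m. 1 / (u i - \<delta>))"
    by (rule sum.atLeast_Suc_atMost[OF k])
  also have "\<dots> \<le> 2 / \<eta> + (\<Sum>i=Suc k..m. 1 / u i + \<delta> / (u i)\<^sup>2 + 2 * \<delta>\<^sup>2 / \<eta> ^ 3)"
    using False k by (intro add_mono sum_mono inverse_shift_bounds \<delta> u) auto
  also have "\<dots> = 2 / \<eta> + ((\<Sum>i=Suc k..m. 1 / u i) + \<delta> * U + real (m - k) * (2 * \<delta>\<^sup>2 / \<eta> ^ 3))"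
    by (simp add: sum.distrib U_def sum_distrib_left)
  also have "real (m - k) * (2 * \<delta>\<^sup>2 / \<eta> ^ 3) \<le> N * (2 * \<delta>\<^sup>2 / \<eta> ^ 3)"
    using N \<delta> by (intro mult_right_mono) auto
  finally have 1: "(\<Sum>i=1..m - (k - 1). 1 / (u (k - 1 + i) - \<delta>)) \<le>
    2 / \<eta> + ((\<Sum>i=Suc k..m. 1 / u i) + \<delta> * U + N * (2 * \<delta>\<^sup>2 / \<eta> ^ 3))" by simp
  have "(\<Sum>j=1..n. 1 / (v j + \<delta>)) \<le> (\<Sum>j=1..n. 1 / v j - \<delta> / (v j)\<^sup>2 + \<delta>\<^sup>2 / \<eta> ^ 3)"
    by (intro sum_mono inverse_shift_bounds \<delta> v) auto
  also have "\<dots> = (\<Sum>j=1..n. 1 / v j) - \<delta> * V + real n * (\<delta>\<^sup>2 / \<eta> ^ 3)"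
    by (simp add: sum.distrib sum_subtractf V_def sum_distrib_left)
  also have "real n * (\<delta>\<^sup>2 / \<eta> ^ 3) \<le> N * (\<delta>\<^sup>2 / \<eta> ^ 3)"
    using N \<delta> by (intro mult_right_mono) auto
  finally have 2: "(\<Sum>j=1..n. 1 / (v j + \<delta>)) \<le> (\<Sum>j=1..n. 1 / v j) - \<delta> * V + N * (\<delta>\<^sup>2 / \<eta> ^ 3)"
    by simp
  let ?P = "\<Sum>i=1..k. 1 / (u i)\<^sup>2"
  define e where "e = \<delta>\<^sup>2 / \<eta> ^ 3"
  have e: "2 * \<delta>\<^sup>2 / \<eta> ^ 3 = 2 * e" "\<delta>\<^sup>2 / \<eta> ^ 3 = e" "3 * \<delta>\<^sup>2 / \<eta> ^ 3 = 3 * e"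
    by (simp_all add: e_def)
  \<comment> \<open>Through the balance of squares the first-order terms
    \<open>\<delta> * (U - V)\<close> become at most \<open>\<delta> * (D - ?P)\<close>: the squares
    collected on the axis are exactly what the comparison loses.\<close>
  have "?P + U \<le> V + D" using bal sum_split_Icc[OF k, of "\<lambda>i. 1 / (u i)\<^sup>2"] by (simp add: U_def V_def)
  then have "\<delta> * (?P + U) \<le> \<delta> * (V + D)" using \<delta> by (intro mult_left_mono) auto
  then have "\<delta> * ?P \<le> \<delta> * D + 2 / \<eta> + N * (3 * \<delta>\<^sup>2 / \<eta> ^ 3) + 5 * s * N"
    using 1 2 cmp sum_split_Icc[OF k, of "\<lambda>i. 1 / u i"] unfolding e by (simp add: algebra_simps)
  then have "?P \<le> (\<delta> * D + 2 / \<eta> + N * (3 * \<delta>\<^sup>2 / \<eta> ^ 3) + 5 * s * N) / \<delta>"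
    using \<delta> by (simp add: pos_le_divide_eq mult.commute)
  also have "\<dots> = D + 2 / (\<eta> * \<delta>) + 3 * \<delta> * N / \<eta> ^ 3 + 5 * s * N / \<delta>"
    using \<delta> by (simp add: add_divide_distrib power2_eq_square)
  finally show ?thesis .
qed

text \<open>The exit cost controls the squares of the mean weights on the axis. Since
  \<open>x \<le> \<theta> + x\<^sup>2 / \<theta>\<close>, it controls the means too, even where
  large rates make the squares far smaller than the means.\<close>

lemma sum_inverse_le_squares:
  fixes u :: "nat \<Rightarrow> real"
  assumes "\<theta> > 0" "real k \<le> N" "\<And>i. 1 \<le> i \<Longrightarrow> i \<le> k \<Longrightarrow> u i > 0"
  shows "(\<Sum>i=1..k. 1 / u i) \<le> \<theta> * N + (\<Sum>i=1..k. 1 / (u i)\<^sup>2) / \<theta>"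
proof -
  have "x \<le> \<theta> + x\<^sup>2 / \<theta>" if "x \<ge> 0" for x :: real
  proof (cases "x \<le> \<theta>")
    case False
    then have "x * \<theta> \<le> x\<^sup>2" using that by (simp add: power2_eq_square mult_left_mono)
    then show ?thesis using assms(1) by (simp add: pos_le_divide_eq add_increasing)
  qed (use assms(1) in \<open>auto intro: add_increasing2\<close>)
  then have "(\<Sum>i=1..k. 1 / u i) \<le> (\<Sum>i=1..k. \<theta> + (1 / u i)\<^sup>2 / \<theta>)"
    by (intro sum_mono) (use assms(3) in \<open>auto simp: less_imp_le\<close>)
  also have "\<dots> = real k * \<theta> + (\<Sum>i=1..k. 1 / (u i)\<^sup>2) / \<theta>"
    by (simp add: sum.distrib power_divide sum_divide_distrib)
  also have "real k * \<theta> \<le> \<theta> * N" using assms by (simp add: mult.commute)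
  finally show ?thesis by simp
qed

text \<open>The deterministic half of the critical case: \<open>stat\<close>, \<open>axes\<close>
  and \<open>upper\<close> describe the good event. The slack D in the equation
  \<open>M' z = 0\<close> serves rectangles that can be balanced only up to one row.\<close>

lemma critical_lower_bound:
  fixes u v :: "nat \<Rightarrow> real"
  assumes w: "\<And>p. 0 \<le> w p" and \<delta>: "\<eta> > 0" "0 < \<delta>" "\<delta> \<le> \<eta> / 2" and \<theta>: "\<theta> > 0"
    and u: "\<And>i. 1 \<le> i \<Longrightarrow> i \<le> m \<Longrightarrow> u i \<ge> \<eta>" and v: "\<And>j. 1 \<le> j \<Longrightarrow> j \<le> n \<Longrightarrow> v j \<ge> \<eta>"
    and N: "real m \<le> N" "real n \<le> N" and s: "s \<ge> 0"
    and bal: "\<bar>(\<Sum>i=1..m. 1 / (u i)\<^sup>2) - (\<Sum>j=1..n. 1 / (v j)\<^sup>2)\<bar> \<le> D"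
    and stat: "(\<Sum>i=1..m. 1 / u i) + (\<Sum>j=1..n. 1 / v j) - 2 * s * N \<le> lpp w m n"
    and axes: "\<And>k. k \<le> m \<Longrightarrow> (\<Sum>i=1..k. w (i, 0)) \<le> (\<Sum>i=1..k. 1 / u i) + s * N"
      "\<And>l. l \<le> n \<Longrightarrow> (\<Sum>j=1..l. w (0, j)) \<le> (\<Sum>j=1..l. 1 / v j) + s * N"
    and upper: "\<And>k. k \<le> m \<Longrightarrow> lpp (bulk (offset (k - 1) 0 w)) (m - (k - 1)) n \<le>
        (\<Sum>i=1..m - (k - 1). 1 / (u (k - 1 + i) - \<delta>)) + (\<Sum>j=1..n. 1 / (v j + \<delta>)) + 2 * s * N"
      "\<And>l. l \<le> n \<Longrightarrow> lpp (bulk (offset 0 (l - 1) w)) m (n - (l - 1)) \<le>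
        (\<Sum>i=1..m. 1 / (u i + \<delta>)) + (\<Sum>j=1..n - (l - 1). 1 / (v (l - 1 + j) - \<delta>)) + 2 * s * N"
    and cost: "3 * s * N + \<theta> * N + (D + 2 / (\<eta> * \<delta>) + 3 * \<delta> * N / \<eta> ^ 3 + 5 * s * N / \<delta>) / \<theta> \<le> \<epsilon> * N"
  shows "(\<Sum>i=1..m. 1 / u i) + (\<Sum>j=1..n. 1 / v j) - \<epsilon> * N \<le> lpp (bulk w) m n"
proof -
  let ?C = "D + 2 / (\<eta> * \<delta>) + 3 * \<delta> * N / \<eta> ^ 3 + 5 * s * N / \<delta>"
  have D: "D \<ge> 0" using bal by linarith
  have bal': "(\<Sum>i=1..m. 1 / (u i)\<^sup>2) \<le> (\<Sum>j=1..n. 1 / (v j)\<^sup>2) + D"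
    "(\<Sum>j=1..n. 1 / (v j)\<^sup>2) \<le> (\<Sum>i=1..m. 1 / (u i)\<^sup>2) + D" using bal by linarith+
  have small: "(\<Sum>i=1..k. 1 / u i) \<le> \<theta> * N + ?C / \<theta>"
    if "k \<le> N" "\<And>i. 1 \<le> i \<Longrightarrow> i \<le> k \<Longrightarrow> u i \<ge> \<eta>" "(\<Sum>i=1..k. 1 / (u i)\<^sup>2) \<le> ?C"
    for u :: "nat \<Rightarrow> real" and k :: nat
  proof -
    have "(\<Sum>i=1..k. 1 / u i) \<le> \<theta> * N + (\<Sum>i=1..k. 1 / (u i)\<^sup>2) / \<theta>"
      using that \<delta> by (intro sum_inverse_le_squares \<theta>) (auto intro: less_le_trans[OF \<delta>(1)])
    also have "(\<Sum>i=1..k. 1 / (u i)\<^sup>2) / \<theta> \<le> ?C / \<theta>" using that(3) \<theta> by (intro divide_right_mono) auto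
    finally show ?thesis by simp
  qed
  from lpp_exit[of m w n] show ?thesis
  proof (elim disjE exE conjE)
    fix k assume k: "k \<le> m" and le: "lpp w m n \<le>
      (\<Sum>i=1..k. w (i, 0)) + lpp (bulk (offset (k - 1) 0 w)) (m - (k - 1)) n"
    \<comment> \<open>The factor 5 in the exit cost is 2 from \<open>stat\<close>, 1 from
      \<open>axes\<close> and 2 from \<open>upper\<close>; the factor 3 in \<open>cost\<close> is 2
      from \<open>stat\<close> and 1 from \<open>axes\<close>.\<close>
    have "(\<Sum>i=1..k. 1 / (u i)\<^sup>2) \<le> ?C"
      by (rule exit_cost[where u=u and v=v and m=m and n=n, OF \<delta> u v N k D s])
        (use bal'(1) stat le axes(1)[OF k] upper(1)[OF k] in \<open>simp_all add: algebra_simps\<close>)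
    then have "(\<Sum>i=1..k. 1 / u i) \<le> \<theta> * N + ?C / \<theta>"
      using k N u by (intro small) auto
    moreover have "lpp (bulk (offset (k - 1) 0 w)) (m - (k - 1)) (n - 0) \<le> lpp (bulk w) m n"
      by (rule lpp_bulk_shift_le[OF w]) (use k in auto)
    ultimately show ?thesis using stat le axes(1)[OF k] cost by simp
  next
    fix l assume l: "l \<le> n" and le: "lpp w m n \<le>
      (\<Sum>j=1..l. w (0, j)) + lpp (bulk (offset 0 (l - 1) w)) m (n - (l - 1))"
    have "(\<Sum>i=1..l. 1 / (v i)\<^sup>2) \<le> ?C"
      by (rule exit_cost[where u=v and v=u and m=n and n=m, OF \<delta> v u N(2,1) l D s])
        (use bal'(2) stat le axes(2)[OF l] upper(2)[OF l] in \<open>simp_all add: algebra_simps\<close>)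
    then have "(\<Sum>i=1..l. 1 / v i) \<le> \<theta> * N + ?C / \<theta>"
      using l N v by (intro small) auto
    moreover have "lpp (bulk (offset 0 (l - 1) w)) (m - 0) (n - (l - 1)) \<le> lpp (bulk w) m n"
      by (rule lpp_bulk_shift_le[OF w]) (use l in auto)
    ultimately show ?thesis using stat le axes(2)[OF l] cost by simp
  qed
qed

lemma bulk_shift_rate_weights:
  "bulk (offset p q (rate_weights u v X)) =
     bulk (rate_weights (\<lambda>i. u (p + i)) (\<lambda>j. v (q + j)) (X \<circ> (\<lambda>(i, j). (p + i, q + j))))"
  by (auto simp: bulk_def)

lemma exp_field_ge_sets: "(f :: _ \<Rightarrow> real) \<in> borel_measurable exp_field \<Longrightarrow> {X. c \<le> f X} \<in> sets exp_field"
  and exp_field_less_sets: "(f :: _ \<Rightarrow> real) \<in> borel_measurable exp_field \<Longrightarrow> {X. f X < c} \<in> sets exp_field"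
  using borel_measurable_iff_ge[of f exp_field] borel_measurable_iff_less[of f exp_field] by auto

lemma measure_exp_field_reindex:
  assumes "inj \<phi>" "A \<in> sets exp_field"
  shows "measure exp_field {X. X \<circ> \<phi> \<in> A} = measure exp_field A"
  by (intro measure_exp_field_preserving measurable_reindex distr_exp_field_reindex assms)

lemma inj_translate: "inj (\<lambda>(i, j). (p + i, q + j) :: nat \<times> nat)"
  by (auto intro!: injI)

lemma measure_bulk_shift:
  "measure exp_field {X. R (lpp (bulk (offset p q (rate_weights u v X))) m n)} =
   measure exp_field {X. R (lpp (bulk (rate_weights (\<lambda>i. u (p + i)) (\<lambda>j. v (q + j)) X)) m n)}"
  if "{x. R x} \<in> sets borel"
proof -
  have "(\<lambda>X. lpp (bulk (rate_weights (\<lambda>i. u (p + i)) (\<lambda>j. v (q + j)) X)) m n) -` {x. R x} \<inter> space exp_field \<in> sets exp_field"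
    by (rule measurable_sets[OF measurable_lpp[OF measurable_bulk_rate_weights] that])
  from measure_exp_field_reindex[OF inj_translate[of p q] this] show ?thesis
    by (simp add: bulk_shift_rate_weights)
qed

lemma measurable_bulk_shift_rate_weights: "(\<lambda>X. bulk (offset p q (rate_weights u v X)) r) \<in> borel_measurable exp_field"
  using measurable_exp_field_component by (cases r; cases "fst r = 0 \<or> snd r = 0") (auto simp: bulk_def)

text \<open>The factor N + 1 pays for a union over exit points. The constants depend on \<epsilon>,
  \<eta> and D but not on the rates, so the bounds can later be summed over arrays that vary with m
  and n.\<close>

lemma critical_tail:
  assumes "\<epsilon> > 0" "\<eta> > 0"
  obtains c N0 where "c > 0" "\<And>u v m n N. N \<ge> N0 \<Longrightarrow> real m \<le> N \<Longrightarrow> real n \<le> N \<Longrightarrow>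
    (\<And>i. 1 \<le> i \<Longrightarrow> i \<le> m \<Longrightarrow> u i \<ge> \<eta>) \<Longrightarrow> (\<And>j. 1 \<le> j \<Longrightarrow> j \<le> n \<Longrightarrow> v j \<ge> \<eta>) \<Longrightarrow>
    \<bar>(\<Sum>i=1..m. 1 / (u i)\<^sup>2) - (\<Sum>j=1..n. 1 / (v j)\<^sup>2)\<bar> \<le> D \<Longrightarrow>
    measure exp_field {X. lpp (bulk (rate_weights u v X)) m n < (\<Sum>i=1..m. 1 / u i) + (\<Sum>j=1..n. 1 / v j) - \<epsilon> * N}
      \<le> 8 * (N + 1) * exp (- c * N)"
proof -
  \<comment> \<open>The allowance \<open>\<epsilon> * N\<close> in \<open>cost\<close> is split into
    \<epsilon> / 4 for \<open>3 * s\<close>, \<epsilon> / 4 for \<theta> and \<epsilon> / 2 for the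
    quotient by \<theta>. The last asks for a numerator of at most
    \<open>\<epsilon>\<^sup>2 / 8 * N\<close>: a share 1/32 each for the terms with \<delta> and s,
    and 1/16 for the terms without N, which is the origin of \<open>N0\<close>.\<close>
  define \<theta> where "\<theta> = \<epsilon> / 4"
  define \<delta> where "\<delta> = min (\<eta> / 2) (\<epsilon>\<^sup>2 * \<eta> ^ 3 / 96)"
  define s where "s = min (\<epsilon> / 12) (\<epsilon>\<^sup>2 * \<delta> / 160)"
  have \<delta>: "\<eta> > 0" "0 < \<delta>" "\<delta> \<le> \<eta> / 2" "\<delta> \<le> \<epsilon>\<^sup>2 * \<eta> ^ 3 / 96" using assms by (auto simp: \<delta>_def)
  have s: "0 < s" "s \<le> \<epsilon> / 12" "s \<le> \<epsilon>\<^sup>2 * \<delta> / 160" using assms \<delta> by (auto simp: s_def)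
  have \<theta>: "\<theta> > 0" using assms by (simp add: \<theta>_def)
  \<comment> \<open>Rates shifted by \<delta> are only known to be at least \<eta> / 2.\<close>
  define c where "c = dev_rate (\<eta> / 2) s"
  define N0 where "N0 = (\<bar>D\<bar> + 2 / (\<eta> * \<delta>)) / (\<epsilon>\<^sup>2 / 16)"
  have c: "c > 0" unfolding c_def using assms s by (intro dev_rate_pos) auto
  have main: "measure exp_field {X. lpp (bulk (rate_weights u v X)) m n < (\<Sum>i=1..m. 1 / u i) + (\<Sum>j=1..n. 1 / v j) - \<epsilon> * N}
      \<le> 8 * (N + 1) * exp (- c * N)" (is "measure exp_field ?A \<le> _")
    if N: "N \<ge> N0" "real m \<le> N" "real n \<le> N"
    and bal: "\<bar>(\<Sum>i=1..m. 1 / (u i)\<^sup>2) - (\<Sum>j=1..n. 1 / (v j)\<^sup>2)\<bar> \<le> D"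
    and u_def: "u = (\<lambda>i. if i = 0 then 0 else max \<eta> (u0 i))" and v_def: "v = (\<lambda>i. if i = 0 then 0 else max \<eta> (v0 i))"
    for u0 v0 u v m n N
  proof -
    have u: "u i \<ge> \<eta>" "u i \<ge> \<eta> / 2" "u i > 0" "u i + \<delta> \<ge> \<eta> / 2" "u i - \<delta> \<ge> \<eta> / 2" if "1 \<le> i" for i
      using that assms \<delta> by (auto simp: u_def max_def)
    have v: "v i \<ge> \<eta>" "v i \<ge> \<eta> / 2" "v i > 0" "v i + \<delta> \<ge> \<eta> / 2" "v i - \<delta> \<ge> \<eta> / 2" if "1 \<le> i" for i
      using that assms \<delta> by (auto simp: v_def max_def)
    have uv0: "u 0 = 0" "v 0 = 0" "u i \<ge> 0" "v i \<ge> 0" for i using assms by (auto simp: u_def v_def)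
    have N_nn: "N \<ge> 0" using N by linarith
    have D: "D \<ge> 0" using bal by linarith
    have cost: "3 * s * N + \<theta> * N + (D + 2 / (\<eta> * \<delta>) + 3 * \<delta> * N / \<eta> ^ 3 + 5 * s * N / \<delta>) / \<theta> \<le> \<epsilon> * N"
    proof -
      have 1: "3 * s * N \<le> \<epsilon> / 4 * N" using s N_nn by (intro mult_right_mono) auto
      have 2: "D + 2 / (\<eta> * \<delta>) \<le> \<epsilon>\<^sup>2 / 16 * N"
        using N(1) D assms by (simp add: N0_def pos_divide_le_eq mult.commute)
      have "3 * \<delta> / \<eta> ^ 3 \<le> \<epsilon>\<^sup>2 / 32" using \<delta> assms by (simp add: field_simps)
      then have 3: "3 * \<delta> * N / \<eta> ^ 3 \<le> \<epsilon>\<^sup>2 / 32 * N" using mult_right_mono[OF _ N_nn] by fastforce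
      have "5 * s / \<delta> \<le> \<epsilon>\<^sup>2 / 32" using s \<delta> by (simp add: field_simps)
      then have 4: "5 * s * N / \<delta> \<le> \<epsilon>\<^sup>2 / 32 * N" using mult_right_mono[OF _ N_nn] by fastforce
      have "D + 2 / (\<eta> * \<delta>) + 3 * \<delta> * N / \<eta> ^ 3 + 5 * s * N / \<delta> \<le> \<epsilon>\<^sup>2 / 8 * N"
        using 2 3 4 by linarith
      then have "(D + 2 / (\<eta> * \<delta>) + 3 * \<delta> * N / \<eta> ^ 3 + 5 * s * N / \<delta>) / \<theta> \<le> \<epsilon>\<^sup>2 / 8 * N / \<theta>"
        using \<theta> by (intro divide_right_mono) auto
      also have "\<dots> = \<epsilon> / 2 * N" using assms by (simp add: \<theta>_def power2_eq_square)
      finally have 5: "(D + 2 / (\<eta> * \<delta>) + 3 * \<delta> * N / \<eta> ^ 3 + 5 * s * N / \<delta>) / \<theta> \<le> \<epsilon> / 2 * N" .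
      have "\<epsilon> / 4 * N + \<epsilon> / 4 * N + \<epsilon> / 2 * N = \<epsilon> * N" by (simp add: field_simps)
      moreover have "\<theta> * N = \<epsilon> / 4 * N" by (simp add: \<theta>_def)
      ultimately show ?thesis using 1 5 by linarith
    qed
    let ?w = "rate_weights u v"
    define B1 :: "(nat \<times> nat \<Rightarrow> real) set" where "B1 = {X. s * N \<le> (-1) * ((\<Sum>i=1..m. X (i, 0) / u i) - (\<Sum>i=1..m. 1 / u i))}"
    define B2 where "B2 = {X. s * N \<le> (-1) * (lpp (?w X) m n - (\<Sum>i=1..m. X (i, 0) / u i) - (\<Sum>j=1..n. 1 / v j))}"
    define B3 :: "nat \<Rightarrow> (nat \<times> nat \<Rightarrow> real) set" where "B3 k = {X. s * N \<le> 1 * ((\<Sum>i=1..k. X (i, 0) / u i) - (\<Sum>i=1..k. 1 / u i))}" for k :: nat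
    define B4 :: "nat \<Rightarrow> (nat \<times> nat \<Rightarrow> real) set" where "B4 l = {X. s * N \<le> 1 * ((\<Sum>j=1..l. X (0, j) / v j) - (\<Sum>j=1..l. 1 / v j))}" for l :: nat
    define B5 where "B5 k = {X. (\<Sum>i=1..m - (k - 1). 1 / (u (k - 1 + i) - \<delta>)) + (\<Sum>j=1..n. 1 / (v j + \<delta>)) + 2 * s * N
      \<le> lpp (bulk (offset (k - 1) 0 (?w X))) (m - (k - 1)) n}" for k
    define B6 where "B6 l = {X. (\<Sum>i=1..m. 1 / (u i + \<delta>)) + (\<Sum>j=1..n - (l - 1). 1 / (v (l - 1 + j) - \<delta>)) + 2 * s * N
      \<le> lpp (bulk (offset 0 (l - 1) (?w X))) m (n - (l - 1))}" for l
    note [measurable] = measurable_exp_field_component measurable_lpp[OF measurable_rate_weights]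
      measurable_lpp[OF measurable_bulk_rate_weights] measurable_lpp[OF measurable_bulk_shift_rate_weights]
    have B1: "B1 \<in> sets exp_field" unfolding B1_def by (rule exp_field_ge_sets) measurable
    have B2: "B2 \<in> sets exp_field" unfolding B2_def by (rule exp_field_ge_sets) measurable
    have B3: "B3 k \<in> sets exp_field" for k unfolding B3_def by (rule exp_field_ge_sets) measurable
    have B4: "B4 k \<in> sets exp_field" for k unfolding B4_def by (rule exp_field_ge_sets) measurable
    have B5: "B5 k \<in> sets exp_field" for k unfolding B5_def by (rule exp_field_ge_sets) measurable
    have B6: "B6 k \<in> sets exp_field" for k unfolding B6_def by (rule exp_field_ge_sets) measurable
    note [measurable] = B1 B2 B3 B4 B5 B6
    let ?e = "exp (- c * N)"
    have m1: "measure exp_field B1 \<le> ?e" unfolding B1_def c_def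
      by (rule sum_deviation_reindex) (use u N assms s in \<open>auto intro: inj_onI\<close>)
    have m2: "measure exp_field B2 \<le> ?e" unfolding B2_def c_def
      by (rule boundary_deviation) (use u v uv0 N assms s in auto)
    have m3: "measure exp_field (B3 k) \<le> ?e" if "k \<in> {..m}" for k unfolding B3_def c_def
      by (rule sum_deviation_reindex) (use u N assms s that in \<open>auto intro: inj_onI\<close>)
    have m4: "measure exp_field (B4 k) \<le> ?e" if "k \<in> {..n}" for k unfolding B4_def c_def
      by (rule sum_deviation_reindex) (use v N assms s that in \<open>auto intro: inj_onI\<close>)
    \<comment> \<open>The two shifts cancel in every bulk rate, so \<open>upper_tail\<close> at the
      shifted parameter speaks about the weights of the original model.\<close>
    have shift_rates: "bulk (rate_weights (\<lambda>i. u (p + i)) (\<lambda>j. v (q + j)) X) =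
        bulk (rate_weights (\<lambda>i. u (p + i) - t) (\<lambda>j. v (q + j) + t) X)" for p q t X
      by (auto simp: bulk_def)
    have m5: "measure exp_field (B5 k) \<le> 2 * ?e" if "k \<in> {..m}" for k unfolding B5_def c_def
    proof (subst measure_bulk_shift)
      show "measure exp_field {X. (\<Sum>i=1..m - (k - 1). 1 / (u (k - 1 + i) - \<delta>)) + (\<Sum>j=1..n. 1 / (v j + \<delta>)) + 2 * s * N
        \<le> lpp (bulk (rate_weights (\<lambda>i. u (k - 1 + i)) (\<lambda>j. v (0 + j)) X)) (m - (k - 1)) n}
        \<le> 2 * exp (- dev_rate (\<eta> / 2) s * N)"
        unfolding shift_rates[of "k - 1" 0 _ \<delta>]
        using upper_tail[where u="\<lambda>i. u (k - 1 + i) - \<delta>" and v="\<lambda>j. v (0 + j) + \<delta>" and m="m - (k - 1)"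
          and n=n and N=N and \<eta>="\<eta> / 2" and s=s] u v N assms s by simp
    qed measurable
    have m6: "measure exp_field (B6 k) \<le> 2 * ?e" if "k \<in> {..n}" for k unfolding B6_def c_def
    proof (subst measure_bulk_shift)
      show "measure exp_field {X. (\<Sum>i=1..m. 1 / (u i + \<delta>)) + (\<Sum>j=1..n - (k - 1). 1 / (v (k - 1 + j) - \<delta>)) + 2 * s * N
        \<le> lpp (bulk (rate_weights (\<lambda>i. u (0 + i)) (\<lambda>j. v (k - 1 + j)) X)) m (n - (k - 1))}
        \<le> 2 * exp (- dev_rate (\<eta> / 2) s * N)"
        unfolding shift_rates[of 0 "k - 1" _ "- \<delta>"]
        using upper_tail[where u="\<lambda>i. u (0 + i) - - \<delta>" and v="\<lambda>j. v (k - 1 + j) + - \<delta>" and m=m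
          and n="n - (k - 1)" and N=N and \<eta>="\<eta> / 2" and s=s] u v N assms s by simp
    qed measurable
    have "measure exp_field ?A \<le> measure exp_field (B1 \<union> B2 \<union> (\<Union>k\<in>{..m}. B3 k) \<union> (\<Union>k\<in>{..n}. B4 k) \<union> (\<Union>k\<in>{..m}. B5 k) \<union> (\<Union>k\<in>{..n}. B6 k))"
      (is "_ \<le> measure exp_field ?B")
    proof (rule exp_field.finite_measure_mono_AE)
      show "AE X in exp_field. X \<in> ?A \<longrightarrow> X \<in> ?B"
        using AE_exp_field_nonneg
      proof eventually_elim
        case (elim X)
        have nn: "0 \<le> ?w X p" for p using elim uv0 by (cases p) auto
        show ?case
        proof (rule impI, rule ccontr)
          assume A: "X \<in> ?A" and nB: "X \<notin> ?B"
          have "(\<Sum>i=1..m. 1 / u i) + (\<Sum>j=1..n. 1 / v j) - \<epsilon> * N \<le> lpp (bulk (?w X)) m n"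
          proof (rule critical_lower_bound[OF nn \<delta>(1-3) \<theta> _ _ N(2,3) _ bal _ _ _ _ _ cost])
            show "(\<Sum>i=1..m. 1 / u i) + (\<Sum>j=1..n. 1 / v j) - 2 * s * N \<le> lpp (?w X) m n"
              using nB by (auto simp: B1_def B2_def)
          next
            fix k assume "k \<le> m"
            then have "X \<notin> B3 k" "X \<notin> B5 k" using nB by auto
            then show "(\<Sum>i=1..k. ?w X (i, 0)) \<le> (\<Sum>i=1..k. 1 / u i) + s * N"
              "lpp (bulk (offset (k - 1) 0 (?w X))) (m - (k - 1)) n \<le>
        (\<Sum>i=1..m - (k - 1). 1 / (u (k - 1 + i) - \<delta>)) + (\<Sum>j=1..n. 1 / (v j + \<delta>)) + 2 * s * N"
              by (simp_all add: B3_def B5_def uv0)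
          next
            fix k assume "k \<le> n"
            then have "X \<notin> B4 k" "X \<notin> B6 k" using nB by auto
            then show "(\<Sum>i=1..k. ?w X (0, i)) \<le> (\<Sum>i=1..k. 1 / v i) + s * N"
              "lpp (bulk (offset 0 (k - 1) (?w X))) m (n - (k - 1)) \<le>
        (\<Sum>i=1..m. 1 / (u i + \<delta>)) + (\<Sum>j=1..n - (k - 1). 1 / (v (k - 1 + j) - \<delta>)) + 2 * s * N"
              by (simp_all add: B4_def B6_def uv0)
          qed (use u v s in auto)
          with A show False by simp
        qed
      qed
    qed measurable
    also have "\<dots> \<le> measure exp_field B1 + measure exp_field B2 + measure exp_field (\<Union>k\<in>{..m}. B3 k) + measure exp_field (\<Union>k\<in>{..n}. B4 k)
      + measure exp_field (\<Union>k\<in>{..m}. B5 k) + measure exp_field (\<Union>k\<in>{..n}. B6 k)"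
      by (intro order_trans[OF measure_Un_le] add_mono order_refl) measurable
    also have "measure exp_field (\<Union>k\<in>{..m}. B3 k) \<le> (\<Sum>k\<in>{..m}. measure exp_field (B3 k))"
      by (rule measure_UNION_le) auto
    also have "\<dots> \<le> (\<Sum>k\<in>{..m}. ?e)" by (intro sum_mono m3)
    also have "measure exp_field (\<Union>k\<in>{..n}. B4 k) \<le> (\<Sum>k\<in>{..n}. measure exp_field (B4 k))"
      by (rule measure_UNION_le) auto
    also have "\<dots> \<le> (\<Sum>k\<in>{..n}. ?e)" by (intro sum_mono m4)
    also have "measure exp_field (\<Union>k\<in>{..m}. B5 k) \<le> (\<Sum>k\<in>{..m}. measure exp_field (B5 k))"
      by (rule measure_UNION_le) auto
    also have "\<dots> \<le> (\<Sum>k\<in>{..m}. 2 * ?e)" by (intro sum_mono m5)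
    also have "measure exp_field (\<Union>k\<in>{..n}. B6 k) \<le> (\<Sum>k\<in>{..n}. measure exp_field (B6 k))"
      by (rule measure_UNION_le) auto
    also have "\<dots> \<le> (\<Sum>k\<in>{..n}. 2 * ?e)" by (intro sum_mono m6)
    finally have "measure exp_field ?A \<le> measure exp_field B1 + measure exp_field B2 + (real m + 1) * ?e + (real n + 1) * ?e
      + (real m + 1) * (2 * ?e) + (real n + 1) * (2 * ?e)"
      by (simp add: add.commute)
    also have "\<dots> \<le> ?e + ?e + (N + 1) * ?e + (N + 1) * ?e + (N + 1) * (2 * ?e) + (N + 1) * (2 * ?e)"
      using N by (intro add_mono m1 m2 mult_right_mono) auto
    \<comment> \<open>Two events concern the stationary passage time; each exit point on either axis
      contributes one event of probability \<open>?e\<close> and one of \<open>2 * ?e\<close>. In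
      all this is \<open>2 + 6 * (N + 1) \<le> 8 * (N + 1)\<close> times \<open>?e\<close>.\<close>
    also have "\<dots> \<le> 8 * (N + 1) * ?e" using N_nn by (simp add: algebra_simps)
    finally show ?thesis .
  qed
  show ?thesis
  proof (rule that[OF c])
    fix u0 v0 m n N
    assume N: "N \<ge> N0" "real m \<le> N" "real n \<le> N"
      and u0: "\<And>i. 1 \<le> i \<Longrightarrow> i \<le> m \<Longrightarrow> u0 i \<ge> \<eta>" and v0: "\<And>j. 1 \<le> j \<Longrightarrow> j \<le> n \<Longrightarrow> v0 j \<ge> \<eta>"
      and bal: "\<bar>(\<Sum>i=1..m. 1 / (u0 i)\<^sup>2) - (\<Sum>j=1..n. 1 / (v0 j)\<^sup>2)\<bar> \<le> D"
    let ?u = "\<lambda>i. if i = 0 then 0 else max \<eta> (u0 i)" and ?v = "\<lambda>i. if i = 0 then 0 else max \<eta> (v0 i)"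
    have eq: "0 < i \<Longrightarrow> i \<le> m \<Longrightarrow> max \<eta> (u0 i) = u0 i" "0 < i \<Longrightarrow> i \<le> n \<Longrightarrow> max \<eta> (v0 i) = v0 i" for i
      using u0[of i] v0[of i] by (auto simp: max_absorb2)
    have "(\<Sum>i=1..m. f (?u i)) = (\<Sum>i=1..m. f (u0 i))" "(\<Sum>j=1..n. f (?v j)) = (\<Sum>j=1..n. f (v0 j))" for f :: "real \<Rightarrow> real"
      using u0 v0 by (auto intro!: sum.cong simp: max_absorb2)
    note sums = this
    have "lpp (bulk (rate_weights u0 v0 X)) m n = lpp (bulk (rate_weights ?u ?v X)) m n" for X
      by (rule lpp_cong) (use eq in \<open>auto simp: bulk_def\<close>)
    with main[where ?u0.0=u0 and ?v0.0=v0, OF N _ refl refl] bal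
    show "measure exp_field {X. lpp (bulk (rate_weights u0 v0 X)) m n <
        (\<Sum>i=1..m. 1 / u0 i) + (\<Sum>j=1..n. 1 / v0 j) - \<epsilon> * N} \<le> 8 * (N + 1) * exp (- c * N)"
      by (simp only: sums[of "\<lambda>x. 1 / x"] sums[of "\<lambda>x. 1 / x\<^sup>2"])
  qed
qed

section \<open>The lower tail in general\<close>

text \<open>Partial sums that grow by at most D per step cannot miss P by more than D. This finds
  the row at which the squares of the inverse rates balance.\<close>

lemma discrete_ivt:
  fixes r :: "nat \<Rightarrow> real"
  assumes "\<And>j. 1 \<le> j \<Longrightarrow> j \<le> n \<Longrightarrow> r j \<le> D" "0 \<le> D" "0 \<le> P" "P \<le> (\<Sum>j=1..n. r j)"
  shows "\<exists>j\<le>n. (\<Sum>i=1..j. r i) \<le> P \<and> P \<le> (\<Sum>i=1..j. r i) + D"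
  using assms
proof (induction n)
  case (Suc n)
  show ?case
  proof (cases "P \<le> (\<Sum>j=1..n. r j)")
    case True
    then obtain j where "j \<le> n" "(\<Sum>i=1..j. r i) \<le> P" "P \<le> (\<Sum>i=1..j. r i) + D"
      using Suc by auto
    then show ?thesis by (intro exI[of _ j]) auto
  next
    case False
    then show ?thesis using Suc.prems(1)[of "Suc n"] Suc.prems(4) by (intro exI[of _ n]) auto
  qed
qed auto

lemma offset_offset: "offset p q (offset p' q' w) = offset (p' + p) (q' + q) w"
  by (auto simp: offset_def add.assoc)

text \<open>Column p acts as a boundary: its weights have rate \<open>\<eta> + v j\<close>, so for
  small \<eta> their means are close to \<open>1 / v j\<close>, those of a stationary boundary. As
  \<open>v j \<ge> c0 / 2\<close>, the bound
  \<open>\<eta> \<le> \<epsilon> * c0\<^sup>2 / 16\<close> makes the difference at most \<epsilon> /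
  4 per row.\<close>

lemma linear_tail:
  assumes "\<epsilon> > 0" "c0 > 0" and \<eta>: "\<eta> > 0" "\<eta> \<le> c0 / 2" "\<eta> \<le> \<epsilon> * c0\<^sup>2 / 16"
  obtains c N0 where "c > 0" "\<And>u v m n p N. N \<ge> N0 \<Longrightarrow> real m \<le> N \<Longrightarrow> real n \<le> N \<Longrightarrow>
    1 \<le> p \<Longrightarrow> p \<le> m \<Longrightarrow> u p = \<eta> \<Longrightarrow>
    (\<And>i. 1 \<le> i \<Longrightarrow> i \<le> m \<Longrightarrow> u i \<ge> \<eta>) \<Longrightarrow> (\<And>j. 1 \<le> j \<Longrightarrow> j \<le> n \<Longrightarrow> v j \<ge> c0 / 2) \<Longrightarrow>
    (\<Sum>i=1..m. 1 / (u i)\<^sup>2) \<le> (\<Sum>j=1..n. 1 / (v j)\<^sup>2) \<Longrightarrow>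
    measure exp_field {X. lpp (bulk (rate_weights u v X)) m n < (\<Sum>i=1..m. 1 / u i) + (\<Sum>j=1..n. 1 / v j) - \<epsilon> * N}
      \<le> 17 * (N + 1) * exp (- c * N)"
proof -
  \<comment> \<open>A bound on the contribution of a single row to the sum of squares, hence on the
    error of balancing a rectangle by cutting at a row.\<close>
  define D where "D = 1 / \<eta>\<^sup>2"
  from assms(1) have "\<epsilon> / 8 > 0" by simp
  from critical_tail[OF this \<eta>(1), of D] obtain c1 N1 where c1: "c1 > 0"
    and crit: "\<And>u v m n N. N \<ge> N1 \<Longrightarrow> real m \<le> N \<Longrightarrow> real n \<le> N \<Longrightarrow>
    (\<And>i. 1 \<le> i \<Longrightarrow> i \<le> m \<Longrightarrow> u i \<ge> \<eta>) \<Longrightarrow> (\<And>j. 1 \<le> j \<Longrightarrow> j \<le> n \<Longrightarrow> v j \<ge> \<eta>) \<Longrightarrow>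
    \<bar>(\<Sum>i=1..m. 1 / (u i)\<^sup>2) - (\<Sum>j=1..n. 1 / (v j)\<^sup>2)\<bar> \<le> D \<Longrightarrow>
    measure exp_field {X. lpp (bulk (rate_weights u v X)) m n < (\<Sum>i=1..m. 1 / u i) + (\<Sum>j=1..n. 1 / v j) - \<epsilon> / 8 * N}
      \<le> 8 * (N + 1) * exp (- c1 * N)" by blast
  define s where "s = \<epsilon> / 8"
  define c where "c = min c1 (dev_rate \<eta> s)"
  have s: "s > 0" using assms by (simp add: s_def)
  have c: "c > 0" using c1 dev_rate_pos[OF \<eta>(1) s] by (simp add: c_def)
  show ?thesis
  \<comment> \<open>The threshold \<open>8 / (\<epsilon> * \<eta>)\<close> makes the term
    \<open>1 / u p = 1 / \<eta>\<close>, which belongs to neither rectangle, at most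
    \<open>\<epsilon> / 8 * N\<close>.\<close>
  proof (rule that[OF c, of "max 0 (max N1 (8 / (\<epsilon> * \<eta>)))"])
    fix u v :: "nat \<Rightarrow> real" and m n p :: nat and N :: real
    assume N: "max 0 (max N1 (8 / (\<epsilon> * \<eta>))) \<le> N" "real m \<le> N" "real n \<le> N"
      and p: "1 \<le> p" "p \<le> m" "u p = \<eta>"
      and u: "\<And>i. 1 \<le> i \<Longrightarrow> i \<le> m \<Longrightarrow> u i \<ge> \<eta>" and v: "\<And>j. 1 \<le> j \<Longrightarrow> j \<le> n \<Longrightarrow> v j \<ge> c0 / 2"
      and le: "(\<Sum>i=1..m. 1 / (u i)\<^sup>2) \<le> (\<Sum>j=1..n. 1 / (v j)\<^sup>2)"
    define r where "r j = 1 / (v j)\<^sup>2" for j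
    have v\<eta>: "v j \<ge> \<eta>" if "1 \<le> j" "j \<le> n" for j using v[OF that] \<eta> by linarith
    have r: "r j \<le> D" if "1 \<le> j" "j \<le> n" for j
      unfolding r_def D_def using v\<eta>[OF that] \<eta> by (intro divide_left_mono power_mono mult_pos_pos) auto
    have D: "D \<ge> 0" by (simp add: D_def)
    have r0: "r j \<ge> 0" for j by (simp add: r_def)
    define PL PR where "PL = (\<Sum>i=1..p - 1. 1 / (u i)\<^sup>2)" and "PR = (\<Sum>i=Suc p..m. 1 / (u i)\<^sup>2)"
    have P0: "PL \<ge> 0" "PR \<ge> 0" by (auto simp: PL_def PR_def intro: sum_nonneg)
    have split_p: "(\<Sum>i=1..m. f i) = (\<Sum>i=1..p - 1. f i) + f p + (\<Sum>i=Suc p..m. f i)" for f :: "nat \<Rightarrow> real"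
    proof -
      have "(\<Sum>i=Suc (p - 1)..m. f i) = f p + (\<Sum>i=Suc p..m. f i)"
        using p by (simp add: sum.atLeast_Suc_atMost)
      then show ?thesis using sum_split_Icc[of "p - 1" m f] p by simp
    qed
    have LR: "PL + PR \<le> (\<Sum>j=1..n. r j)"
      using le split_p[of "\<lambda>i. 1 / (u i)\<^sup>2"] zero_le_divide_1_iff[of "(u p)\<^sup>2"] zero_le_power2[of "u p"]
      unfolding PL_def PR_def r_def by linarith
    then have "PL \<le> (\<Sum>j=1..n. r j)" using P0 by simp
    from discrete_ivt[OF r D P0(1) this] obtain j where j: "j \<le> n" "(\<Sum>i=1..j. r i) \<le> PL" "PL \<le> (\<Sum>i=1..j. r i) + D"
      by blast
    have split_j: "(\<Sum>j=1..n. f j) = (\<Sum>i=1..j. f i) + (\<Sum>i=1..n - j. f (j + i))" for f :: "nat \<Rightarrow> real"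
      using sum_split_Icc[OF j(1), of f] sum_shift_Icc[of f j n] by simp
    \<comment> \<open>The right rectangle is balanced through its complement: the rows j + 1 to j +
      l take the surplus over \<open>PR\<close>, so that the rows above j + l keep \<open>PR\<close>
      up to an error D.\<close>
    let ?P = "(\<Sum>i=1..n - j. r (j + i)) - PR"
    have "0 \<le> ?P" using LR j(2) split_j[of r] by simp
    moreover have "?P \<le> (\<Sum>i=1..n - j. r (j + i))" using P0 by simp
    ultimately obtain l where l: "l \<le> n - j" "(\<Sum>i=1..l. r (j + i)) \<le> ?P" "?P \<le> (\<Sum>i=1..l. r (j + i)) + D"
      using discrete_ivt[of "n - j" "\<lambda>i. r (j + i)" D ?P] r D by auto
    define q where "q = j + l"
    have split_l: "(\<Sum>i=1..n - j. f (j + i)) = (\<Sum>i=1..l. f (j + i)) + (\<Sum>i=1..n - q. f (q + i))" for f :: "nat \<Rightarrow> real"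
      using sum_split_Icc[OF l(1), of "\<lambda>i. f (j + i)"] sum_shift_Icc[of "\<lambda>i. f (j + i)" l "n - j"]
      by (simp add: q_def add.assoc diff_diff_left)
    have PR': "PR = (\<Sum>i=1..m - p. 1 / (u (p + i))\<^sup>2)"
      using sum_shift_Icc[of "\<lambda>i. 1 / (u i)\<^sup>2" p m] by (simp add: PR_def)
    let ?w = "rate_weights u v"
    define A1 where "A1 = {X. lpp (bulk (?w X)) (p - 1) j < (\<Sum>i=1..p - 1. 1 / u i) + (\<Sum>i=1..j. 1 / v i) - \<epsilon> / 8 * N}"
    define A2 where "A2 = {X. s * N \<le> (-1) * ((\<Sum>i=1..l. X (p, j + i) / (u p + v (j + i))) - (\<Sum>i=1..l. 1 / (u p + v (j + i))))}"
    define A3 where "A3 = {X. lpp (bulk (offset p q (?w X))) (m - p) (n - q) <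
      (\<Sum>i=1..m - p. 1 / u (p + i)) + (\<Sum>i=1..n - q. 1 / v (q + i)) - \<epsilon> / 8 * N}"
    note [measurable] = measurable_exp_field_component measurable_lpp[OF measurable_bulk_rate_weights]
      measurable_lpp[OF measurable_bulk_shift_rate_weights]
    have [measurable]: "A1 \<in> sets exp_field" unfolding A1_def by (rule exp_field_less_sets) measurable
    have [measurable]: "A2 \<in> sets exp_field" unfolding A2_def by (rule exp_field_ge_sets) measurable
    have [measurable]: "A3 \<in> sets exp_field" unfolding A3_def by (rule exp_field_less_sets) measurable
    have N0: "N \<ge> 0" and N1: "N \<ge> N1" using N by auto
    let ?e = "exp (- c * N)"
    have e: "exp (- c1 * N) \<le> ?e" "exp (- dev_rate \<eta> s * N) \<le> ?e"
      using N0 by (auto simp: c_def intro: mult_right_mono)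
    have "measure exp_field A1 \<le> 8 * (N + 1) * exp (- c1 * N)"
      unfolding A1_def using N N1 p j u v\<eta> by (intro crit) (auto simp: PL_def r_def)
    also have "\<dots> \<le> 8 * (N + 1) * ?e" using e N0 by (intro mult_left_mono) auto
    finally have m1: "measure exp_field A1 \<le> 8 * (N + 1) * ?e" .
    have "measure exp_field A2 \<le> exp (- dev_rate \<eta> s * N)" unfolding A2_def
    proof (rule sum_deviation_reindex)
      fix i assume "i \<in> {1..l}"
      then have "1 \<le> j + i" "j + i \<le> n" using l j by auto
      from v\<eta>[OF this] show "\<eta> \<le> u p + v (j + i)" using p \<eta> by linarith
    qed (use N l s \<eta> in \<open>auto intro: inj_onI\<close>)
    then have m2: "measure exp_field A2 \<le> ?e" using e(2) by linarith
    have bal3: "\<bar>(\<Sum>i=1..m - p. 1 / (u (p + i))\<^sup>2) - (\<Sum>j=1..n - q. 1 / (v (q + j))\<^sup>2)\<bar> \<le> D"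
      using l split_l[of r] unfolding PR'[symmetric] r_def by linarith
    have "measure exp_field A3 \<le> 8 * (N + 1) * exp (- c1 * N)"
      unfolding A3_def
    proof (subst measure_bulk_shift)
      show "measure exp_field {X. lpp (bulk (rate_weights (\<lambda>i. u (p + i)) (\<lambda>j. v (q + j)) X)) (m - p) (n - q)
        < (\<Sum>i=1..m - p. 1 / u (p + i)) + (\<Sum>i=1..n - q. 1 / v (q + i)) - \<epsilon> / 8 * N}
        \<le> 8 * (N + 1) * exp (- c1 * N)"
        using N N1 p u v\<eta> l by (intro crit bal3) auto
    qed measurable
    also have "\<dots> \<le> 8 * (N + 1) * ?e" using e N0 by (intro mult_left_mono) auto
    finally have m3: "measure exp_field A3 \<le> 8 * (N + 1) * ?e" .
    have mid: "(\<Sum>i=1..l. 1 / v (j + i)) \<le> (\<Sum>i=1..l. 1 / (u p + v (j + i))) + \<epsilon> / 4 * N"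
    proof -
      have "(\<Sum>i=1..l. 1 / v (j + i)) \<le> (\<Sum>i=1..l. 1 / (u p + v (j + i)) + \<epsilon> / 4)"
      proof (rule sum_mono)
        fix i assume i: "i \<in> {1..l}"
        let ?v = "v (j + i)"
        have vi: "?v \<ge> c0 / 2" using v[of "j + i"] i l by auto
        then have v0: "?v > 0" using assms by linarith
        have "1 / ?v - 1 / (\<eta> + ?v) = \<eta> / (?v * (\<eta> + ?v))"
          using v0 \<eta> by (simp add: divide_simps)
        also have "\<dots> \<le> \<eta> / (c0 / 2 * (c0 / 2))"
          using vi v0 \<eta> assms by (intro divide_left_mono mult_mono mult_pos_pos) auto
        also have "\<dots> \<le> \<epsilon> / 4"
          using \<eta>(3) assms by (simp add: field_simps power2_eq_square)
        finally show "1 / ?v \<le> 1 / (u p + ?v) + \<epsilon> / 4" using p by simp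
      qed
      also have "\<dots> = (\<Sum>i=1..l. 1 / (u p + v (j + i))) + real l * (\<epsilon> / 4)" by (simp add: sum.distrib)
      also have "real l * (\<epsilon> / 4) \<le> N * (\<epsilon> / 4)" using l N assms by (intro mult_right_mono) auto
      finally show ?thesis by (simp add: mult.commute)
    qed
    have inv\<eta>: "1 / \<eta> \<le> \<epsilon> / 8 * N" using N \<eta> assms by (simp add: field_simps)
    have "measure exp_field {X. lpp (bulk (?w X)) m n < (\<Sum>i=1..m. 1 / u i) + (\<Sum>j=1..n. 1 / v j) - \<epsilon> * N} \<le> measure exp_field (A1 \<union> A2 \<union> A3)"
    proof (rule exp_field.finite_measure_mono_AE)
      show "AE X in exp_field. X \<in> {X. lpp (bulk (?w X)) m n < (\<Sum>i=1..m. 1 / u i) + (\<Sum>j=1..n. 1 / v j) - \<epsilon> * N} \<longrightarrow> X \<in> A1 \<union> A2 \<union> A3"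
        using AE_exp_field_nonneg
      proof eventually_elim
        case (elim X)
        \<comment> \<open>Superadditivity needs nonnegative weights everywhere; rates outside the
          rectangle are set to 0, which leaves the weights inside unchanged.\<close>
        define w where "w = rate_weights (\<lambda>i. if i \<in> {1..m} then u i else 0) (\<lambda>j. if j \<in> {1..n} then v j else 0) X"
        have w: "0 \<le> w x" for x
        proof -
          have "0 \<le> (if i \<in> {1..m} then u i else 0)" "0 \<le> (if j \<in> {1..n} then v j else 0)" for i j
            using u[of i] v\<eta>[of j] \<eta> by auto
          then show ?thesis using elim unfolding w_def by (cases x) (simp del: atLeastAtMost_iff)
        qed
        have weq: "w (i, j) = ?w X (i, j)" if "1 \<le> i" "i \<le> m" "1 \<le> j" "j \<le> n" for i j
          using that by (simp add: w_def)
        have 1: "lpp (bulk (?w X)) (p - 1) j = lpp (bulk w) (p - 1) j"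
          by (rule lpp_cong) (use weq p j in \<open>auto simp: bulk_def simp del: rate_weights_apply\<close>)
        have 2: "(\<Sum>i=1..l. X (p, j + i) / (u p + v (j + i))) = lpp (bulk (offset (p - 1) j w)) 1 l"
          using weq p l j by (subst lpp_bulk_column) (auto simp: w offset_def intro!: sum.cong)
        have 3: "lpp (bulk (offset p q (?w X))) (m - p) (n - q) = lpp (bulk (offset p q w)) (m - p) (n - q)"
          by (rule lpp_cong) (use weq p j l in \<open>auto simp: bulk_def q_def simp del: rate_weights_apply\<close>)
        have 4: "lpp (bulk (?w X)) m n = lpp (bulk w) m n"
          by (rule lpp_cong) (use weq in \<open>auto simp: bulk_def simp del: rate_weights_apply\<close>)
        have wo: "0 \<le> offset (p - 1) j w x" for x using w by (cases x) simp
        have "lpp (bulk w) (p - 1) j + lpp (bulk (offset (p - 1) j w)) (1 + (m - p)) (l + (n - q)) \<le> lpp (bulk w) m n"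
          using lpp_bulk_superadditive[where w=w and p="p - 1" and q=j and i="1 + (m - p)" and j="l + (n - q)", OF w] p j l
          by (simp add: q_def)
        moreover have "lpp (bulk (offset (p - 1) j w)) 1 l + lpp (bulk (offset p q w)) (m - p) (n - q)
            \<le> lpp (bulk (offset (p - 1) j w)) (1 + (m - p)) (l + (n - q))"
          using lpp_bulk_superadditive[where w="offset (p - 1) j w" and p=1 and q=l and i="m - p" and j="n - q", OF wo] p
          by (simp add: q_def offset_offset)
        moreover have "(\<Sum>i=Suc p..m. 1 / u i) = (\<Sum>i=1..m - p. 1 / u (p + i))"
          using sum_shift_Icc[of "\<lambda>i. 1 / u i" p m] by simp
        ultimately have lower: "lpp (bulk w) (p - 1) j + (lpp (bulk (offset (p - 1) j w)) 1 l
            + lpp (bulk (offset p q w)) (m - p) (n - q)) \<le> lpp (bulk w) m n"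
          and up: "(\<Sum>i=Suc p..m. 1 / u i) = (\<Sum>i=1..m - p. 1 / u (p + i))"
          by linarith+
        show ?case
        proof (rule impI, rule ccontr)
          assume X: "X \<in> {X. lpp (bulk (?w X)) m n < (\<Sum>i=1..m. 1 / u i) + (\<Sum>j=1..n. 1 / v j) - \<epsilon> * N}"
            and nX: "X \<notin> A1 \<union> A2 \<union> A3"
          have a: "(\<Sum>i=1..p - 1. 1 / u i) + (\<Sum>i=1..j. 1 / v i) - \<epsilon> / 8 * N \<le> lpp (bulk w) (p - 1) j"
            using nX 1 by (simp add: A1_def)
          have b: "(\<Sum>i=1..l. 1 / (u p + v (j + i))) - \<epsilon> / 8 * N \<le> lpp (bulk (offset (p - 1) j w)) 1 l"
            using nX 2 by (simp add: A2_def s_def)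
          have c: "(\<Sum>i=1..m - p. 1 / u (p + i)) + (\<Sum>i=1..n - q. 1 / v (q + i)) - \<epsilon> / 8 * N
              \<le> lpp (bulk (offset p q w)) (m - p) (n - q)"
            using nX 3 by (simp add: A3_def)
          have d: "lpp (bulk w) m n < (\<Sum>i=1..m. 1 / u i) + (\<Sum>j=1..n. 1 / v j) - \<epsilon> * N"
            using X 4 by simp
          have g: "1 / u p \<le> \<epsilon> / 8 * N" using inv\<eta> p(3) by simp
          have h: "\<epsilon> / 8 * N = \<epsilon> * N / 8" "\<epsilon> / 4 * N = \<epsilon> * N / 4" "\<epsilon> * N \<ge> 0"
            using assms N0 by simp_all
          note s1 = split_p[of "\<lambda>i. 1 / u i"] and s2 = split_j[of "\<lambda>i. 1 / v i"]
            and s3 = split_l[of "\<lambda>i. 1 / v i"]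
          \<comment> \<open>In units of \<open>\<epsilon> * N\<close> the losses are 1/8 in each
            rectangle, 1/8 for the fluctuation in column p, 1/8 for \<open>1 / u p\<close> and 1/4
            from \<open>mid\<close>: 3/4 in all.\<close>
          show False
            using a b c d g lower up mid s1 s2 s3 h(3) unfolding h(1,2) by linarith
        qed
      qed
    qed measurable
    also have "\<dots> \<le> measure exp_field A1 + measure exp_field A2 + measure exp_field A3"
      by (intro order_trans[OF measure_Un_le] add_mono order_refl) measurable
    also have "\<dots> \<le> 8 * (N + 1) * ?e + (N + 1) * ?e + 8 * (N + 1) * ?e"
    proof (intro add_mono m1 m3)
      have "1 * ?e \<le> (N + 1) * ?e" using N0 by (intro mult_right_mono) simp_all
      then show "measure exp_field A2 \<le> (N + 1) * ?e" using m2 by linarith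
    qed
    also have "\<dots> = 17 * (N + 1) * ?e" by (simp add: algebra_simps)
    finally show "measure exp_field {X. lpp (bulk (?w X)) m n < (\<Sum>i=1..m. 1 / u i) + (\<Sum>j=1..n. 1 / v j) - \<epsilon> * N}
      \<le> 17 * (N + 1) * exp (- c * N)" .
  qed
qed

lemma measure_bulk_transpose:
  "measure exp_field {X. lpp (bulk (rate_weights u v X)) m n < t} = measure exp_field {X. lpp (bulk (rate_weights v u X)) n m < t}"
proof -
  let ?\<phi> = "\<lambda>(i, j). (j, i) :: nat \<times> nat"
  have inj: "inj ?\<phi>" by (auto intro!: injI)
  have "bulk (rate_weights u v (X \<circ> ?\<phi>)) = (\<lambda>(i, j). bulk (rate_weights v u X) (j, i))" for X
    by (auto simp: bulk_def add.commute)
  then have eq: "lpp (bulk (rate_weights u v (X \<circ> ?\<phi>))) m n = lpp (bulk (rate_weights v u X)) n m" for X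
    by (simp add: lpp_transpose)
  have "{X. lpp (bulk (rate_weights u v X)) m n < t} \<in> sets exp_field"
    by (intro exp_field_less_sets measurable_lpp measurable_bulk_rate_weights)
  from measure_exp_field_reindex[OF inj this] show ?thesis by (simp add: eq)
qed

text \<open>The parameter z depends on the array, but its margin \<eta> from the poles does not; the
  comparison with the shape function relies on this uniform margin.\<close>

lemma lower_tail:
  assumes "\<epsilon> > 0" "c0 > 0"
  obtains \<eta> c N0 where "\<eta> > 0" "c > 0" "\<And>a b m n N. N \<ge> N0 \<Longrightarrow> 1 \<le> m \<Longrightarrow> 1 \<le> n \<Longrightarrow> real m \<le> N \<Longrightarrow> real n \<le> N \<Longrightarrow>
    (\<And>i j. 1 \<le> i \<Longrightarrow> i \<le> m \<Longrightarrow> 1 \<le> j \<Longrightarrow> j \<le> n \<Longrightarrow> a i + b j \<ge> c0) \<Longrightarrow>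
    \<exists>z. (\<forall>i\<in>{1..m}. a i + z \<ge> \<eta>) \<and> (\<forall>j\<in>{1..n}. b j - z \<ge> \<eta>) \<and>
    measure exp_field {X. lpp (bulk (rate_weights a b X)) m n < (\<Sum>i=1..m. 1 / (a i + z)) + (\<Sum>j=1..n. 1 / (b j - z)) - \<epsilon> * N}
      \<le> 17 * (N + 1) * exp (- c * N)"
proof -
  \<comment> \<open>The bound c0 / 2 gives \<open>zl \<le> zr\<close> and leaves rates of at least
    c0 / 2 opposite the dominating one; the other bound is the one required by
    \<open>linear_tail\<close>.\<close>
  define \<eta> where "\<eta> = min (c0 / 2) (\<epsilon> * c0\<^sup>2 / 16)"
  have \<eta>: "\<eta> > 0" "\<eta> \<le> c0 / 2" "\<eta> \<le> \<epsilon> * c0\<^sup>2 / 16" using assms by (auto simp: \<eta>_def)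
  obtain c1 N1 where c1: "c1 > 0" and
    crit: "\<And>u v m n N. N \<ge> N1 \<Longrightarrow> real m \<le> N \<Longrightarrow> real n \<le> N \<Longrightarrow>
    (\<And>i. 1 \<le> i \<Longrightarrow> i \<le> m \<Longrightarrow> u i \<ge> \<eta>) \<Longrightarrow> (\<And>j. 1 \<le> j \<Longrightarrow> j \<le> n \<Longrightarrow> v j \<ge> \<eta>) \<Longrightarrow>
    \<bar>(\<Sum>i=1..m. 1 / (u i)\<^sup>2) - (\<Sum>j=1..n. 1 / (v j)\<^sup>2)\<bar> \<le> 0 \<Longrightarrow>
    measure exp_field {X. lpp (bulk (rate_weights u v X)) m n < (\<Sum>i=1..m. 1 / u i) + (\<Sum>j=1..n. 1 / v j) - \<epsilon> * N}
      \<le> 8 * (N + 1) * exp (- c1 * N)"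
    using critical_tail[OF assms(1) \<eta>(1), of 0] by blast
  obtain c2 N2 where c2: "c2 > 0" and
    lin: "\<And>u v m n p N. N \<ge> N2 \<Longrightarrow> real m \<le> N \<Longrightarrow> real n \<le> N \<Longrightarrow>
    1 \<le> p \<Longrightarrow> p \<le> m \<Longrightarrow> u p = \<eta> \<Longrightarrow>
    (\<And>i. 1 \<le> i \<Longrightarrow> i \<le> m \<Longrightarrow> u i \<ge> \<eta>) \<Longrightarrow> (\<And>j. 1 \<le> j \<Longrightarrow> j \<le> n \<Longrightarrow> v j \<ge> c0 / 2) \<Longrightarrow>
    (\<Sum>i=1..m. 1 / (u i)\<^sup>2) \<le> (\<Sum>j=1..n. 1 / (v j)\<^sup>2) \<Longrightarrow>
    measure exp_field {X. lpp (bulk (rate_weights u v X)) m n < (\<Sum>i=1..m. 1 / u i) + (\<Sum>j=1..n. 1 / v j) - \<epsilon> * N}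
      \<le> 17 * (N + 1) * exp (- c2 * N)"
    using linear_tail[OF assms \<eta>] by blast
  define c where "c = min c1 c2"
  have c: "c > 0" using c1 c2 by (simp add: c_def)
  show ?thesis
  proof (rule that[OF \<eta>(1) c, of "max 0 (max N1 N2)"])
    fix a b :: "nat \<Rightarrow> real" and m n :: nat and N :: real
    assume N: "max 0 (max N1 N2) \<le> N" and mn: "1 \<le> m" "1 \<le> n" "real m \<le> N" "real n \<le> N"
      and ab: "\<And>i j. 1 \<le> i \<Longrightarrow> i \<le> m \<Longrightarrow> 1 \<le> j \<Longrightarrow> j \<le> n \<Longrightarrow> a i + b j \<ge> c0"
    have N0: "N \<ge> 0" "N \<ge> N1" "N \<ge> N2" using N by auto
    let ?e = "exp (- c * N)"
    have e: "8 * (N + 1) * exp (- c1 * N) \<le> 17 * (N + 1) * ?e" "17 * (N + 1) * exp (- c2 * N) \<le> 17 * (N + 1) * ?e"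
      using N0 by (auto simp: c_def intro!: mult_mono mult_right_mono)
    obtain p where p: "p \<in> {1..m}" "\<And>i. i \<in> {1..m} \<Longrightarrow> a p \<le> a i"
      using ex_min_if_finite[of "{1..m}"] arg_min_if_finite[of "{1..m}" a] mn
      by (metis (no_types, lifting) arg_min_least atLeastAtMost_iff empty_iff finite_atLeastAtMost order_refl)
    obtain q where q: "q \<in> {1..n}" "\<And>j. j \<in> {1..n} \<Longrightarrow> b q \<le> b j"
      using arg_min_if_finite[of "{1..n}" b] mn
      by (metis (no_types, lifting) arg_min_least atLeastAtMost_iff empty_iff finite_atLeastAtMost order_refl)
    have pq: "a p + b q \<ge> c0" using ab p q by auto
    \<comment> \<open>This is \<open>- M'\<close>; at \<open>zl\<close> and \<open>zr\<close> the
      smallest rate in the columns or in the rows equals \<eta>.\<close>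
    define f where "f z = (\<Sum>i=1..m. 1 / (a i + z)\<^sup>2) - (\<Sum>j=1..n. 1 / (b j - z)\<^sup>2)" for z
    define zl zr where "zl = \<eta> - a p" and "zr = b q - \<eta>"
    have zlr: "zl \<le> zr" using pq \<eta> by (simp add: zl_def zr_def)
    have rates: "a i + z \<ge> \<eta>" "b j - z \<ge> \<eta>" if "z \<in> {zl..zr}" "i \<in> {1..m}" "j \<in> {1..n}" for z i j
      using that p(2)[of i] q(2)[of j] by (auto simp: zl_def zr_def)
    have shift_rates: "rate_weights (\<lambda>i. a i + z) (\<lambda>j. b j - z) = rate_weights a b" for z
      by (auto simp: rate_weights_def fun_eq_iff)
    have shift_rates': "rate_weights (\<lambda>j. b j - z) (\<lambda>i. a i + z) = rate_weights b a" for z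
      by (auto simp: rate_weights_def fun_eq_iff)
    have "\<exists>z\<in>{zl..zr}. measure exp_field {X. lpp (bulk (rate_weights a b X)) m n <
        (\<Sum>i=1..m. 1 / (a i + z)) + (\<Sum>j=1..n. 1 / (b j - z)) - \<epsilon> * N} \<le> 17 * (N + 1) * ?e"
    proof -
      \<comment> \<open>Column p dominates in the first case and row q in the second, which is the
        transpose of the first; in the third there is a critical parameter in between.\<close>
      consider "f zl \<le> 0" | "f zr \<ge> 0" | "f zl \<ge> 0" "f zr \<le> 0" by linarith
      then show ?thesis
      proof cases
        case 1
        have "measure exp_field {X. lpp (bulk (rate_weights (\<lambda>i. a i + zl) (\<lambda>j. b j - zl) X)) m n <
            (\<Sum>i=1..m. 1 / (a i + zl)) + (\<Sum>j=1..n. 1 / (b j - zl)) - \<epsilon> * N} \<le> 17 * (N + 1) * exp (- c2 * N)"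
        proof (rule lin[of N m n p])
          show "b j - zl \<ge> c0 / 2" if "1 \<le> j" "j \<le> n" for j
            using ab[of p j] p that \<eta> by (auto simp: zl_def)
          show "a i + zl \<ge> \<eta>" if "1 \<le> i" "i \<le> m" for i using p(2)[of i] that by (simp add: zl_def)
        qed (use N0 mn p 1 in \<open>auto simp: zl_def f_def\<close>)
        then show ?thesis using zlr e(2) unfolding shift_rates by (intro bexI[of _ zl]) auto
      next
        case 2
        have "measure exp_field {X. lpp (bulk (rate_weights (\<lambda>j. b j - zr) (\<lambda>i. a i + zr) X)) n m <
            (\<Sum>j=1..n. 1 / (b j - zr)) + (\<Sum>i=1..m. 1 / (a i + zr)) - \<epsilon> * N} \<le> 17 * (N + 1) * exp (- c2 * N)"
        proof (rule lin[of N n m q])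
          show "a i + zr \<ge> c0 / 2" if "1 \<le> i" "i \<le> m" for i
            using ab[of i q] q that \<eta> by (auto simp: zr_def)
          show "b j - zr \<ge> \<eta>" if "1 \<le> j" "j \<le> n" for j using q(2)[of j] that by (simp add: zr_def)
        qed (use N0 mn q 2 in \<open>auto simp: zr_def f_def\<close>)
        then have "measure exp_field {X. lpp (bulk (rate_weights a b X)) m n <
            (\<Sum>i=1..m. 1 / (a i + zr)) + (\<Sum>j=1..n. 1 / (b j - zr)) - \<epsilon> * N} \<le> 17 * (N + 1) * exp (- c2 * N)"
          unfolding shift_rates' measure_bulk_transpose[of b a] by (simp add: add.commute)
        then show ?thesis using zlr e(2) by (intro bexI[of _ zr]) auto
      next
        case 3
        have "continuous_on {zl..zr} f"
          unfolding f_def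
        proof (intro continuous_intros ballI)
          fix z i assume "z \<in> {zl..zr}" "i \<in> {1..m}"
          then show "(a i + z)\<^sup>2 \<noteq> 0" using rates(1)[of z i q] q \<eta> by auto
        next
          fix z j assume "z \<in> {zl..zr}" "j \<in> {1..n}"
          then show "(b j - z)\<^sup>2 \<noteq> 0" using rates(2)[of z p j] p \<eta> by auto
        qed
        from IVT2'[of f zr 0 zl, OF 3(2,1) zlr this] obtain z where z: "z \<in> {zl..zr}" "f z = 0" by auto
        have "measure exp_field {X. lpp (bulk (rate_weights (\<lambda>i. a i + z) (\<lambda>j. b j - z) X)) m n <
            (\<Sum>i=1..m. 1 / (a i + z)) + (\<Sum>j=1..n. 1 / (b j - z)) - \<epsilon> * N} \<le> 8 * (N + 1) * exp (- c1 * N)"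
          by (rule crit) (use N0 mn z rates[OF z(1)] p q in \<open>auto simp: f_def\<close>)
        then show ?thesis using z e(1) unfolding shift_rates by (intro bexI[of _ z]) auto
      qed
    qed
    then show "\<exists>z. (\<forall>i\<in>{1..m}. a i + z \<ge> \<eta>) \<and> (\<forall>j\<in>{1..n}. b j - z \<ge> \<eta>) \<and>
      measure exp_field {X. lpp (bulk (rate_weights a b X)) m n <
        (\<Sum>i=1..m. 1 / (a i + z)) + (\<Sum>j=1..n. 1 / (b j - z)) - \<epsilon> * N} \<le> 17 * (N + 1) * ?e"
      using rates p q by blast
  qed
qed

section \<open>Limits of the empirical averages\<close>

lemma integral_empirical_distribution:
  fixes f :: "real \<Rightarrow> real"
  assumes [measurable]: "f \<in> borel_measurable borel" and "m \<ge> 1"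
  shows "(\<integral>x. f x \<partial>empirical_distribution a m) = (\<Sum>i=1..m. f (a m i)) / real m"
  unfolding empirical_distribution_def
  by (subst integral_distr) (simp_all add: integral_uniform_count_measure)

lemma tendsto_0_at_infinity_real:
  fixes f :: "real \<Rightarrow> real"
  assumes "(f \<longlongrightarrow> 0) at_top" "(f \<longlongrightarrow> 0) at_bot"
  shows "(f \<longlongrightarrow> 0) at_infinity"
  unfolding at_infinity_eq_at_top_bot using assms by (rule filterlim_sup)

text \<open>The limit is tested against a function that is positive below c and zero from c on; the
  quadratic denominator makes it vanish at infinity.\<close>

lemma vague_limit_lower_bound:
  assumes \<mu>: "subprobability_on_reals \<mu>" and lim: "vague_convergence (empirical_distribution a) \<mu>"
    and ev: "eventually (\<lambda>m. \<forall>i\<in>{1..m}. c \<le> a m i) sequentially"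
  shows "AE x in \<mu>. c \<le> x"
proof -
  have sets[measurable_cong]: "sets \<mu> = sets borel" and "subprob_space \<mu>"
    using \<mu> by (auto simp: subprobability_on_reals_def)
  interpret subprob_space \<mu> by fact
  define f where "f x = max 0 (c - x) / (1 + (c - x)\<^sup>2)" for x :: real
  have den: "1 + (c - x)\<^sup>2 > 0" for x using zero_le_power2[of "c - x"] by linarith
  have cont: "continuous_on UNIV f"
    unfolding f_def by (intro continuous_intros) (auto simp: den[THEN less_imp_neq, symmetric])
  have [measurable]: "f \<in> borel_measurable borel" using cont by (rule borel_measurable_continuous_onI)
  have "(f \<longlongrightarrow> 0) at_top" "(f \<longlongrightarrow> 0) at_bot" unfolding f_def by real_asymp+
  then have "(\<lambda>m. \<integral>x. f x \<partial>empirical_distribution a m) \<longlonglongrightarrow> (\<integral>x. f x \<partial>\<mu>)"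
    using lim cont tendsto_0_at_infinity_real unfolding vague_convergence_def by blast
  moreover have "eventually (\<lambda>m. (\<integral>x. f x \<partial>empirical_distribution a m) = 0) sequentially"
    using ev eventually_ge_at_top[of 1]
  proof eventually_elim
    case (elim m)
    then show ?case by (subst integral_empirical_distribution) (auto simp: f_def intro!: sum.neutral)
  qed
  ultimately have "(\<integral>x. f x \<partial>\<mu>) = 0"
    by (rule LIMSEQ_unique[OF _ tendsto_eventually])
  moreover have fn: "0 \<le> f x" for x using den[of x] by (simp add: f_def)
  moreover have "integrable \<mu> f"
  proof (rule integrable_const_bound[where B=1])
    have "\<bar>c - x\<bar> \<le> 1 + (c - x)\<^sup>2" for x
      using zero_le_power2[of "\<bar>c - x\<bar> - 1"] by (simp add: power2_diff) (smt (verit) zero_le_power2)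
    then have "\<bar>f x\<bar> \<le> 1" for x using den[of x] by (auto simp: f_def divide_le_eq max_def abs_le_iff)
    then show "AE x in \<mu>. norm (f x) \<le> 1" by simp
  qed measurable
  ultimately have "AE x in \<mu>. f x = 0"
    by (subst integral_nonneg_eq_0_iff_AE[symmetric]) (auto simp: fn)
  then show ?thesis
  proof eventually_elim
    case (elim x)
    then show ?case using den[of x] by (auto simp: f_def max_def split: if_splits)
  qed
qed

text \<open>The integrand has a pole, so it is replaced by a test function that agrees with it on
  \<open>x \<ge> c\<close>, where almost all rows and the limit measure live. Mass that escapes to
  infinity does no harm, since the test function vanishes there.\<close>

lemma empirical_resolvent_tendsto:
  assumes \<mu>: "subprobability_on_reals \<mu>" and lim: "vague_convergence (empirical_distribution a) \<mu>"
    and ev: "eventually (\<lambda>m. \<forall>i\<in>{1..m}. c \<le> a m i) sequentially" and c: "c + z > 0"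
  shows "(\<lambda>m. (\<Sum>i=1..m. 1 / (a m i + z)) / real m) \<longlonglongrightarrow> (\<integral>x. 1 / (x + z) \<partial>\<mu>)"
proof -
  have sets[measurable_cong]: "sets \<mu> = sets borel"
    using \<mu> by (auto simp: subprobability_on_reals_def)
  define f where "f x = 1 / (\<bar>x - c\<bar> + (c + z))" for x :: real
  have den: "\<bar>x - c\<bar> + (c + z) > 0" for x using c by linarith
  have cont: "continuous_on UNIV f"
    unfolding f_def by (intro continuous_intros) (auto simp: den[THEN less_imp_neq, symmetric])
  have [measurable]: "f \<in> borel_measurable borel" using cont by (rule borel_measurable_continuous_onI)
  have "(f \<longlongrightarrow> 0) at_top" "(f \<longlongrightarrow> 0) at_bot" unfolding f_def by real_asymp+
  then have "(\<lambda>m. \<integral>x. f x \<partial>empirical_distribution a m) \<longlonglongrightarrow> (\<integral>x. f x \<partial>\<mu>)"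
    using lim cont tendsto_0_at_infinity_real unfolding vague_convergence_def by blast
  moreover have "(\<integral>x. f x \<partial>\<mu>) = (\<integral>x. 1 / (x + z) \<partial>\<mu>)"
    by (intro integral_cong_AE) (use vague_limit_lower_bound[OF \<mu> lim ev] in \<open>auto simp: f_def\<close>)
  moreover have "eventually (\<lambda>m. (\<integral>x. f x \<partial>empirical_distribution a m) =
      (\<Sum>i=1..m. 1 / (a m i + z)) / real m) sequentially"
    using ev eventually_ge_at_top[of 1]
  proof eventually_elim
    case (elim m)
    have "(\<Sum>i=1..m. f (a m i)) = (\<Sum>i=1..m. 1 / (a m i + z))"
      using elim by (intro sum.cong) (auto simp: f_def)
    then show ?case using elim by (subst integral_empirical_distribution) auto
  qed
  ultimately show ?thesis using tendsto_cong by force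
qed

lemma eventually_row_ge:
  assumes "(\<lambda>m. ereal (row_min a m)) \<longlonglongrightarrow> \<aa>" "ereal c < \<aa>"
  shows "eventually (\<lambda>m. \<forall>i\<in>{1..m}. c \<le> a m i) sequentially"
  using order_tendstoD(1)[OF assms]
proof eventually_elim
  case (elim m)
  then show ?case unfolding row_min_def by (auto intro: order_trans[OF less_imp_le Min_le])
qed

lemma eventually_row_ex_le:
  assumes "(\<lambda>m. ereal (row_min a m)) \<longlonglongrightarrow> \<aa>" "\<aa> < ereal c"
  shows "eventually (\<lambda>m. \<exists>i\<in>{1..m}. a m i \<le> c) sequentially"
  using order_tendstoD(2)[OF assms] eventually_ge_at_top[of 1]
proof eventually_elim
  case (elim m)
  then have "row_min a m \<in> a m ` {1..m}" unfolding row_min_def by (intro Min_in) auto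
  then obtain i where "i \<in> {1..m}" "row_min a m = a m i" by auto
  then show ?case using elim by (intro bexI[of _ i]) auto
qed

lemma resolvent_bounds:
  assumes \<mu>: "subprobability_on_reals \<mu>" and lim: "vague_convergence (empirical_distribution a) \<mu>"
    and mins: "(\<lambda>m. ereal (row_min a m)) \<longlonglongrightarrow> \<aa>" and c: "ereal c < \<aa>" "c + z > 0"
  shows "0 \<le> (\<integral>x. 1 / (x + z) \<partial>\<mu>)" "(\<integral>x. 1 / (x + z) \<partial>\<mu>) \<le> 1 / (c + z)"
proof -
  note ev = eventually_row_ge[OF mins c(1)]
  note t = empirical_resolvent_tendsto[OF \<mu> lim ev c(2)]
  show "0 \<le> (\<integral>x. 1 / (x + z) \<partial>\<mu>)"
  proof (rule tendsto_lowerbound[OF t])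
    show "\<forall>\<^sub>F m in sequentially. 0 \<le> (\<Sum>i=1..m. 1 / (a m i + z)) / real m"
      using ev
    proof eventually_elim
      case (elim m)
      have "0 \<le> a m i + z" if "i \<in> {1..m}" for i using elim that c(2) by fastforce
      then show ?case by (intro divide_nonneg_nonneg sum_nonneg) auto
    qed
  qed simp
  show "(\<integral>x. 1 / (x + z) \<partial>\<mu>) \<le> 1 / (c + z)"
  proof (rule tendsto_upperbound[OF t])
    show "\<forall>\<^sub>F m in sequentially. (\<Sum>i=1..m. 1 / (a m i + z)) / real m \<le> 1 / (c + z)"
      using ev eventually_ge_at_top[of 1]
    proof eventually_elim
      case (elim m)
      have "(\<Sum>i=1..m. 1 / (a m i + z)) \<le> (\<Sum>i=1..m. 1 / (c + z))"
        using elim c(2) by (intro sum_mono frac_le) auto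
      then show ?case using elim by (simp add: pos_divide_le_eq mult.commute)
    qed
  qed simp
qed

text \<open>A version of Dickson's lemma: after rounding, finitely many elements are minimal.\<close>

lemma finite_dominating_subset:
  fixes A B :: "'a \<Rightarrow> real"
  assumes "s0 \<in> S" "\<epsilon> > 0" and nn: "\<And>s. s \<in> S \<Longrightarrow> 0 \<le> A s" "\<And>s. s \<in> S \<Longrightarrow> 0 \<le> B s"
  obtains F where "finite F" "F \<subseteq> S" "\<And>s. s \<in> S \<Longrightarrow> \<exists>f\<in>F. A f \<le> A s + \<epsilon> \<and> B f \<le> B s + \<epsilon>"
proof -
  have one: "\<exists>F. finite F \<and> F \<subseteq> S \<and> (\<forall>s\<in>S. A s \<le> A s0 \<longrightarrow> (\<exists>f\<in>F. A f \<le> A s + \<epsilon> \<and> B f \<le> B s + \<epsilon>))"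
    if nn: "\<And>s. s \<in> S \<Longrightarrow> 0 \<le> A s" "\<And>s. s \<in> S \<Longrightarrow> 0 \<le> B s" for A B :: "'a \<Rightarrow> real"
  proof -
    define k l where "k s = nat \<lfloor>A s / \<epsilon>\<rfloor>" and "l s = nat \<lfloor>B s / \<epsilon>\<rfloor>" for s
    have close: "C s \<le> C t + \<epsilon>" if "nat \<lfloor>C s / \<epsilon>\<rfloor> \<le> nat \<lfloor>C t / \<epsilon>\<rfloor>" "0 \<le> C s" "0 \<le> C t" for C :: "'a \<Rightarrow> real" and s t
    proof -
      have "\<lfloor>C s / \<epsilon>\<rfloor> \<le> \<lfloor>C t / \<epsilon>\<rfloor>" using that assms(2) by (simp add: nat_le_eq_zle)
      then have "C s / \<epsilon> \<le> C t / \<epsilon> + 1" by linarith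
      then show ?thesis using assms(2) by (simp add: field_simps)
    qed
    \<comment> \<open>One representative for each rounded value of A, chosen with the smallest
      rounded B. Finitely many rounded values are at most that of s0.\<close>
    define g where "g i = (ARG_MIN l s. s \<in> S \<and> k s = i)" for i
    have g: "g (k s) \<in> S \<and> k (g (k s)) = k s \<and> l (g (k s)) \<le> l s" if "s \<in> S" for s
      using arg_min_natI[of "\<lambda>t. t \<in> S \<and> k t = k s" s l] arg_min_nat_le[of "\<lambda>t. t \<in> S \<and> k t = k s" s l] that
      unfolding g_def by auto
    let ?F = "g ` (k ` {s \<in> S. A s \<le> A s0})"
    have "k ` {s \<in> S. A s \<le> A s0} \<subseteq> {..k s0}"
      using assms(2) by (auto simp: k_def intro!: nat_mono floor_mono divide_right_mono)
    then have "finite ?F" by (meson finite_atMost finite_imageI finite_subset)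
    moreover have "?F \<subseteq> S" using g by auto
    moreover have "\<exists>f\<in>?F. A f \<le> A s + \<epsilon> \<and> B f \<le> B s + \<epsilon>" if "s \<in> S" "A s \<le> A s0" for s
    proof (rule bexI[of _ "g (k s)"])
      show "A (g (k s)) \<le> A s + \<epsilon> \<and> B (g (k s)) \<le> B s + \<epsilon>"
        using g[OF that(1)] nn that(1) by (auto intro!: close simp: k_def[symmetric] l_def[symmetric])
    qed (use that in auto)
    ultimately show ?thesis by blast
  qed
  obtain F1 where F1: "finite F1" "F1 \<subseteq> S" "\<forall>s\<in>S. A s \<le> A s0 \<longrightarrow> (\<exists>f\<in>F1. A f \<le> A s + \<epsilon> \<and> B f \<le> B s + \<epsilon>)"
    using one[of A B] nn by blast
  obtain F2 where F2: "finite F2" "F2 \<subseteq> S" "\<forall>s\<in>S. B s \<le> B s0 \<longrightarrow> (\<exists>f\<in>F2. B f \<le> B s + \<epsilon> \<and> A f \<le> A s + \<epsilon>)"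
    using one[of B A] nn by blast
  show ?thesis
  proof (rule that[of "insert s0 (F1 \<union> F2)"])
    fix s assume s: "s \<in> S"
    \<comment> \<open>Points below s0 in one coordinate are covered by \<open>F1\<close> or
      \<open>F2\<close>; all others are dominated by s0 itself.\<close>
    consider "A s \<le> A s0" | "B s \<le> B s0" | "A s0 \<le> A s" "B s0 \<le> B s" by linarith
    then show "\<exists>f\<in>insert s0 (F1 \<union> F2). A f \<le> A s + \<epsilon> \<and> B f \<le> B s + \<epsilon>"
    proof cases
      case 3
      then show ?thesis using assms(2) by (intro bexI[of _ s0]) auto
    qed (use F1(3) F2(3) s in blast)+
  qed (use F1 F2 assms in auto)
qed

section \<open>Row sums against the shape function\<close>

locale converging_rates =
  fixes a b :: "nat \<Rightarrow> nat \<Rightarrow> real" and \<alpha> \<beta> :: "real measure" and \<aa> \<bb> :: ereal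
  assumes subprob: "subprobability_on_reals \<alpha>" "subprobability_on_reals \<beta>"
    and vague: "vague_convergence (empirical_distribution a) \<alpha>" "vague_convergence (empirical_distribution b) \<beta>"
    and endpoints: "\<aa> \<noteq> -\<infinity>" "\<bb> \<noteq> -\<infinity>" "\<aa> + \<bb> > 0"
    and mins: "(\<lambda>m. ereal (row_min a m)) \<longlonglongrightarrow> \<aa>" "(\<lambda>n. ereal (row_min b n)) \<longlonglongrightarrow> \<bb>"
begin

definition A where "A z = (\<integral>x. 1 / (x + z) \<partial>\<alpha>)"
definition B where "B z = (\<integral>x. 1 / (x - z) \<partial>\<beta>)"
definition S where "S = {z :: real. - \<aa> < ereal z \<and> ereal z < \<bb>}"

abbreviation \<gamma> where "\<gamma> \<equiv> shape_function \<alpha> \<beta> \<aa> \<bb>"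

lemma S_separation:
  assumes "z \<in> S"
  obtains c d where "ereal c < \<aa>" "c + z > 0" "ereal d < \<bb>" "d - z > 0"
proof -
  have "ereal (- z) < \<aa>" using assms ereal_uminus_less_reorder[of \<aa> "ereal z"] by (simp add: S_def)
  then obtain c where "ereal (- z) < ereal c" "ereal c < \<aa>" using ereal_dense2 by blast
  moreover obtain d where "ereal z < ereal d" "ereal d < \<bb>"
    using assms ereal_dense2[of "ereal z" \<bb>] unfolding S_def by blast
  ultimately show ?thesis using that by simp
qed

lemma S_nonempty: "S \<noteq> {}"
proof -
  have "- \<aa> < \<bb>" using endpoints by (cases \<aa>; cases \<bb>) auto
  then obtain z where "- \<aa> < ereal z" "ereal z < \<bb>" using ereal_dense2 by blast
  then show ?thesis by (auto simp: S_def)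
qed

lemma row_sum_tendsto:
  assumes "z \<in> S"
  shows "(\<lambda>m. (\<Sum>i=1..m. 1 / (a m i + z)) / real m) \<longlonglongrightarrow> A z"
    "(\<lambda>n. (\<Sum>j=1..n. 1 / (b n j - z)) / real n) \<longlonglongrightarrow> B z"
proof -
  from S_separation[OF assms] obtain c d where cd: "ereal c < \<aa>" "c + z > 0" "ereal d < \<bb>" "d - z > 0" .
  show "(\<lambda>m. (\<Sum>i=1..m. 1 / (a m i + z)) / real m) \<longlonglongrightarrow> A z"
    unfolding A_def using cd
    by (intro empirical_resolvent_tendsto[OF subprob(1) vague(1)] eventually_row_ge[OF mins(1)])
  show "(\<lambda>n. (\<Sum>j=1..n. 1 / (b n j - z)) / real n) \<longlonglongrightarrow> B z"
    using empirical_resolvent_tendsto[OF subprob(2) vague(2) eventually_row_ge[OF mins(2) cd(3)], of "- z"] cd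
    by (simp add: B_def)
qed

lemma A_bounds: "ereal c < \<aa> \<Longrightarrow> c + z > 0 \<Longrightarrow> 0 \<le> A z \<and> A z \<le> 1 / (c + z)"
  unfolding A_def using resolvent_bounds[OF subprob(1) vague(1) mins(1)] by blast

lemma B_bounds: "ereal c < \<bb> \<Longrightarrow> c - z > 0 \<Longrightarrow> 0 \<le> B z \<and> B z \<le> 1 / (c - z)"
  unfolding B_def using resolvent_bounds[OF subprob(2) vague(2) mins(2), of c "- z"] by simp

lemma AB_nonneg: "z \<in> S \<Longrightarrow> 0 \<le> A z" "z \<in> S \<Longrightarrow> 0 \<le> B z"
  using A_bounds B_bounds by (meson S_separation)+

lemma shape_function_le: "z \<in> S \<Longrightarrow> 0 \<le> x \<Longrightarrow> 0 \<le> y \<Longrightarrow> \<gamma> x y \<le> x * A z + y * B z"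
  unfolding shape_function_def A_def[symmetric] B_def[symmetric] S_def[symmetric]
  by (intro cINF_lower bdd_belowI[of _ 0]) (auto intro!: add_nonneg_nonneg mult_nonneg_nonneg AB_nonneg)

lemma shape_function_approx:
  assumes "\<gamma> x y < t"
  obtains z where "z \<in> S" "x * A z + y * B z < t"
proof -
  have "Inf ((\<lambda>z. x * A z + y * B z) ` S) < t"
    using assms unfolding shape_function_def A_def B_def S_def .
  then show ?thesis using that cInf_lessD[of "(\<lambda>z. x * A z + y * B z) ` S" t] S_nonempty by auto
qed

lemma eventually_row_sums_close:
  assumes "finite F" "F \<subseteq> S" "\<epsilon> > 0"
  obtains L where "L \<ge> 1" "\<And>m z. m \<ge> L \<Longrightarrow> z \<in> F \<Longrightarrow> \<bar>(\<Sum>i=1..m. 1 / (a m i + z)) - real m * A z\<bar> \<le> \<epsilon> * real m"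
    "\<And>n z. n \<ge> L \<Longrightarrow> z \<in> F \<Longrightarrow> \<bar>(\<Sum>j=1..n. 1 / (b n j - z)) - real n * B z\<bar> \<le> \<epsilon> * real n"
proof -
  have conv: "\<bar>s - real m * t\<bar> \<le> \<epsilon> * real m" if "\<bar>s / real m - t\<bar> < \<epsilon>" "m \<ge> 1" for s t and m :: nat
  proof -
    have "\<bar>s - real m * t\<bar> = \<bar>s / real m - t\<bar> * real m" using that(2) by (simp add: abs_mult_pos' field_simps)
    also have "\<dots> \<le> \<epsilon> * real m" using that by (intro mult_right_mono) auto
    finally show ?thesis .
  qed
  have "\<forall>\<^sub>F m in sequentially. \<forall>z\<in>F. \<bar>(\<Sum>i=1..m. 1 / (a m i + z)) / real m - A z\<bar> < \<epsilon>"
    "\<forall>\<^sub>F m in sequentially. \<forall>z\<in>F. \<bar>(\<Sum>i=1..m. 1 / (b m i - z)) / real m - B z\<bar> < \<epsilon>"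
    using row_sum_tendsto[THEN tendstoD, OF _ assms(3)] assms(1,2)
    by (auto simp: eventually_ball_finite_distrib dist_real_def)
  then have "\<forall>\<^sub>F m in sequentially. m \<ge> 1 \<and> (\<forall>z\<in>F. \<bar>(\<Sum>i=1..m. 1 / (a m i + z)) - real m * A z\<bar> \<le> \<epsilon> * real m) \<and>
     (\<forall>z\<in>F. \<bar>(\<Sum>i=1..m. 1 / (b m i - z)) - real m * B z\<bar> \<le> \<epsilon> * real m)"
    using eventually_ge_at_top[of 1] by eventually_elim (auto intro!: conv)
  then obtain L where L: "\<forall>m\<ge>L. m \<ge> 1 \<and> (\<forall>z\<in>F. \<bar>(\<Sum>i=1..m. 1 / (a m i + z)) - real m * A z\<bar> \<le> \<epsilon> * real m) \<and>
     (\<forall>z\<in>F. \<bar>(\<Sum>i=1..m. 1 / (b m i - z)) - real m * B z\<bar> \<le> \<epsilon> * real m)"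
    unfolding eventually_sequentially by blast
  show ?thesis by (rule that[of L]) (use L in auto)
qed

lemma shape_upper:
  assumes "\<epsilon> > 0"
  obtains L \<eta> where "L \<ge> 1" "\<eta> > 0" "\<And>m n. m \<ge> L \<Longrightarrow> n \<ge> L \<Longrightarrow>
    \<exists>z. (\<forall>i\<in>{1..m}. a m i + z \<ge> \<eta>) \<and> (\<forall>j\<in>{1..n}. b n j - z \<ge> \<eta>) \<and>
      (\<Sum>i=1..m. 1 / (a m i + z)) + (\<Sum>j=1..n. 1 / (b n j - z)) \<le> \<gamma> (real m) (real n) + \<epsilon> * (real m + real n)"
proof -
  \<comment> \<open>One third each for the near-minimizer, for its replacement by a point of
    \<open>F\<close> and for the convergence of the row sums.\<close>
  define e where "e = \<epsilon> / 3"
  have e: "e > 0" using assms by (simp add: e_def)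
  obtain s0 where "s0 \<in> S" using S_nonempty by auto
  from finite_dominating_subset[of s0 S e A B, OF this e AB_nonneg] obtain F where
    F: "finite F" "F \<subseteq> S" and dom: "\<And>s. s \<in> S \<Longrightarrow> \<exists>f\<in>F. A f \<le> A s + e \<and> B f \<le> B s + e" by blast
  from eventually_row_sums_close[OF F e] obtain L where L: "L \<ge> 1"
    and La: "\<And>m z. m \<ge> L \<Longrightarrow> z \<in> F \<Longrightarrow> \<bar>(\<Sum>i=1..m. 1 / (a m i + z)) - real m * A z\<bar> \<le> e * real m"
    and Lb: "\<And>n z. n \<ge> L \<Longrightarrow> z \<in> F \<Longrightarrow> \<bar>(\<Sum>j=1..n. 1 / (b n j - z)) - real n * B z\<bar> \<le> e * real n"
    by blast
  have "\<exists>\<eta>>0. \<forall>\<^sub>F m in sequentially. (\<forall>i\<in>{1..m}. a m i + z \<ge> \<eta>) \<and> (\<forall>j\<in>{1..m}. b m j - z \<ge> \<eta>)" if "z \<in> F" for z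
  proof -
    have "z \<in> S" using that F by auto
    then obtain c d where cd: "ereal c < \<aa>" "c + z > 0" "ereal d < \<bb>" "d - z > 0"
      by (rule S_separation)
    have "\<forall>\<^sub>F m in sequentially. (\<forall>i\<in>{1..m}. a m i + z \<ge> min (c + z) (d - z)) \<and> (\<forall>j\<in>{1..m}. b m j - z \<ge> min (c + z) (d - z))"
      using eventually_row_ge[OF mins(1) cd(1)] eventually_row_ge[OF mins(2) cd(3)]
    proof eventually_elim
      case (elim m)
      have "min (c + z) (d - z) \<le> c + z" "min (c + z) (d - z) \<le> d - z" by auto
      then show ?case using elim by (fastforce simp del: min_le_iff_disj)
    qed
    then show ?thesis using cd by (intro exI[of _ "min (c + z) (d - z)"]) auto
  qed
  then have "\<forall>z\<in>F. \<exists>\<eta>>0. \<forall>\<^sub>F m in sequentially. (\<forall>i\<in>{1..m}. a m i + z \<ge> \<eta>) \<and> (\<forall>j\<in>{1..m}. b m j - z \<ge> \<eta>)"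
    by blast
  from bchoice[OF this] obtain h where h: "\<And>z. z \<in> F \<Longrightarrow> h z > 0"
    "\<And>z. z \<in> F \<Longrightarrow> \<forall>\<^sub>F m in sequentially. (\<forall>i\<in>{1..m}. a m i + z \<ge> h z) \<and> (\<forall>j\<in>{1..m}. b m j - z \<ge> h z)"
    by blast
  define \<eta> where "\<eta> = Min (insert 1 (h ` F))"
  have \<eta>: "\<eta> > 0" "\<And>z. z \<in> F \<Longrightarrow> \<eta> \<le> h z" using h F by (auto simp: \<eta>_def)
  have "\<forall>\<^sub>F m in sequentially. \<forall>z\<in>F. (\<forall>i\<in>{1..m}. a m i + z \<ge> h z) \<and> (\<forall>j\<in>{1..m}. b m j - z \<ge> h z)"
    using h(2) F by (simp add: eventually_ball_finite_distrib)
  then obtain L' where L': "\<And>m z. m \<ge> L' \<Longrightarrow> z \<in> F \<Longrightarrow> (\<forall>i\<in>{1..m}. a m i + z \<ge> h z) \<and> (\<forall>j\<in>{1..m}. b m j - z \<ge> h z)"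
    unfolding eventually_sequentially by blast
  show ?thesis
  proof (rule that[of "max L L'" \<eta>])
    fix m n assume mn: "m \<ge> max L L'" "n \<ge> max L L'"
    have "\<gamma> (real m) (real n) < \<gamma> (real m) (real n) + e * (real m + real n)" using mn L e by simp
    then obtain s where s: "s \<in> S" "real m * A s + real n * B s < \<gamma> (real m) (real n) + e * (real m + real n)"
      by (rule shape_function_approx)
    obtain z where z: "z \<in> F" "A z \<le> A s + e" "B z \<le> B s + e" using dom[OF s(1)] by blast
    have "real m * A z \<le> real m * (A s + e)" "real n * B z \<le> real n * (B s + e)"
      using z by (auto intro: mult_left_mono)
    then have "(\<Sum>i=1..m. 1 / (a m i + z)) + (\<Sum>j=1..n. 1 / (b n j - z)) \<le> \<gamma> (real m) (real n) + 3 * (e * (real m + real n))"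
      using La[of m z] Lb[of n z] z s(2) mn by (simp add: algebra_simps abs_le_iff)
    moreover have "\<forall>i\<in>{1..m}. a m i + z \<ge> \<eta>" "\<forall>j\<in>{1..n}. b n j - z \<ge> \<eta>"
      using L'[of m z] L'[of n z] mn z \<eta>(2)[OF z(1)] order_trans by auto
    ultimately show "\<exists>z. (\<forall>i\<in>{1..m}. a m i + z \<ge> \<eta>) \<and> (\<forall>j\<in>{1..n}. b n j - z \<ge> \<eta>) \<and>
      (\<Sum>i=1..m. 1 / (a m i + z)) + (\<Sum>j=1..n. 1 / (b n j - z)) \<le> \<gamma> (real m) (real n) + \<epsilon> * (real m + real n)"
      by (auto simp: e_def)
  qed (use L \<eta> in auto)
qed

text \<open>If \<aa> is infinite, \<open>A_bounds\<close> holds with arbitrarily large c, so A is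
  negligible for every z, and z can be moved towards -\<infinity> until B is small. The case of
  \<bb> is symmetric.\<close>

lemma shape_function_small:
  assumes inf: "\<aa> = \<infinity> \<or> \<bb> = \<infinity>" and "\<epsilon> > 0" "0 \<le> x" "0 \<le> y"
  shows "\<gamma> x y \<le> \<epsilon> * (x + y)"
proof -
  have "\<exists>z\<in>S. A z \<le> \<epsilon> \<and> B z \<le> \<epsilon>"
  proof -
    obtain s where "s \<in> S" using S_nonempty by auto
    from S_separation[OF this] obtain c d where cd: "ereal c < \<aa>" "c + s > 0" "ereal d < \<bb>" "d - s > 0" .
    have e: "1 / \<epsilon> > 0" "1 / (1 / \<epsilon>) = \<epsilon>" using assms by auto
    from inf show ?thesis
    proof
      assume i: "\<aa> = \<infinity>"
      let ?z = "d - 1 / \<epsilon>"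
      have "ereal ?z < ereal d" using e by simp
      then have "ereal ?z < \<bb>" using cd(3) by (rule less_trans)
      then have "?z \<in> S" using i unfolding S_def by simp
      moreover have "A ?z \<le> \<epsilon>" using A_bounds[of "1 / \<epsilon> - ?z" ?z] i e by simp
      moreover have "B ?z \<le> \<epsilon>" using B_bounds[OF cd(3), of ?z] e by simp
      ultimately show ?thesis by blast
    next
      assume i: "\<bb> = \<infinity>"
      let ?z = "1 / \<epsilon> - c"
      have "- \<aa> < ereal (- c)" using cd(1) by (cases \<aa>) auto
      moreover have "ereal (- c) < ereal ?z" using e by simp
      ultimately have "- \<aa> < ereal ?z" by (rule less_trans)
      then have "?z \<in> S" using i unfolding S_def by simp
      moreover have "A ?z \<le> \<epsilon>" using A_bounds[OF cd(1), of ?z] e by simp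
      moreover have "B ?z \<le> \<epsilon>" using B_bounds[of "1 / \<epsilon> + ?z" ?z] i e by simp
      ultimately show ?thesis by blast
    qed
  qed
  then obtain z where z: "z \<in> S" "A z \<le> \<epsilon>" "B z \<le> \<epsilon>" by blast
  have "\<gamma> x y \<le> x * A z + y * B z" using shape_function_le z assms by blast
  also have "\<dots> \<le> x * \<epsilon> + y * \<epsilon>" using z assms by (intro add_mono mult_left_mono) auto
  finally show ?thesis by (simp add: algebra_simps)
qed

text \<open>Here z is arbitrary with margin \<eta>. For finite endpoints the row minima eventually
  lie within \<eta> / 2 above them at most, which confines z to a compact part of \<open>S\<close>,
  where a finite net and a Lipschitz bound give uniformity. For an infinite endpoint there is no
  such confinement, but the shape function is negligible and the sums are nonnegative.\<close>

lemma shape_lower: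
  assumes "\<epsilon> > 0" "\<eta> > 0"
  obtains L where "L \<ge> 1" "\<And>m n z. m \<ge> L \<Longrightarrow> n \<ge> L \<Longrightarrow> (\<forall>i\<in>{1..m}. a m i + z \<ge> \<eta>) \<Longrightarrow> (\<forall>j\<in>{1..n}. b n j - z \<ge> \<eta>) \<Longrightarrow>
      \<gamma> (real m) (real n) - \<epsilon> * (real m + real n) \<le> (\<Sum>i=1..m. 1 / (a m i + z)) + (\<Sum>j=1..n. 1 / (b n j - z))"
proof (cases "\<aa> = \<infinity> \<or> \<bb> = \<infinity>")
  case True
  show ?thesis
  proof (rule that[of 1])
    fix m n z assume r: "\<forall>i\<in>{1..m}. a m i + z \<ge> \<eta>" "\<forall>j\<in>{1..n}. b n j - z \<ge> \<eta>"
    have "0 \<le> a m i + z" if "i \<in> {1..m}" for i using r(1) assms that by fastforce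
    moreover have "0 \<le> b n j - z" if "j \<in> {1..n}" for j using r(2) assms that by fastforce
    ultimately have "0 \<le> (\<Sum>i=1..m. 1 / (a m i + z))" "0 \<le> (\<Sum>j=1..n. 1 / (b n j - z))"
      by (auto intro!: sum_nonneg)
    then show "\<gamma> (real m) (real n) - \<epsilon> * (real m + real n) \<le> (\<Sum>i=1..m. 1 / (a m i + z)) + (\<Sum>j=1..n. 1 / (b n j - z))"
      using shape_function_small[OF True assms(1), of "real m" "real n"] by simp
  qed simp
next
  case False
  then obtain a0 b0 where ab: "\<aa> = ereal a0" "\<bb> = ereal b0" using endpoints by (cases \<aa>; cases \<bb>) auto
  define K where "K = {- a0 + \<eta> / 2..b0 - \<eta> / 2}"
  have KS: "K \<subseteq> S" using assms unfolding K_def S_def by (auto simp: ab)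
  \<comment> \<open>A point within \<tau> of some \<open>x \<ge> \<eta>\<close> is at least \<eta> /
    2, so its reciprocal differs by at most \<open>\<tau> / (\<eta> * (\<eta> / 2))\<close>, which
    is at most \<epsilon> / 2.\<close>
  define \<tau> where "\<tau> = min (\<eta> / 2) (\<epsilon> * \<eta>\<^sup>2 / 4)"
  have \<tau>: "\<tau> > 0" "\<tau> \<le> \<eta> / 2" "\<tau> \<le> \<epsilon> * \<eta>\<^sup>2 / 4" using assms by (auto simp: \<tau>_def)
  have "compact K" by (simp add: K_def)
  then have "seq_compact K" by (simp add: compact_eq_seq_compact_metric)
  then obtain Z where Z: "finite Z" "Z \<subseteq> K" "K \<subseteq> (\<Union>x\<in>Z. ball x \<tau>)"
    using seq_compact_imp_totally_bounded[of K, rule_format, OF _ \<tau>(1)] by auto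
  from assms have "\<epsilon> / 2 > 0" by simp
  from eventually_row_sums_close[OF Z(1) order_trans[OF Z(2) KS] this] obtain L where L: "L \<ge> 1"
    and La: "\<And>m z. m \<ge> L \<Longrightarrow> z \<in> Z \<Longrightarrow> \<bar>(\<Sum>i=1..m. 1 / (a m i + z)) - real m * A z\<bar> \<le> \<epsilon> / 2 * real m"
    and Lb: "\<And>n z. n \<ge> L \<Longrightarrow> z \<in> Z \<Longrightarrow> \<bar>(\<Sum>j=1..n. 1 / (b n j - z)) - real n * B z\<bar> \<le> \<epsilon> / 2 * real n"
    by blast
  have "\<aa> < ereal (a0 + \<eta> / 2)" "\<bb> < ereal (b0 + \<eta> / 2)" using assms by (auto simp: ab)
  from eventually_row_ex_le[OF mins(1) this(1)] eventually_row_ex_le[OF mins(2) this(2)]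
  have "\<forall>\<^sub>F m in sequentially. (\<exists>i\<in>{1..m}. a m i \<le> a0 + \<eta> / 2) \<and> (\<exists>i\<in>{1..m}. b m i \<le> b0 + \<eta> / 2)"
    by eventually_elim auto
  then obtain L' where L': "\<And>m. m \<ge> L' \<Longrightarrow> (\<exists>i\<in>{1..m}. a m i \<le> a0 + \<eta> / 2) \<and> (\<exists>i\<in>{1..m}. b m i \<le> b0 + \<eta> / 2)"
    unfolding eventually_sequentially by blast
  have lip: "1 / y - \<epsilon> / 2 \<le> 1 / x" if "x \<ge> \<eta>" "\<bar>x - y\<bar> \<le> \<tau>" for x y :: real
  proof -
    have y: "y \<ge> \<eta> / 2" using that \<tau> by linarith
    have xy: "x > 0" "y > 0" using that y assms by linarith+
    have "1 / y - 1 / x = (x - y) / (x * y)" using xy by (simp add: field_simps)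
    also have "\<dots> \<le> \<tau> / (\<eta> * (\<eta> / 2))"
      using that xy y assms \<tau> by (intro frac_le mult_mono) auto
    also have "\<dots> \<le> \<epsilon> / 2" using \<tau>(3) assms by (simp add: field_simps power2_eq_square)
    finally show ?thesis by simp
  qed
  show ?thesis
  proof (rule that[of "max L L'"])
    fix m n z assume mn: "max L L' \<le> m" "max L L' \<le> n"
      and r: "\<forall>i\<in>{1..m}. a m i + z \<ge> \<eta>" "\<forall>j\<in>{1..n}. b n j - z \<ge> \<eta>"
    obtain i j where "i \<in> {1..m}" "a m i \<le> a0 + \<eta> / 2" "j \<in> {1..n}" "b n j \<le> b0 + \<eta> / 2"
      using L'[of m] L'[of n] mn by auto
    then have "z \<in> K" using r(1)[rule_format, of i] r(2)[rule_format, of j] by (auto simp: K_def)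
    then obtain z' where z': "z' \<in> Z" "\<bar>z - z'\<bar> \<le> \<tau>" using Z(3) by (force simp: dist_real_def)
    have mL: "L \<le> m" "L \<le> n" using mn by auto
    have ab': "real m * A z' \<le> (\<Sum>i=1..m. 1 / (a m i + z')) + \<epsilon> / 2 * real m"
      "real n * B z' \<le> (\<Sum>j=1..n. 1 / (b n j - z')) + \<epsilon> / 2 * real n"
      using La[OF mL(1) z'(1)] Lb[OF mL(2) z'(1)] by linarith+
    have "(\<Sum>i=1..m. 1 / (a m i + z') - \<epsilon> / 2) \<le> (\<Sum>i=1..m. 1 / (a m i + z))"
      by (intro sum_mono lip) (use r z' in auto)
    moreover have "(\<Sum>j=1..n. 1 / (b n j - z') - \<epsilon> / 2) \<le> (\<Sum>j=1..n. 1 / (b n j - z))"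
      by (intro sum_mono lip) (use r z' in auto)
    moreover have "\<gamma> (real m) (real n) \<le> real m * A z' + real n * B z'"
      using z' Z KS by (intro shape_function_le) auto
    ultimately show "\<gamma> (real m) (real n) - \<epsilon> * (real m + real n) \<le>
        (\<Sum>i=1..m. 1 / (a m i + z)) + (\<Sum>j=1..n. 1 / (b n j - z))"
      using ab' by (simp add: sum_subtractf algebra_simps)
  qed (use L in auto)
qed

end

section \<open>Transfer to the given arrays\<close>

lemma indep_vars_exp_field: "exp_field.indep_vars (\<lambda>_. exp1) (\<lambda>p X. X p) K" if "finite K" "K \<noteq> {}"
proof -
  have rv: "(\<lambda>X. X p) \<in> exp_field \<rightarrow>\<^sub>M exp1" for p
    unfolding exp_field_def by measurable
  have "distr exp_field exp1 (\<lambda>X. X p) = exp1" for p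
    unfolding exp_field_def using exp_prod.PiM_component[of p] by simp
  moreover have "distr exp_field (PiM K (\<lambda>_. exp1)) (\<lambda>X. restrict X K) = PiM K (\<lambda>_. exp1)"
    unfolding exp_field_def by (rule exp_prod.distr_PiM_restrict_finite) (auto simp: that)
  ultimately show ?thesis
    by (subst exp_field.indep_vars_iff_distr_eq_PiM'[OF that(2) rv]) (simp add: restrict_def)
qed

lemma distr_exp1_scaled:
  assumes "r > 0"
  shows "distr exp1 borel (\<lambda>x. x / r) = density lborel (exponential_density r)"
proof (rule measure_eqI)
  fix A assume "A \<in> sets (distr exp1 borel (\<lambda>x. x / r))"
  then have A[measurable]: "A \<in> sets borel" by simp
  have "emeasure (distr exp1 borel (\<lambda>x. x / r)) A = (\<integral>\<^sup>+y. indicator A y \<partial>distr exp1 borel (\<lambda>x. x / r))"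
    by simp
  also have "\<dots> = (\<integral>\<^sup>+x. indicator A (x / r) \<partial>exp1)"
    by (rule nn_integral_distr) measurable
  also have "\<dots> = (\<integral>\<^sup>+x. ennreal (exponential_density r x) * indicator A x \<partial>lborel)"
    by (subst nn_integral_exp1[OF _ assms])
      (use assms in \<open>auto simp: erlang_density_def mult.commute indicator_def intro!: nn_integral_cong\<close>)
  also have "\<dots> = emeasure (density lborel (exponential_density r)) A"
    by (simp add: emeasure_density)
  finally show "emeasure (distr exp1 borel (\<lambda>x. x / r)) A = emeasure (density lborel (exponential_density r)) A" .
qed simp

text \<open>For fixed m and n the weights in the rectangle have the same joint law as
  \<open>rate_weights\<close>, being independent with equal marginals. Only such probabilities enter
  the proof, which is why the coupling between different rectangles is irrelevant.\<close>

lemma measure_lpp_transfer: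
  assumes M: "prob_space M" and mn: "m \<ge> 1" "n \<ge> 1"
    and indep: "prob_space.indep_vars M (\<lambda>_. borel) \<omega> ({1..m} \<times> {1..n})"
    and dist: "\<And>i j. i \<in> {1..m} \<Longrightarrow> j \<in> {1..n} \<Longrightarrow>
      distributed M lborel (\<omega> (i, j)) (exponential_density (u i + v j))"
    and pos: "\<And>i j. i \<in> {1..m} \<Longrightarrow> j \<in> {1..n} \<Longrightarrow> u i + v j > 0"
    and R: "{x. R x} \<in> sets borel"
  shows "measure M {x \<in> space M. R (lpp (bulk (\<lambda>p. \<omega> p x)) m n)} =
    measure exp_field {X. R (lpp (bulk (rate_weights u v X)) m n)}"
proof -
  interpret M: prob_space M by fact
  define K where "K = {1..m} \<times> {1..n}"
  have K: "finite K" "K \<noteq> {}" using mn by (auto simp: K_def)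
  let ?P = "PiM K (\<lambda>_. borel :: real measure)"
  \<comment> \<open>Setting the weights outside K to 0 makes this a measurable function on the
    finite product over K.\<close>
  define \<Psi> where "\<Psi> w = lpp (bulk (\<lambda>p. if p \<in> K then w p else 0)) m n" for w :: "nat \<times> nat \<Rightarrow> real"
  have \<Psi>[measurable]: "\<Psi> \<in> borel_measurable ?P"
    unfolding \<Psi>_def
  proof (rule measurable_lpp)
    fix p
    have "bulk (\<lambda>p. if p \<in> K then w p else 0) p = (if p \<in> K then w p else 0)" for w
      by (cases p) (auto simp: bulk_def K_def)
    then show "(\<lambda>w. bulk (\<lambda>p. if p \<in> K then w p else 0) p) \<in> borel_measurable ?P"
      by (cases "p \<in> K") simp_all
  qed
  have \<Psi>_eq: "\<Psi> (\<lambda>p\<in>K. w p) = lpp (bulk w) m n" for w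
    unfolding \<Psi>_def by (rule lpp_cong) (auto simp: bulk_def K_def)
  have set: "\<Psi> -` {x. R x} \<inter> space ?P \<in> sets ?P"
    by (rule measurable_sets[OF \<Psi> R])
  have rv: "\<omega> p \<in> borel_measurable M" if "p \<in> K" for p
    using dist[of "fst p" "snd p"] that by (auto simp: K_def distributed_def)
  have rvE: "(\<lambda>X. rate_weights u v X p) \<in> borel_measurable exp_field" for p
    by (rule measurable_rate_weights)
  have indepE: "exp_field.indep_vars (\<lambda>_. borel) (\<lambda>p X. rate_weights u v X p) K"
    using exp_field.indep_vars_compose2[OF indep_vars_exp_field[OF K], of "\<lambda>p x. x / (u (fst p) + v (snd p))" "\<lambda>_. borel"]
    by (simp add: rate_weights_def split_beta)
  have distrE: "distr exp_field borel (\<lambda>X. rate_weights u v X p) = distr M borel (\<omega> p)" if p: "p \<in> K" for p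
  proof -
    obtain i j where ij: "p = (i, j)" "i \<in> {1..m}" "j \<in> {1..n}" using p by (auto simp: K_def)
    have "distr exp_field borel (\<lambda>X. rate_weights u v X p) = distr exp_field borel ((\<lambda>x. x / (u i + v j)) \<circ> (\<lambda>X. X p))"
      by (simp add: ij comp_def)
    also have "\<dots> = distr (distr exp_field exp1 (\<lambda>X. X p)) borel (\<lambda>x. x / (u i + v j))"
      by (rule distr_distr[symmetric]) (simp_all add: exp_field_def)
    also have "distr exp_field exp1 (\<lambda>X. X p) = exp1"
      unfolding exp_field_def using exp_prod.PiM_component[of p] by simp
    also have "distr exp1 borel (\<lambda>x. x / (u i + v j)) = density lborel (exponential_density (u i + v j))"
      using pos ij by (intro distr_exp1_scaled) auto
    also have "\<dots> = distr M lborel (\<omega> p)"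
      using dist[OF ij(2,3)] ij(1) by (simp add: distributed_def)
    also have "\<dots> = distr M borel (\<omega> p)" by (intro distr_cong) simp_all
    finally show ?thesis .
  qed
  have eq: "distr M ?P (\<lambda>x. \<lambda>p\<in>K. \<omega> p x) = distr exp_field ?P (\<lambda>X. \<lambda>p\<in>K. rate_weights u v X p)"
  proof -
    have "distr M ?P (\<lambda>x. \<lambda>p\<in>K. \<omega> p x) = PiM K (\<lambda>p. distr M borel (\<omega> p))"
      using M.indep_vars_iff_distr_eq_PiM'[OF K(2) rv] indep[folded K_def] by (rule iffD1)
    also have "\<dots> = PiM K (\<lambda>p. distr exp_field borel (\<lambda>X. rate_weights u v X p))"
      by (intro PiM_cong) (simp_all add: distrE)
    also have "\<dots> = distr exp_field ?P (\<lambda>X. \<lambda>p\<in>K. rate_weights u v X p)"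
      using exp_field.indep_vars_iff_distr_eq_PiM'[OF K(2) rvE] indepE by (rule iffD1[THEN sym])
    finally show ?thesis .
  qed
  have mM: "(\<lambda>x. \<lambda>p\<in>K. \<omega> p x) \<in> M \<rightarrow>\<^sub>M ?P" by (intro measurable_restrict rv)
  have mE: "(\<lambda>X. \<lambda>p\<in>K. rate_weights u v X p) \<in> exp_field \<rightarrow>\<^sub>M ?P" by (intro measurable_restrict rvE)
  have "measure M {x \<in> space M. R (lpp (bulk (\<lambda>p. \<omega> p x)) m n)} =
      measure (distr M ?P (\<lambda>x. \<lambda>p\<in>K. \<omega> p x)) (\<Psi> -` {x. R x} \<inter> space ?P)"
    using measurable_space[OF mM]
    by (subst measure_distr[OF mM set]) (auto simp: \<Psi>_eq intro!: arg_cong[where f="measure M"])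
  also have "\<dots> = measure exp_field {X. R (lpp (bulk (rate_weights u v X)) m n)}"
    unfolding eq using measurable_space[OF mE]
    by (subst measure_distr[OF mE set]) (auto simp: \<Psi>_eq intro!: arg_cong[where f="measure exp_field"])
  finally show ?thesis .
qed

lemma summable_poly_exp:
  fixes c :: real
  assumes "c > 0"
  shows "summable (\<lambda>N. K * (real N + 1)\<^sup>2 * exp (- c * real N))"
proof (rule summable_comparison_test_bigo)
  show "summable (\<lambda>N. norm (1 / real N ^ 2))"
    using inverse_power_summable[of 2, where 'a=real] by (simp add: field_simps)
  show "(\<lambda>N. K * (real N + 1)\<^sup>2 * exp (- c * real N)) \<in> O(\<lambda>N. 1 / real N ^ 2)"
    using assms by real_asymp
qed

section \<open>Deviation bound and almost sure convergence\<close>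

context converging_rates
begin

lemma deviation_bound:
  assumes "\<epsilon> > 0"
  obtains L c where "L \<ge> 1" "c > 0" "\<And>m n. m \<ge> L \<Longrightarrow> n \<ge> L \<Longrightarrow>
    measure exp_field {X. \<epsilon> * (real m + real n) < \<bar>lpp (bulk (rate_weights (a m) (b n) X)) m n - \<gamma> (real m) (real n)\<bar>}
      \<le> 19 * (real (m + n) + 1) * exp (- c * real (m + n))"
proof -
  obtain s where "s \<in> S" using S_nonempty by auto
  from S_separation[OF this] obtain ca cb where cs: "ereal ca < \<aa>" "ca + s > 0" "ereal cb < \<bb>" "cb - s > 0" .
  \<comment> \<open>Any point of \<open>S\<close> separates the endpoints, so \<open>ca + cb\<close>
    is a positive lower bound for all rates \<open>a m i + b n j\<close> with m and n large.\<close>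
  define c0 where "c0 = ca + cb"
  have c0: "c0 > 0" using cs by (simp add: c0_def)
  have "\<forall>\<^sub>F m in sequentially. (\<forall>i\<in>{1..m}. ca \<le> a m i) \<and> (\<forall>i\<in>{1..m}. cb \<le> b m i)"
    using eventually_row_ge[OF mins(1) cs(1)] eventually_row_ge[OF mins(2) cs(3)] by eventually_elim auto
  then obtain L0 where L0: "\<And>m. m \<ge> L0 \<Longrightarrow> (\<forall>i\<in>{1..m}. ca \<le> a m i) \<and> (\<forall>i\<in>{1..m}. cb \<le> b m i)"
    unfolding eventually_sequentially by blast
  \<comment> \<open>Half of \<epsilon> pays for the comparison of row sums with the shape function,
    half for the fluctuations; \<open>upper_tail\<close> consumes its half as \<open>2 * s\<close>
    with s = \<epsilon> / 4.\<close>
  from assms have e2: "\<epsilon> / 2 > 0" "\<epsilon> / 4 > 0" by auto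
  obtain L1 \<eta>1 where L1: "L1 \<ge> 1" "\<eta>1 > 0" and up: "\<And>m n. m \<ge> L1 \<Longrightarrow> n \<ge> L1 \<Longrightarrow>
    \<exists>z. (\<forall>i\<in>{1..m}. a m i + z \<ge> \<eta>1) \<and> (\<forall>j\<in>{1..n}. b n j - z \<ge> \<eta>1) \<and>
      (\<Sum>i=1..m. 1 / (a m i + z)) + (\<Sum>j=1..n. 1 / (b n j - z)) \<le> \<gamma> (real m) (real n) + \<epsilon> / 2 * (real m + real n)"
    using shape_upper[OF e2(1)] by blast
  obtain \<eta>2 c2 N0 where \<eta>2: "\<eta>2 > 0" "c2 > 0" and low: "\<And>a b m n N. N \<ge> N0 \<Longrightarrow> 1 \<le> m \<Longrightarrow> 1 \<le> n \<Longrightarrow> real m \<le> N \<Longrightarrow> real n \<le> N \<Longrightarrow>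
    (\<And>i j. 1 \<le> i \<Longrightarrow> i \<le> m \<Longrightarrow> 1 \<le> j \<Longrightarrow> j \<le> n \<Longrightarrow> a i + b j \<ge> c0) \<Longrightarrow>
    \<exists>z. (\<forall>i\<in>{1..m}. a i + z \<ge> \<eta>2) \<and> (\<forall>j\<in>{1..n}. b j - z \<ge> \<eta>2) \<and>
    measure exp_field {X. lpp (bulk (rate_weights a b X)) m n < (\<Sum>i=1..m. 1 / (a i + z)) + (\<Sum>j=1..n. 1 / (b j - z)) - \<epsilon> / 2 * N}
      \<le> 17 * (N + 1) * exp (- c2 * N)"
    using lower_tail[OF e2(1) c0] by blast
  obtain L2 where L2: "L2 \<ge> 1" and sl: "\<And>m n z. m \<ge> L2 \<Longrightarrow> n \<ge> L2 \<Longrightarrow> (\<forall>i\<in>{1..m}. a m i + z \<ge> \<eta>2) \<Longrightarrow> (\<forall>j\<in>{1..n}. b n j - z \<ge> \<eta>2) \<Longrightarrow>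
      \<gamma> (real m) (real n) - \<epsilon> / 2 * (real m + real n) \<le> (\<Sum>i=1..m. 1 / (a m i + z)) + (\<Sum>j=1..n. 1 / (b n j - z))"
    using shape_lower[OF e2(1) \<eta>2(1)] by blast
  define c1 where "c1 = dev_rate \<eta>1 (\<epsilon> / 4)"
  have c1: "c1 > 0" unfolding c1_def by (rule dev_rate_pos[OF L1(2) e2(2)])
  define c where "c = min c1 c2"
  show ?thesis
  proof (rule that[of "max L0 (max L1 (max L2 (nat \<lceil>N0\<rceil>)))" c])
    fix m n :: nat
    assume m: "max L0 (max L1 (max L2 (nat \<lceil>N0\<rceil>))) \<le> m" and n: "max L0 (max L1 (max L2 (nat \<lceil>N0\<rceil>))) \<le> n"
    define N where "N = real (m + n)"
    have N: "real m \<le> N" "real n \<le> N" "N \<ge> N0" "N \<ge> 0" "real m + real n = N" using m n by (auto simp: N_def)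
    have mn1: "1 \<le> m" "1 \<le> n" using m n L1(1) by auto
    let ?G = "\<lambda>X. lpp (bulk (rate_weights (a m) (b n) X)) m n"
    let ?\<gamma> = "\<gamma> (real m) (real n)"
    have meas: "?G \<in> borel_measurable exp_field" by (intro measurable_lpp measurable_bulk_rate_weights)
    obtain z1 where z1: "\<forall>i\<in>{1..m}. a m i + z1 \<ge> \<eta>1" "\<forall>j\<in>{1..n}. b n j - z1 \<ge> \<eta>1"
      "(\<Sum>i=1..m. 1 / (a m i + z1)) + (\<Sum>j=1..n. 1 / (b n j - z1)) \<le> ?\<gamma> + \<epsilon> / 2 * N"
      using up[of m n] m n unfolding N(5) by auto
    have ab: "a m i + b n j \<ge> c0" if "1 \<le> i" "i \<le> m" "1 \<le> j" "j \<le> n" for i j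
      using L0[of m] L0[of n] m n that unfolding c0_def by (intro add_mono) auto
    obtain z2 where z2: "\<forall>i\<in>{1..m}. a m i + z2 \<ge> \<eta>2" "\<forall>j\<in>{1..n}. b n j - z2 \<ge> \<eta>2"
      "measure exp_field {X. ?G X < (\<Sum>i=1..m. 1 / (a m i + z2)) + (\<Sum>j=1..n. 1 / (b n j - z2)) - \<epsilon> / 2 * N}
      \<le> 17 * (N + 1) * exp (- c2 * N)"
      using low[where a="a m" and b="b n", OF N(3) mn1 N(1,2) ab] by blast
    have le2: "?\<gamma> - \<epsilon> / 2 * N \<le> (\<Sum>i=1..m. 1 / (a m i + z2)) + (\<Sum>j=1..n. 1 / (b n j - z2))"
      using sl[OF _ _ z2(1,2)] m n unfolding N(5) by auto
    let ?U = "{X. (\<Sum>i=1..m. 1 / (a m i + z1)) + (\<Sum>j=1..n. 1 / (b n j - z1)) + 2 * (\<epsilon> / 4) * N \<le> ?G X}"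
    let ?V = "{X. ?G X < (\<Sum>i=1..m. 1 / (a m i + z2)) + (\<Sum>j=1..n. 1 / (b n j - z2)) - \<epsilon> / 2 * N}"
    have sets: "?U \<in> sets exp_field" "?V \<in> sets exp_field" by (intro exp_field_ge_sets exp_field_less_sets meas)+
    have half: "\<epsilon> / 2 * N = \<epsilon> * N / 2" "2 * (\<epsilon> / 4) * N = \<epsilon> * N / 2" by auto
    have "measure exp_field {X. \<epsilon> * N < \<bar>?G X - ?\<gamma>\<bar>} \<le> measure exp_field (?U \<union> ?V)"
    proof (rule exp_field.finite_measure_mono)
      show "{X. \<epsilon> * N < \<bar>?G X - ?\<gamma>\<bar>} \<subseteq> ?U \<union> ?V"
      proof
        fix X assume "X \<in> {X. \<epsilon> * N < \<bar>?G X - ?\<gamma>\<bar>}"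
        then consider "?\<gamma> + \<epsilon> * N < ?G X" | "?G X < ?\<gamma> - \<epsilon> * N" by fastforce
        then show "X \<in> ?U \<union> ?V" using z1(3) le2 unfolding half by cases simp_all
      qed
    qed (use sets in auto)
    also have "\<dots> \<le> measure exp_field ?U + measure exp_field ?V" by (rule measure_Un_le[OF sets])
    also have "measure exp_field ?U \<le> 2 * exp (- c1 * N)"
    proof -
      have "rate_weights (a m) (b n) = rate_weights (\<lambda>i. a m i + z1) (\<lambda>j. b n j - z1)"
        by (auto simp: rate_weights_def fun_eq_iff)
      then show ?thesis
        using upper_tail[where u="\<lambda>i. a m i + z1" and v="\<lambda>j. b n j - z1" and m=m and n=n and N=N
          and \<eta>=\<eta>1 and s="\<epsilon> / 4"] z1 N L1 e2 by (simp add: c1_def)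
    qed
    also have "measure exp_field ?V \<le> 17 * (N + 1) * exp (- c2 * N)" by (rule z2(3))
    also have "2 * exp (- c1 * N) + 17 * (N + 1) * exp (- c2 * N)
        \<le> 2 * (N + 1) * exp (- c * N) + 17 * (N + 1) * exp (- c * N)"
      using N(4) by (intro add_mono mult_mono) (auto simp: c_def intro: mult_right_mono)
    also have "\<dots> = 19 * (N + 1) * exp (- c * N)" by (simp add: algebra_simps)
    finally show "measure exp_field {X. \<epsilon> * (real m + real n) < \<bar>?G X - ?\<gamma>\<bar>}
      \<le> 19 * (real (m + n) + 1) * exp (- c * real (m + n))"
      unfolding N(5) by (simp only: N_def)
  qed (use L1 c1 \<eta>2 in \<open>auto simp: c_def\<close>)
qed

end

lemma prob_space_iid_exp_space: "prob_space iid_exp_space"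
  unfolding iid_exp_space_def by (intro prob_space_PiM prob_space_exponential_density) simp

theorem theorem3p6:
  fixes a b :: "nat \<Rightarrow> nat \<Rightarrow> real"
    and \<alpha> \<beta> :: "real measure"
    and \<aa> \<bb> :: ereal
    and \<omega> :: "nat \<Rightarrow> nat \<Rightarrow> nat \<times> nat \<Rightarrow> (nat \<times> nat \<Rightarrow> real) \<Rightarrow> real"
    and \<epsilon> :: real
  assumes pos: "\<And>m n i j. m \<ge> 1 \<Longrightarrow> n \<ge> 1 \<Longrightarrow> i \<in> {1..m} \<Longrightarrow> j \<in> {1..n} \<Longrightarrow> a m i + b n j > 0"
    and indep: "\<And>m n. m \<ge> 1 \<Longrightarrow> n \<ge> 1 \<Longrightarrow>
      prob_space.indep_vars iid_exp_space (\<lambda>_. borel) (\<omega> m n) ({1..m} \<times> {1..n})"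
    and exp_dist: "\<And>m n i j. m \<ge> 1 \<Longrightarrow> n \<ge> 1 \<Longrightarrow> i \<in> {1..m} \<Longrightarrow> j \<in> {1..n} \<Longrightarrow>
      distributed iid_exp_space lborel (\<omega> m n (i, j)) (exponential_density (a m i + b n j))"
    and subprob: "subprobability_on_reals \<alpha>" "subprobability_on_reals \<beta>"
    and vague: "vague_convergence (empirical_distribution a) \<alpha>"
      "vague_convergence (empirical_distribution b) \<beta>"
    and endpoints: "\<aa> \<noteq> -\<infinity>" "\<bb> \<noteq> -\<infinity>" "\<aa> + \<bb> > 0"
    and mins: "(\<lambda>m. ereal (row_min a m)) \<longlonglongrightarrow> \<aa>" "(\<lambda>n. ereal (row_min b n)) \<longlonglongrightarrow> \<bb>"
    and eps: "\<epsilon> > 0"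
  shows "AE x in iid_exp_space. \<exists>L\<ge>1. \<forall>m\<ge>L. \<forall>n\<ge>L.
    \<bar>last_passage_time (\<lambda>p. \<omega> m n p x) m n - shape_function \<alpha> \<beta> \<aa> \<bb> (real m) (real n)\<bar>
      \<le> \<epsilon> * (real m + real n)"
proof -
  let ?\<Omega> = "iid_exp_space"
  interpret converging_rates a b \<alpha> \<beta> \<aa> \<bb>
    by unfold_locales (fact subprob vague endpoints mins)+
  interpret \<Omega>: prob_space ?\<Omega> by (rule prob_space_iid_exp_space)
  from deviation_bound[OF eps] obtain L c where L: "L \<ge> 1" and c: "c > 0"
    and dev: "\<And>m n. m \<ge> L \<Longrightarrow> n \<ge> L \<Longrightarrow>
    measure exp_field {X. \<epsilon> * (real m + real n) < \<bar>lpp (bulk (rate_weights (a m) (b n) X)) m n - \<gamma> (real m) (real n)\<bar>}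
      \<le> 19 * (real (m + n) + 1) * exp (- c * real (m + n))" by blast
  define G where "G m n x = lpp (bulk (\<lambda>p. \<omega> m n p x)) m n" for m n x
  have rv: "\<omega> m n (i, j) \<in> borel_measurable ?\<Omega>"
    if "m \<ge> 1" "n \<ge> 1" "i \<in> {1..m}" "j \<in> {1..n}" for m n i j
    using exp_dist[OF that] by (auto simp: distributed_def)
  have nonneg: "AE x in ?\<Omega>. 0 \<le> \<omega> m n (i, j) x" if "m \<ge> 1" "n \<ge> 1" "i \<in> {1..m}" "j \<in> {1..n}" for m n i j
  proof -
    have "AE y in density lborel (exponential_density (a m i + b n j)). 0 \<le> y"
      by (subst AE_density) (auto simp: erlang_density_def)
    then have "AE y in distr ?\<Omega> lborel (\<omega> m n (i, j)). 0 \<le> y"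
      using exp_dist[OF that] by (simp only: distributed_def)
    then show ?thesis using rv[OF that] by (subst (asm) AE_distr_iff) auto
  qed
  have "AE x in ?\<Omega>. m \<ge> 1 \<longrightarrow> n \<ge> 1 \<longrightarrow> i \<in> {1..m} \<longrightarrow> j \<in> {1..n} \<longrightarrow> 0 \<le> \<omega> m n (i, j) x" for m n i j
    using nonneg[of m n i j] by (cases "m \<ge> 1 \<and> n \<ge> 1 \<and> i \<in> {1..m} \<and> j \<in> {1..n}") auto
  then have all_nonneg: "AE x in ?\<Omega>. \<forall>m n i j. m \<ge> 1 \<longrightarrow> n \<ge> 1 \<longrightarrow> i \<in> {1..m} \<longrightarrow> j \<in> {1..n} \<longrightarrow> 0 \<le> \<omega> m n (i, j) x"
    by (simp only: AE_all_countable simp_thms)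
  have G_meas: "G m n \<in> borel_measurable ?\<Omega>" if mn: "m \<ge> L" "n \<ge> L" for m n
  proof -
    \<comment> \<open>Outside the rectangle the given weights need not even be measurable, so they
      are replaced by 0.\<close>
    have "(\<lambda>x. lpp (\<lambda>p. if p \<in> {1..m} \<times> {1..n} then \<omega> m n p x else 0) m n) \<in> borel_measurable ?\<Omega>"
    proof (rule measurable_lpp)
      fix p show "(\<lambda>x. if p \<in> {1..m} \<times> {1..n} then \<omega> m n p x else 0) \<in> borel_measurable ?\<Omega>"
        using rv[of m n] mn L by (cases p; cases "p \<in> {1..m} \<times> {1..n}") auto
    qed
    moreover have "G m n x = lpp (\<lambda>p. if p \<in> {1..m} \<times> {1..n} then \<omega> m n p x else 0) m n" for x
      unfolding G_def by (rule lpp_cong) (auto simp: bulk_def)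
    ultimately show ?thesis by (simp add: fun_eq_iff[symmetric] cong: measurable_cong)
  qed
  define D where "D m n = {x \<in> space ?\<Omega>. \<epsilon> * (real m + real n) < \<bar>G m n x - \<gamma> (real m) (real n)\<bar>}" for m n
  have D_sets: "D m n \<in> sets ?\<Omega>" if "m \<ge> L" "n \<ge> L" for m n
  proof -
    note [measurable] = G_meas[OF that]
    show ?thesis unfolding D_def by measurable
  qed
  have D_bound: "measure ?\<Omega> (D m n) \<le> 19 * (real (m + n) + 1) * exp (- c * real (m + n))" if "m \<ge> L" "n \<ge> L" for m n
  proof -
    let ?R = "\<lambda>g. \<epsilon> * (real m + real n) < \<bar>g - \<gamma> (real m) (real n)\<bar>"
    have "{g. ?R g} \<in> sets borel" by measurable
    then have "measure ?\<Omega> (D m n) = measure exp_field {X. ?R (lpp (bulk (rate_weights (a m) (b n) X)) m n)}"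
      unfolding D_def G_def using that L
      by (intro measure_lpp_transfer[OF prob_space_iid_exp_space] indep exp_dist pos) auto
    then show ?thesis using dev[OF that] by simp
  qed
  \<comment> \<open>Bad events are grouped by the antidiagonal m + n = N, because the bound decays
    in m + n. An antidiagonal has at most N + 1 pairs, hence the square in
    \<open>B_bound\<close>.\<close>
  define B where "B N = (\<Union>m\<in>{m. L \<le> m \<and> m \<le> N \<and> L \<le> N - m}. D m (N - m))" for N
  have fin: "finite {m. L \<le> m \<and> m \<le> N \<and> L \<le> N - m}" for N by (rule finite_subset[of _ "{..N}"]) auto
  have B_sets: "B N \<in> sets ?\<Omega>" for N
    unfolding B_def by (intro sets.finite_UN fin D_sets) auto
  have B_bound: "measure ?\<Omega> (B N) \<le> 19 * (real N + 1)\<^sup>2 * exp (- c * real N)" for N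
  proof -
    let ?I = "{m. L \<le> m \<and> m \<le> N \<and> L \<le> N - m}"
    have "measure ?\<Omega> (B N) \<le> (\<Sum>m\<in>?I. measure ?\<Omega> (D m (N - m)))"
      unfolding B_def by (intro measure_UNION_le fin D_sets) auto
    also have "\<dots> \<le> (\<Sum>m\<in>?I. 19 * (real N + 1) * exp (- c * real N))"
      using D_bound[of m "N - m" for m] by (intro sum_mono) fastforce
    also have "\<dots> = real (card ?I) * (19 * (real N + 1) * exp (- c * real N))" by simp
    also have "\<dots> \<le> (real N + 1) * (19 * (real N + 1) * exp (- c * real N))"
    proof (intro mult_right_mono)
      have "card ?I \<le> card {..N}" by (intro card_mono) auto
      then show "real (card ?I) \<le> real N + 1" by simp
    qed auto
    finally show ?thesis by (simp add: power2_eq_square mult_ac)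
  qed
  have "summable (\<lambda>N. measure ?\<Omega> (B N))"
    by (rule summable_comparison_test'[OF summable_poly_exp[OF c, of 19], of 0]) (use B_bound in auto)
  then have "AE x in ?\<Omega>. eventually (\<lambda>N. x \<in> space ?\<Omega> - B N) sequentially"
    by (intro borel_cantelli_AE1 B_sets) (auto simp: \<Omega>.emeasure_eq_measure)
  then show ?thesis
    using all_nonneg
  proof eventually_elim
    case (elim x)
    then obtain N0 where N0: "\<And>N. N \<ge> N0 \<Longrightarrow> x \<in> space ?\<Omega> - B N"
      unfolding eventually_sequentially by blast
    show ?case
    proof (intro exI[of _ "max L N0"] conjI allI impI)
      fix m n assume mn: "max L N0 \<le> m" "max L N0 \<le> n"
      have "last_passage_time (\<lambda>p. \<omega> m n p x) m n = G m n x"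
        unfolding G_def using elim(2) mn L by (intro last_passage_time_eq_lpp) auto
      moreover have "x \<in> space ?\<Omega> - B (m + n)" using N0[of "m + n"] mn by simp
      then have "x \<in> space ?\<Omega>" "x \<notin> D m n" using mn by (auto simp: B_def dest: spec[of _ m])
      ultimately show "\<bar>last_passage_time (\<lambda>p. \<omega> m n p x) m n - \<gamma> (real m) (real n)\<bar> \<le> \<epsilon> * (real m + real n)"
        by (auto simp: D_def)
    qed (use L in auto)
  qed
qed

end
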